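(* Let $A$ and $V$ be two bounded self-adjoint operators in an infinite dimensional Hilbert space $\mathcal{H}$ such that $V\in\mathcal{B}_2(\mathcal{H})$. Let $a=\inf\sigma(A)-\|V\|$ and $b=\sup\sigma(A)+\|V\|$. Then there exists a unique real-valued function $\eta\in L^1([a,b])$ such that for every polynomial $p(\cdot)$ on $[a,b]$ $$\mathrm{Tr}\left[p(A+V)-p(A)-D^{(1)}p(A)(V)-\tfrac12 D^{(2)}p(A)(V,V)\right]=\int_a^b p'''(\lambda)\,\eta(\lambda)\,d\lambda ,$$ and moreover $\int_a^b\eta(\lambda)\,d\lambda=\frac16\mathrm{Tr}(V^3)$.
   Context: $\mathcal{H}$ is a separable Hilbert space; $\mathcal{B}(\mathcal{H})$ is the set of bounded operators with operator norm $\|\cdot\|$; $\mathcal{B}_p(\mathcal{H})$ ($p\ge 1$) is the Schatten $p$-class with norm $\|\cdot\|_p$ ($\mathcal{B}_1$ trace class, $\mathcal{B}_2$ Hilbert-Schmidt). $\sigma(A)$ is the spectrum of $A$ and $\mathrm{Tr}$ the trace. $D^{(1)}p(A)$ and $D^{(2)}p(A)$ denote the first and second order Fréchet derivatives at $A$ of the map $T\mapsto p(T)$ on $\mathcal{B}(\mathcal{H})$ (with operator norm): $D^{(1)}p(A)(X)$ is linear in $X$ and $D^{(2)}p(A)(X,Y)$ is bilinear, being the derivative in direction $X$ of $T\mapsto D^{(1)}p(T)(Y)$ at $T=A$. *)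

theory Defs
  imports
    "HOL-Analysis.Analysis"
    "HOL-Computational_Algebra.Polynomial"
begin

class complex_vector = real_vector +
  fixes scaleC :: "complex \<Rightarrow> 'a \<Rightarrow> 'a"  (infixr "*C" 75)
  assumes scaleC_add_right: "c *C (x + y) = c *C x + c *C y"
    and scaleC_add_left: "(c + d) *C x = c *C x + d *C x"
    and scaleC_scaleC: "c *C d *C x = (c * d) *C x"
    and scaleC_one: "1 *C x = x"
    and scaleR_scaleC: "r *\<^sub>R x = complex_of_real r *C x"

global_interpretation complex_vector:
  vector_space "scaleC :: complex \<Rightarrow> 'a \<Rightarrow> 'a::complex_vector"
  by standard (simp_all add: scaleC_add_right scaleC_add_left scaleC_scaleC scaleC_one)

text \<open>The inner product is linear in its first argument. Its real part is the inner product of the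
  underlying real inner product space, which supplies positive definiteness, the norm
  \<open>norm x = sqrt (inner x x)\<close> and the topology.\<close>

class complex_inner = complex_vector + real_inner +
  fixes cinner :: "'a \<Rightarrow> 'a \<Rightarrow> complex"
  assumes cinner_commute: "cinner x y = cnj (cinner y x)"
    and cinner_add_left: "cinner (x + y) z = cinner x z + cinner y z"
    and cinner_scaleC_left: "cinner (c *C x) y = c * cinner x y"
    and inner_eq_Re_cinner: "inner x y = Re (cinner x y)"

class chilbert_space = complex_inner + complete_space

lemma cinner_scaleC_right: "cinner x (c *C y) = cnj c * cinner x y"
  by (metis cinner_commute cinner_scaleC_left complex_cnj_mult)

lemma cinner_self: "cinner x x = complex_of_real ((norm x)\<^sup>2)"
proof -
  have "Im (cinner x x) = 0"
    using arg_cong[OF cinner_commute[of x x], of Im] by simp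
  then show ?thesis
    by (simp add: complex_eq_iff inner_eq_Re_cinner[symmetric] power2_norm_eq_inner)
qed

lemma norm_scaleC: "norm (c *C x) = norm c * norm (x :: 'a::complex_inner)"
proof -
  have "complex_of_real ((norm (c *C x))\<^sup>2) = c * cnj c * cinner x x"
    by (simp only: cinner_self[symmetric] cinner_scaleC_left cinner_scaleC_right ac_simps)
  also have "\<dots> = complex_of_real ((norm c * norm x)\<^sup>2)"
    by (simp add: cinner_self complex_norm_square[symmetric] power_mult_distrib)
  finally have "(norm (c *C x))\<^sup>2 = (norm c * norm x)\<^sup>2"
    using of_real_eq_iff by blast
  then show ?thesis
    by (simp add: power2_eq_iff_nonneg)
qed

lemma bounded_linear_scaleC: "bounded_linear (\<lambda>x :: 'a::complex_inner. c *C x)"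
  by (rule bounded_linear_intro[where K = "norm c"])
    (simp_all add: scaleC_add_right scaleR_scaleC scaleC_scaleC norm_scaleC mult.commute)

lemma blinfun_eq_iff_apply: "S = T \<longleftrightarrow> (\<forall>x. blinfun_apply S x = blinfun_apply T x)"
  by (auto intro: blinfun_eqI)

definition is_onb :: "'a::chilbert_space set \<Rightarrow> bool" where
  "is_onb E \<longleftrightarrow>
     (\<forall>e\<in>E. \<forall>f\<in>E. cinner e f = (if e = f then 1 else 0)) \<and>
     closure (complex_vector.span E) = UNIV"

text \<open>Multiplication of operators is composition, and the norm is the operator norm inherited from
  the real bounded linear maps.\<close>

typedef (overloaded) 'a bop =
  "{T :: 'a::chilbert_space \<Rightarrow>\<^sub>L 'a. \<forall>c x. blinfun_apply T (c *C x) = c *C blinfun_apply T x}"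
  morphisms blinfun_of_bop bop_of_blinfun
proof
  show "(0 :: 'a \<Rightarrow>\<^sub>L 'a) \<in> {T. \<forall>c x. blinfun_apply T (c *C x) = c *C blinfun_apply T x}"
    by simp
qed

setup_lifting type_definition_bop

lift_definition bop_apply :: "'a::chilbert_space bop \<Rightarrow> 'a \<Rightarrow> 'a"  (infixr "*V" 70)
  is "blinfun_apply" .

instantiation bop :: (chilbert_space) real_normed_vector
begin

lift_definition zero_bop :: "'a bop" is "0" by simp

lift_definition plus_bop :: "'a bop \<Rightarrow> 'a bop \<Rightarrow> 'a bop" is "(+)"
  by (simp add: plus_blinfun.rep_eq scaleC_add_right)

lift_definition uminus_bop :: "'a bop \<Rightarrow> 'a bop" is "uminus"
  by (simp add: uminus_blinfun.rep_eq complex_vector.scale_minus_right)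

lift_definition minus_bop :: "'a bop \<Rightarrow> 'a bop \<Rightarrow> 'a bop" is "(-)"
  by (simp add: minus_blinfun.rep_eq complex_vector.scale_right_diff_distrib)

lift_definition scaleR_bop :: "real \<Rightarrow> 'a bop \<Rightarrow> 'a bop" is "scaleR"
  by (simp add: scaleR_blinfun.rep_eq scaleR_scaleC scaleC_scaleC mult.commute)

lift_definition norm_bop :: "'a bop \<Rightarrow> real" is "norm" .

definition dist_bop :: "'a bop \<Rightarrow> 'a bop \<Rightarrow> real"
  where "dist_bop S T = norm (S - T)"

definition sgn_bop :: "'a bop \<Rightarrow> 'a bop"
  where "sgn_bop T = inverse (norm T) *\<^sub>R T"

definition uniformity_bop :: "('a bop \<times> 'a bop) filter"
  where [code del]: "uniformity_bop = (INF e\<in>{0 <..}. principal {(x, y). dist x y < e})"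

definition open_bop :: "'a bop set \<Rightarrow> bool"
  where [code del]: "open_bop S = (\<forall>x\<in>S. \<forall>\<^sub>F (x', y) in uniformity. x' = x \<longrightarrow> y \<in> S)"

instance
proof
  fix S T U :: "'a bop" and r s :: real
  show "S + T + U = S + (T + U)" by transfer (simp add: add.assoc)
  show "S + T = T + S" by transfer (simp add: add.commute)
  show "0 + T = T" by transfer simp
  show "- T + T = 0" by transfer simp
  show "S - T = S + - T" by transfer simp
  show "r *\<^sub>R (S + T) = r *\<^sub>R S + r *\<^sub>R T" by transfer (rule scaleR_add_right)
  show "(r + s) *\<^sub>R T = r *\<^sub>R T + s *\<^sub>R T" by transfer (rule scaleR_add_left)
  show "r *\<^sub>R s *\<^sub>R T = (r * s) *\<^sub>R T" by transfer simp
  show "1 *\<^sub>R T = T" by transfer simp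
  show "dist S T = norm (S - T)" by (rule dist_bop_def)
  show "sgn T = inverse (norm T) *\<^sub>R T" by (rule sgn_bop_def)
  show "(uniformity :: ('a bop \<times> 'a bop) filter) = (INF e\<in>{0 <..}. principal {(x, y). dist x y < e})"
    by (rule uniformity_bop_def)
  show "open X = (\<forall>x\<in>X. \<forall>\<^sub>F (x', y) in uniformity. x' = x \<longrightarrow> y \<in> X)" for X :: "'a bop set"
    by (rule open_bop_def)
  show "norm T = 0 \<longleftrightarrow> T = 0" by transfer simp
  show "norm (S + T) \<le> norm S + norm T" by transfer (rule norm_triangle_ineq)
  show "norm (r *\<^sub>R T) = \<bar>r\<bar> * norm T" by transfer simp
qed

end

instantiation bop :: (chilbert_space) real_normed_algebra
begin

lift_definition times_bop :: "'a bop \<Rightarrow> 'a bop \<Rightarrow> 'a bop" is blinfun_compose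
  by simp

instance
proof
  fix S T U :: "'a bop" and r :: real
  show "S * T * U = S * (T * U)" by transfer (simp add: blinfun_eq_iff_apply)
  show "(S + T) * U = S * U + T * U"
    by transfer (simp add: blinfun_eq_iff_apply plus_blinfun.rep_eq)
  show "S * (T + U) = S * T + S * U"
    by transfer (simp add: blinfun_eq_iff_apply plus_blinfun.rep_eq blinfun.add_right)
  show "r *\<^sub>R S * T = r *\<^sub>R (S * T)"
    by transfer (simp add: blinfun_eq_iff_apply scaleR_blinfun.rep_eq)
  show "S * r *\<^sub>R T = r *\<^sub>R (S * T)"
    by transfer (simp add: blinfun_eq_iff_apply scaleR_blinfun.rep_eq blinfun.scaleR_right)
  show "norm (S * T) \<le> norm S * norm T" by transfer (rule norm_blinfun_compose)
qed

end

instantiation bop :: (chilbert_space) monoid_mult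
begin

lift_definition one_bop :: "'a bop" is id_blinfun by simp

instance
  by standard (transfer, simp add: blinfun_eq_iff_apply)+

end

instantiation bop :: (chilbert_space) complex_vector
begin

lift_definition scaleC_bop :: "complex \<Rightarrow> 'a bop \<Rightarrow> 'a bop"
  is "\<lambda>c T. Blinfun (\<lambda>x. c *C x) o\<^sub>L T"
  by (simp add: bounded_linear_Blinfun_apply bounded_linear_scaleC scaleC_scaleC mult.commute)

instance
proof
  fix S T :: "'a bop" and c d :: complex and r :: real
  note [simp] = blinfun_eq_iff_apply plus_blinfun.rep_eq scaleR_blinfun.rep_eq
    bounded_linear_Blinfun_apply bounded_linear_scaleC
  show "c *C (S + T) = c *C S + c *C T" by transfer (simp add: scaleC_add_right)
  show "(c + d) *C T = c *C T + d *C T" by transfer (simp add: scaleC_add_left)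
  show "c *C d *C T = (c * d) *C T" by transfer (simp add: scaleC_scaleC)
  show "1 *C T = T" by transfer (simp add: scaleC_one)
  show "r *\<^sub>R T = complex_of_real r *C T" by transfer (simp add: scaleR_scaleC)
qed

end

lemma bop_apply_simps:
  "(S + T) *V x = S *V x + T *V x"
  "(S - T) *V x = S *V x - T *V x"
  "(- T) *V x = - (T *V x)"
  "0 *V x = 0"
  "(S * T) *V x = S *V (T *V x)"
  "1 *V x = x"
  "(c *C T) *V x = c *C (T *V x)"
  "(r *\<^sub>R T) *V x = r *\<^sub>R (T *V x)"
  by (transfer, simp add: plus_blinfun.rep_eq minus_blinfun.rep_eq uminus_blinfun.rep_eq
      scaleR_blinfun.rep_eq bounded_linear_Blinfun_apply bounded_linear_scaleC)+

lemma norm_bop_eq_onorm: "norm T = onorm (bop_apply T)"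
  by transfer (simp add: norm_blinfun.rep_eq)

definition spectrum :: "'a::chilbert_space bop \<Rightarrow> complex set" where
  "spectrum A = {z. \<not> (\<exists>S. S * (A - z *C 1) = 1 \<and> (A - z *C 1) * S = 1)}"

definition self_adjoint :: "'a::chilbert_space bop \<Rightarrow> bool" where
  "self_adjoint T \<longleftrightarrow> (\<forall>x y. cinner (T *V x) y = cinner x (T *V y))"

definition positive_op :: "'a::chilbert_space bop \<Rightarrow> bool" where
  "positive_op T \<longleftrightarrow> self_adjoint T \<and> (\<forall>x. 0 \<le> Re (cinner (T *V x) x))"

definition adj_op :: "'a::chilbert_space bop \<Rightarrow> 'a bop" where
  "adj_op T = (THE S. \<forall>x y. cinner (T *V x) y = cinner x (S *V y))"

text \<open>The absolute value is the positive square root of \<open>T\<^sup>* T\<close>.\<close>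

definition abs_op :: "'a::chilbert_space bop \<Rightarrow> 'a bop" where
  "abs_op T = (THE P. positive_op P \<and> P * P = adj_op T * T)"

text \<open>The value of each of the following three sums does not depend on the orthonormal basis
  (for the trace: if the operator is of trace class).\<close>

definition hilbert_schmidt :: "'a::chilbert_space bop \<Rightarrow> bool" where
  "hilbert_schmidt T \<longleftrightarrow> (\<exists>E. is_onb E \<and> (\<lambda>e. (norm (T *V e))\<^sup>2) summable_on E)"

definition trace_class :: "'a::chilbert_space bop \<Rightarrow> bool" where
  "trace_class T \<longleftrightarrow> (\<exists>E. is_onb E \<and> (\<lambda>e. Re (cinner (abs_op T *V e) e)) summable_on E)"

definition trace_op :: "'a::chilbert_space bop \<Rightarrow> complex" where
  "trace_op T = (\<Sum>\<^sub>\<infinity>e\<in>(SOME E. is_onb E). cinner (T *V e) e)"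

definition poly_op :: "complex poly \<Rightarrow> 'a::chilbert_space bop \<Rightarrow> 'a bop" where
  "poly_op p T = (\<Sum>i\<le>degree p. coeff p i *C T ^ i)"

text \<open>\<open>frechet_derivative\<close> is the derivative over the reals. The map \<open>T \<mapsto> p(T)\<close> is a polynomial map with
  complex coefficients, so its real derivatives are complex-linear and coincide with the complex
  ones. \<open>D2_poly p A X Y\<close> is the derivative in direction \<open>X\<close> of \<open>T \<mapsto> D1_poly p T Y\<close> at \<open>A\<close>.\<close>

definition D1_poly :: "complex poly \<Rightarrow> 'a::chilbert_space bop \<Rightarrow> 'a bop \<Rightarrow> 'a bop" where
  "D1_poly p A X = frechet_derivative (\<lambda>T. poly_op p T) (at A) X"

definition D2_poly :: "complex poly \<Rightarrow> 'a::chilbert_space bop \<Rightarrow> 'a bop \<Rightarrow> 'a bop \<Rightarrow> 'a bop" where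
  "D2_poly p A X Y = frechet_derivative (\<lambda>T. D1_poly p T Y) (at A) X"

definition taylor_remainder :: "complex poly \<Rightarrow> 'a::chilbert_space bop \<Rightarrow> 'a bop \<Rightarrow> 'a bop" where
  "taylor_remainder p A V =
     poly_op p (A + V) - poly_op p A - D1_poly p A V - (1/2) *\<^sub>R D2_poly p A V V"

end

theory Submission
  imports Defs "HOL-Probability.Helly_Selection"
begin

text \<open>The idea is to avoid the spectral theorem. After an affine change of variables, \<open>A + t V\<close> lies between \<open>0\<close>
  and \<open>1\<close> for all \<open>t\<close> in \<open>[0, 1]\<close>. By cyclicity of the trace, half the trace of
  \<open>D2_poly p T V V\<close> is the integral over \<open>s\<close> of half the Hilbert-Schmidt inner product of
  \<open>p''(S) V\<close> and \<open>V\<close>, where \<open>S X = s T X + (1 - s) X T\<close>. The operator \<open>S\<close> is symmetric on the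
  Hilbert-Schmidt class with \<open>0 \<le> S \<le> 1\<close>, so inserting \<open>u\<^sup>k (1 - u)\<^sup>l\<close> for \<open>p''\<close> gives nonnegative
  numbers. Integrating over \<open>T = A + t V\<close> with weight \<open>1 - t\<close>, the same holds for the trace of the
  first-order Taylor remainder. By the Hausdorff moment problem both functionals of \<open>p''\<close> are
  integrals against positive measures. The two measures have the same mass, so integration by parts
  turns the difference into an integral of \<open>p'''\<close> against the difference \<open>\<eta>\<close> of their distribution
  functions, which is bounded.\<close>

section \<open>Bounded operators on a Hilbert space\<close>

text \<open>The hypothesis on \<open>V\<close> makes words with at least two letters
  \<open>V\<close> trace class and says nothing about the others, so the formula is split into two
  functionals of \<open>p''\<close> that have a trace separately. For
  \<open>p = x ^ (N + 2)\<close>, cyclicity leaves only the lengths of the two gaps between the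
  letters \<open>V\<close>, and exchanging the gaps gives every pair of lengths the same weight.
  That equally weighted sum is the divided difference of \<open>x ^ (N + 1)\<close> in left and
  right multiplication by \<open>T\<close>. All Bernstein polynomials of one degree have the same
  integral, so it is also the mean over \<open>s\<close> of the powers of \<open>S\<close>; this is
  where \<open>s\<close> comes from. Hausdorff's criterion needs positivity at every
  \<open>u ^ k * (1 - u) ^ l\<close>, hence of \<open>1 - S\<close> as well as of \<open>S\<close>.
  The margin \<open>norm V\<close> at both ends of the spectrum of \<open>A\<close> secures this for
  all \<open>t\<close> in \<open>{0..1}\<close> at once. The masses agree because the weight
  \<open>1 - t\<close> has integral \<open>1/2\<close>, the factor in front of the second
  derivative, so the integration by parts leaves no boundary term.\<close>

instance chilbert_space \<subseteq> banach ..

lemma cinner_add_right: "cinner x (y + z) = cinner x y + cinner x z"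
  by (metis cinner_commute cinner_add_left complex_cnj_add)

lemma norm_cinner_le: "norm (cinner x y) \<le> norm x * norm (y :: 'a::complex_inner)"
proof (cases "cinner x y = 0")
  case False
  \<comment> \<open>A unimodular factor that makes the product real and nonnegative, so that the
    real Cauchy-Schwarz inequality applies.\<close>
  define c where "c = cnj (cinner x y) / of_real (cmod (cinner x y))"
  have c: "norm c = 1" using False by (simp add: c_def norm_divide)
  have "c * cinner x y = of_real (cmod (cinner x y))"
    using False by (simp add: c_def mult.commute[of "cnj _"] complex_norm_square[symmetric] power2_eq_square)
  then have "cmod (cinner x y) = inner (c *C x) y"
    by (simp add: inner_eq_Re_cinner cinner_scaleC_left)
  also have "\<dots> \<le> norm (c *C x) * norm y" by (rule norm_cauchy_schwarz)
  finally show ?thesis by (simp add: norm_scaleC c)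
qed simp

interpretation cinner: bounded_bilinear "cinner :: 'a::complex_inner \<Rightarrow> 'a \<Rightarrow> complex"
proof
  show "\<exists>K. \<forall>a b :: 'a. norm (cinner a b) \<le> norm a * norm b * K"
    by (rule exI[of _ 1]) (simp add: norm_cinner_le)
qed (simp_all add: cinner_add_left cinner_add_right scaleR_scaleC cinner_scaleC_left
    cinner_scaleC_right scaleR_conv_of_real)

lemma mult_cnj_cmod: "z * cnj z = (complex_of_real (cmod z))\<^sup>2"
  using complex_norm_square[of z] by simp

lemma norm_cinner_self: "norm (cinner x x) = norm x * norm (x :: 'a::complex_inner)"
  by (simp add: cinner_self norm_mult power2_eq_square)

lemma cinner_ext: "(\<And>x. cinner x y = cinner x (z :: 'a::complex_inner)) \<Longrightarrow> y = z"
  by (metis cinner.diff_right cinner_self eq_iff_diff_eq_0 norm_eq_zero of_real_eq_0_iff zero_eq_power2)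

lemma norm_bop_apply: "norm (T *V x) \<le> norm T * norm x"
  by transfer (rule norm_blinfun)

interpretation bop: bounded_bilinear "bop_apply :: 'a::chilbert_space bop \<Rightarrow> 'a \<Rightarrow> 'a"
proof
  show "\<exists>K. \<forall>(a :: 'a bop) b. norm (a *V b) \<le> norm a * norm b * K"
    by (rule exI[of _ 1]) (simp add: norm_bop_apply)
  show "a *V (b + c) = a *V b + a *V c" for a :: "'a bop" and b c
    by transfer (rule blinfun.add_right)
  show "a *V (r *\<^sub>R b) = r *\<^sub>R (a *V b)" for a :: "'a bop" and b r
    by transfer (rule blinfun.scaleR_right)
qed (simp_all add: bop_apply_simps)

lemma bop_apply_scaleC: "T *V (c *C x) = c *C (T *V x)"
  by transfer simp

lemma bop_ext: "(\<And>x. S *V x = T *V x) \<Longrightarrow> S = T"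
  by transfer (rule blinfun_eqI)

lemma norm_bop_le:
  assumes "0 \<le> K" "\<And>x. norm (T *V x) \<le> K * norm x"
  shows "norm T \<le> K"
  using assms by transfer (rule norm_blinfun_bound)

lemma norm_one_bop: "norm (1 :: 'a::chilbert_space bop) \<le> 1"
  by (rule norm_bop_le) (simp_all add: bop_apply_simps)

lemma norm_power_bop: "norm ((T :: 'a::chilbert_space bop) ^ n) \<le> norm T ^ n"
proof (induction n)
  case (Suc n)
  have "norm (T ^ Suc n) \<le> norm T * norm (T ^ n)" by (simp add: norm_mult_ineq)
  also have "\<dots> \<le> norm T * norm T ^ n" by (intro mult_left_mono Suc) simp
  finally show ?case by simp
qed (simp add: norm_one_bop)

lemma bop_exists:
  fixes f :: "'a::chilbert_space \<Rightarrow> 'a"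
  assumes "\<And>x y. f (x + y) = f x + f y" "\<And>c x. f (c *C x) = c *C f x"
    and "\<And>x. norm (f x) \<le> norm x * K"
  shows "\<exists>T. \<forall>x. T *V x = f x"
proof -
  have bl: "bounded_linear f"
    by (rule bounded_linear_intro[where K = K]) (simp_all add: assms scaleR_scaleC)
  have "bop_of_blinfun (Blinfun f) *V x = f x" for x
    unfolding bop_apply_def by (simp add: bop_of_blinfun_inverse bounded_linear_Blinfun_apply[OF bl] assms)
  then show ?thesis by blast
qed

lemma isometry_dist_blinfun_of_bop: "dist (blinfun_of_bop S) (blinfun_of_bop T) = dist S T"
  by (simp add: dist_norm norm_bop.rep_eq minus_bop.rep_eq)

text \<open>The embedding into the real bounded linear maps is isometric, and its range is closed
  because complex homogeneity survives pointwise limits.\<close>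

instance bop :: (chilbert_space) banach
proof
  fix X :: "nat \<Rightarrow> 'a bop"
  assume X: "Cauchy X"
  then have "Cauchy (\<lambda>n. blinfun_of_bop (X n))"
    by (simp add: Cauchy_def isometry_dist_blinfun_of_bop)
  then obtain L where L: "(\<lambda>n. blinfun_of_bop (X n)) \<longlonglongrightarrow> L"
    using Cauchy_convergent convergent_def by blast
  have "blinfun_apply L (c *C x) = c *C blinfun_apply L x" for c x
  proof (rule LIMSEQ_unique)
    show "(\<lambda>n. blinfun_apply (blinfun_of_bop (X n)) (c *C x)) \<longlonglongrightarrow> blinfun_apply L (c *C x)"
      by (intro tendsto_intros L)
    have "(\<lambda>n. c *C blinfun_apply (blinfun_of_bop (X n)) x) \<longlonglongrightarrow> c *C blinfun_apply L x"
      by (intro bounded_linear.tendsto[OF bounded_linear_scaleC] tendsto_intros L)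
    moreover have "blinfun_apply (blinfun_of_bop (X n)) (c *C x) = c *C blinfun_apply (blinfun_of_bop (X n)) x" for n
      using blinfun_of_bop[of "X n"] by simp
    ultimately show "(\<lambda>n. blinfun_apply (blinfun_of_bop (X n)) (c *C x)) \<longlonglongrightarrow> c *C blinfun_apply L x"
      by simp
  qed
  then have "blinfun_of_bop (bop_of_blinfun L) = L"
    by (simp add: bop_of_blinfun_inverse)
  then have "X \<longlonglongrightarrow> bop_of_blinfun L"
    using L by (simp add: lim_sequentially flip: isometry_dist_blinfun_of_bop)
  then show "convergent X" by (rule convergentI)
qed

section \<open>Orthonormal families, Bessel's inequality and orthonormal bases\<close>

definition orthonormal :: "'a::complex_inner set \<Rightarrow> bool" where
  "orthonormal E \<longleftrightarrow> (\<forall>e\<in>E. \<forall>f\<in>E. cinner e f = (if e = f then 1 else 0))"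

lemma cinner_sum_orthonormal:
  assumes "orthonormal E" "finite F" "F \<subseteq> E" "e \<in> E"
  shows "cinner (\<Sum>f\<in>F. c f *C f) e = (if e \<in> F then c e else 0)"
proof -
  have "cinner (\<Sum>f\<in>F. c f *C f) e = (\<Sum>f\<in>F. if f = e then c f else 0)"
    unfolding cinner.sum_left
    by (intro sum.cong) (use assms in \<open>auto simp: cinner_scaleC_left orthonormal_def\<close>)
  then show ?thesis using assms(2) by simp
qed

lemma norm_sum_orthonormal:
  assumes "orthonormal E" "finite F" "F \<subseteq> E"
  shows "(norm (\<Sum>e\<in>F. c e *C e))\<^sup>2 = (\<Sum>e\<in>F. (cmod (c e))\<^sup>2)"
proof -
  let ?s = "\<Sum>e\<in>F. c e *C e"
  have "complex_of_real ((norm ?s)\<^sup>2) = cinner ?s ?s" by (simp add: cinner_self)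
  also have "\<dots> = (\<Sum>e\<in>F. cnj (c e) * cinner ?s e)"
    by (simp add: cinner.sum_right[of ?s] cinner_scaleC_right)
  also have "\<dots> = (\<Sum>e\<in>F. complex_of_real ((cmod (c e))\<^sup>2))"
    by (intro sum.cong refl) (use assms in \<open>auto simp: cinner_sum_orthonormal subset_iff mult_cnj_cmod mult.commute[of "cnj _"]\<close>)
  finally show ?thesis by (simp only: of_real_sum[symmetric] of_real_eq_iff)
qed

text \<open>By Pythagoras the finite partial sums form a Cauchy net, and the space is complete. Two
  late finite sets are compared through a common superset that is late as well.\<close>

lemma orthonormal_summable:
  fixes E :: "'a::chilbert_space set"
  assumes E: "orthonormal E" and c: "(\<lambda>e. (cmod (c e))\<^sup>2) summable_on E"
  shows "(\<lambda>e. c e *C e) summable_on E"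
proof -
  let ?f = "\<lambda>e. c e *C e" and ?g = "\<lambda>e. (cmod (c e))\<^sup>2"
  from c obtain L where L: "(sum ?g \<longlongrightarrow> L) (finite_subsets_at_top E)"
    unfolding has_sum_def summable_on_def by blast
  have "\<exists>P. eventually P (finite_subsets_at_top E) \<and>
              (\<forall>F F'. P F \<and> P F' \<longrightarrow> dist (sum ?f F) (sum ?f F') < e)" if "e > 0" for e
  proof -
    \<comment> \<open>Scalar partial sums over sets in \<open>P\<close> differ by less than
      \<open>2 * d\<close>, which is the square of \<open>e / 2\<close>.\<close>
    define d where "d = e\<^sup>2 / 8"
    have d: "d > 0" using that by (simp add: d_def)
    define P where "P F \<longleftrightarrow> finite F \<and> F \<subseteq> E \<and> dist (sum ?g F) L < d" for F
    have ev_P: "eventually P (finite_subsets_at_top E)"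
      using L d by (auto simp add: P_def[abs_def] eventually_conj_iff eventually_finite_subsets_at_top_weakI tendsto_iff)
    have "dist (sum ?f F1) (sum ?f F2) < e" if "P F1" "P F2" for F1 F2
    proof -
      from ev_P obtain F' where F': "finite F'" "F' \<subseteq> E"
        and P: "\<And>F. finite F \<and> F \<supseteq> F' \<and> F \<subseteq> E \<Longrightarrow> P F"
        by atomize_elim (simp add: eventually_finite_subsets_at_top)
      define F where "F = F' \<union> F1 \<union> F2"
      have F: "finite F" "F \<subseteq> E" "P F"
        using that F' by (auto simp: F_def P_def intro!: P[unfolded P_def, THEN conjunct2, THEN conjunct2])
      have half: "dist (sum ?f F) (sum ?f G) < e / 2" if G: "G \<subseteq> F" "P G" for G
      proof -
        have "(dist (sum ?f F) (sum ?f G))\<^sup>2 = (norm (sum ?f (F - G)))\<^sup>2"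
          unfolding dist_norm using F G by (subst sum_diff) auto
        also have "\<dots> = sum ?g (F - G)"
          using F by (intro norm_sum_orthonormal[OF E]) auto
        also have "\<dots> = sum ?g F - sum ?g G" using F G by (subst sum_diff) auto
        also have "\<dots> < 2 * d" using F(3) G(2) unfolding P_def dist_real_def by linarith
        also have "\<dots> = (e / 2)\<^sup>2" by (simp add: d_def power_divide)
        finally show ?thesis using \<open>e > 0\<close> by (meson half_gt_zero less_imp_le power_less_imp_less_base)
      qed
      have "dist (sum ?f F1) (sum ?f F2) \<le> dist (sum ?f F) (sum ?f F1) + dist (sum ?f F) (sum ?f F2)"
        by (rule dist_triangle3)
      also have "\<dots> < e / 2 + e / 2"
        by (intro add_strict_mono half that) (auto simp: F_def)
      finally show ?thesis by simp
    qed
    then show ?thesis using ev_P by blast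
  qed
  then have "cauchy_filter (filtermap (sum ?f) (finite_subsets_at_top E))"
    by (simp add: cauchy_filter_metric_filtermap)
  then obtain L' where "(sum ?f \<longlongrightarrow> L') (finite_subsets_at_top E)"
    using complete_uniform[where S = "UNIV :: 'a set"] complete_UNIV by (force simp add: filterlim_def)
  then show ?thesis using summable_on_def has_sum_def by blast
qed

text \<open>The sum is both \<open>inner x ?s\<close> and the square of \<open>norm ?s\<close>.
  Cauchy-Schwarz followed by the arithmetic-geometric mean inequality bounds it by half of itself
  plus half of the right-hand side.\<close>

lemma bessel_finite:
  assumes "orthonormal E" "finite F" "F \<subseteq> E"
  shows "(\<Sum>e\<in>F. (cmod (cinner x e))\<^sup>2) \<le> (norm x)\<^sup>2"
proof -
  let ?s = "\<Sum>e\<in>F. cinner x e *C e"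
  have "of_real (\<Sum>e\<in>F. (cmod (cinner x e))\<^sup>2) = cinner x ?s"
    by (simp add: cinner.sum_right cinner_scaleC_right mult_cnj_cmod mult.commute[of "cnj _"])
  then have "(\<Sum>e\<in>F. (cmod (cinner x e))\<^sup>2) = inner x ?s"
    by (metis inner_eq_Re_cinner Re_complex_of_real)
  also have "\<dots> \<le> norm x * norm ?s" by (rule norm_cauchy_schwarz)
  also have "\<dots> \<le> ((norm x)\<^sup>2 + (norm ?s)\<^sup>2) / 2"
    using sum_squares_bound[of "norm x" "norm ?s"] by simp
  finally show ?thesis by (simp add: norm_sum_orthonormal[OF assms])
qed

lemma summable_on_nonneg_bounded:
  fixes f :: "'a \<Rightarrow> real"
  assumes "\<And>x. x \<in> A \<Longrightarrow> 0 \<le> f x" "\<And>F. finite F \<Longrightarrow> F \<subseteq> A \<Longrightarrow> sum f F \<le> C"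
  shows "f summable_on A" "infsum f A \<le> C"
proof -
  show "f summable_on A"
    by (rule nonneg_bdd_above_summable_on) (use assms in \<open>auto intro!: bdd_aboveI2\<close>)
  then show "infsum f A \<le> C" by (rule infsum_le_finite_sums) (use assms in auto)
qed

text \<open>Stated for any orthonormal set because it serves twice: to show that a maximal one spans
  a dense subspace, and to expand vectors in a basis.\<close>

lemma orthonormal_projection:
  fixes x :: "'a::chilbert_space"
  assumes E: "orthonormal E"
  obtains y where "((\<lambda>e. cinner x e *C e) has_sum y) E" "\<And>e. e \<in> E \<Longrightarrow> cinner (x - y) e = 0"
proof -
  have "(\<lambda>e. (cmod (cinner x e))\<^sup>2) summable_on E"
    by (rule summable_on_nonneg_bounded[where C = "(norm x)\<^sup>2"]) (use bessel_finite[OF E] in auto)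
  from orthonormal_summable[OF E this] obtain y where y: "((\<lambda>e. cinner x e *C e) has_sum y) E"
    by (auto simp: summable_on_def)
  have "cinner (x - y) e = 0" if "e \<in> E" for e
  proof -
    have "((\<lambda>f. cinner (cinner x f *C f) e) has_sum cinner y e) E"
      by (rule has_sum_bounded_linear[OF cinner.bounded_linear_left y])
    moreover have "((\<lambda>f. cinner (cinner x f *C f) e) has_sum cinner x e) E"
      by (rule has_sum_finite_neutralI[of "{e}"])
        (use E that in \<open>auto simp: cinner_scaleC_left orthonormal_def\<close>)
    ultimately show ?thesis by (auto simp: cinner.diff_left dest: has_sum_unique)
  qed
  with y show ?thesis by (rule that)
qed

lemma has_sum_in_closure_span:
  fixes E :: "'a::chilbert_space set"
  assumes "((\<lambda>e. c e *C e) has_sum y) E"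
  shows "y \<in> closure (complex_vector.span E)"
proof -
  have "\<exists>z\<in>complex_vector.span E. dist z y < e" if e: "e > 0" for e
  proof -
    obtain F where F: "finite F" "F \<subseteq> E" "dist (\<Sum>e\<in>F. c e *C e) y \<le> e / 2"
      using has_sum_finite_approximation[OF assms, of "e / 2"] half_gt_zero[OF e] by blast
    moreover have "(\<Sum>e\<in>F. c e *C e) \<in> complex_vector.span E"
      using F by (intro complex_vector.span_sum complex_vector.span_scale complex_vector.span_base) auto
    ultimately show ?thesis using e by force
  qed
  then show ?thesis by (auto simp: closure_approachable)
qed

text \<open>Zorn's lemma: a nonzero residual \<open>x - y\<close>, once normalised, could be
  adjoined to a maximal orthonormal set. The trace sums over a basis picked by \<open>SOME\<close>,
  so its meaning rests on this fact.\<close>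

lemma is_onb_exists: "\<exists>E :: 'a::chilbert_space set. is_onb E"
proof -
  have "\<exists>M\<in>{E :: 'a set. orthonormal E}. \<forall>X\<in>{E. orthonormal E}. M \<subseteq> X \<longrightarrow> X = M"
  proof (rule subset_Zorn_nonempty)
    show "{E :: 'a set. orthonormal E} \<noteq> {}" by (auto simp: orthonormal_def)
    fix \<C> :: "'a set set" assume "\<C> \<noteq> {}" "subset.chain {E. orthonormal E} \<C>"
    then have orth: "\<And>X. X \<in> \<C> \<Longrightarrow> orthonormal X" and chain: "\<And>X Y. X \<in> \<C> \<Longrightarrow> Y \<in> \<C> \<Longrightarrow> X \<subseteq> Y \<or> Y \<subseteq> X"
      by (auto simp: subset_chain_def)
    have "cinner e f = (if e = f then 1 else 0)" if e: "e \<in> X" "X \<in> \<C>" and f: "f \<in> Y" "Y \<in> \<C>" for e f X Y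
    proof -
      obtain Z where "Z \<in> \<C>" "e \<in> Z" "f \<in> Z" using chain[OF e(2) f(2)] e f by blast
      then show ?thesis using orth unfolding orthonormal_def by blast
    qed
    then show "\<Union>\<C> \<in> {E. orthonormal E}"
      unfolding orthonormal_def by blast
  qed
  then obtain E :: "'a set" where E: "orthonormal E" and max: "\<And>X. orthonormal X \<Longrightarrow> E \<subseteq> X \<Longrightarrow> X = E"
    by auto
  have "x \<in> closure (complex_vector.span E)" for x
  proof -
    obtain y where y: "((\<lambda>e. cinner x e *C e) has_sum y) E" "\<And>e. e \<in> E \<Longrightarrow> cinner (x - y) e = 0"
      using orthonormal_projection[OF E] by blast
    have "x - y = 0"
    proof (rule ccontr)
      assume nz: "x - y \<noteq> 0"
      define u where "u = complex_of_real (inverse (norm (x - y))) *C (x - y)"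
      have nu: "norm u = 1" using nz by (simp add: u_def norm_scaleC norm_inverse)
      then have u1: "cinner u u = 1" by (simp add: cinner_self)
      have ue: "cinner u e = 0" "cinner e u = 0" if "e \<in> E" for e
        using y(2)[OF that] cinner_commute[of e u] by (simp_all add: u_def cinner_scaleC_left)
      have "orthonormal (insert u E)"
        using E u1 ue unfolding orthonormal_def by auto
      then have "insert u E = E" by (rule max) blast
      then have "u \<in> E" by blast
      from ue(1)[OF this] u1 show False by simp
    qed
    then show ?thesis using has_sum_in_closure_span[OF y(1)] by simp
  qed
  then have "closure (complex_vector.span E) = UNIV" by blast
  then have "is_onb E" using E unfolding is_onb_def orthonormal_def by blast
  then show ?thesis ..
qed

locale onb_space =
  fixes E :: "'a::chilbert_space set"
  assumes is_onb: "is_onb E"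
begin

lemma orthonormal: "orthonormal E"
  using is_onb by (simp add: is_onb_def orthonormal_def)

lemma norm_basis: "e \<in> E \<Longrightarrow> norm e = 1"
proof -
  assume "e \<in> E"
  then have "complex_of_real ((norm e)\<^sup>2) = 1"
    using orthonormal by (simp add: orthonormal_def del: of_real_power flip: cinner_self)
  then have "(norm e)\<^sup>2 = 1" using of_real_eq_1_iff by blast
  then show ?thesis by (simp add: power2_eq_1_iff) (use norm_ge_zero[of e] in linarith)
qed

text \<open>The vectors orthogonal to the residual \<open>x - y\<close> form a closed subspace
  containing \<open>E\<close>, hence everything, including the residual itself.\<close>

lemma expansion: "((\<lambda>e. cinner x e *C e) has_sum x) E"
proof -
  obtain y where y: "((\<lambda>e. cinner x e *C e) has_sum y) E" "\<And>e. e \<in> E \<Longrightarrow> cinner (x - y) e = 0"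
    using orthonormal_projection[OF orthonormal] by blast
  have "E \<subseteq> {z. cinner (x - y) z = 0}" using y by auto
  moreover have "complex_vector.subspace {z. cinner (x - y) z = 0}"
    by (auto simp: complex_vector.subspace_def cinner.zero_right cinner_add_right cinner_scaleC_right)
  ultimately have "complex_vector.span E \<subseteq> {z. cinner (x - y) z = 0}"
    by (rule complex_vector.span_minimal)
  moreover have "closed {z. cinner (x - y) z = 0}"
    by (intro closed_Collect_eq continuous_intros cinner.continuous_on)
  ultimately have "closure (complex_vector.span E) \<subseteq> {z. cinner (x - y) z = 0}"
    by (rule closure_minimal)
  then have "cinner (x - y) (x - y) = 0" using is_onb by (auto simp: is_onb_def)
  then show ?thesis using y(1) by (simp add: cinner_self)
qed

lemma cinner_has_sum: "((\<lambda>e. cinner x e * cinner e y) has_sum cinner x y) E"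
  using has_sum_bounded_linear[OF cinner.bounded_linear_left expansion, of x y]
  by (simp add: cinner_scaleC_left)

lemma parseval: "((\<lambda>e. (cmod (cinner x e))\<^sup>2) has_sum (norm x)\<^sup>2) E"
proof -
  have eq: "cinner x e * cinner e x = complex_of_real ((cmod (cinner x e))\<^sup>2)" for e
    by (subst cinner_commute[of e x]) (rule complex_norm_square[symmetric])
  show ?thesis
    using cinner_has_sum[of x x] unfolding eq cinner_self
    by (metis (mono_tags, lifting) has_sum_Re Re_complex_of_real has_sum_cong)
qed

end

section \<open>Adjoints\<close>

definition is_adj :: "'a::chilbert_space bop \<Rightarrow> 'a bop \<Rightarrow> bool" where
  "is_adj T S \<longleftrightarrow> (\<forall>x y. cinner (T *V x) y = cinner x (S *V y))"

text \<open>The adjoint is built from its coefficients in a basis. They are square summable by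
  duality: a finite sum of their squares equals \<open>cinner y (T *V ?z)\<close>, where
  \<open>?z\<close> has those coefficients, so it is at most \<open>norm y * norm T\<close> times
  its own square root.\<close>

lemma is_adj_exists: "\<exists>S. is_adj (T :: 'a::chilbert_space bop) S"
proof -
  obtain E :: "'a set" where "is_onb E" using is_onb_exists by blast
  then interpret onb_space E by unfold_locales
  define f where "f y = (\<Sum>\<^sub>\<infinity>e\<in>E. cinner y (T *V e) *C e)" for y
  have bound: "(\<Sum>e\<in>F. (cmod (cinner y (T *V e)))\<^sup>2) \<le> (norm y * norm T)\<^sup>2" if "finite F" "F \<subseteq> E" for F y
  proof -
    let ?z = "\<Sum>e\<in>F. cinner y (T *V e) *C e" and ?s = "\<Sum>e\<in>F. (cmod (cinner y (T *V e)))\<^sup>2"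
    have nz: "(norm ?z)\<^sup>2 = ?s" by (rule norm_sum_orthonormal[OF orthonormal that])
    have "complex_of_real ?s = cinner y (T *V ?z)"
      by (simp add: bop.sum_right bop_apply_scaleC cinner.sum_right cinner_scaleC_right
          mult_cnj_cmod mult.commute[of "cnj _"])
    then have "norm (cinner y (T *V ?z)) = norm (complex_of_real ?s)" by simp
    also have "norm (complex_of_real ?s) = ?s"
      by (simp only: norm_of_real) (simp add: sum_nonneg)
    finally have "?s = norm (cinner y (T *V ?z))" ..
    also have "\<dots> \<le> norm y * norm (T *V ?z)" by (rule norm_cinner_le)
    also have "\<dots> \<le> norm y * (norm T * norm ?z)" by (intro mult_left_mono norm_bop_apply) simp
    also have "\<dots> = (norm y * norm T) * norm ?z" by simp
    also have "\<dots> \<le> ((norm y * norm T)\<^sup>2 + (norm ?z)\<^sup>2) / 2"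
      using sum_squares_bound[of "norm y * norm T" "norm ?z"] by simp
    finally show ?thesis unfolding nz by simp
  qed
  have hs: "((\<lambda>e. cinner y (T *V e) *C e) has_sum f y) E" for y
    unfolding f_def
    by (intro has_sum_infsum orthonormal_summable[OF orthonormal]
        summable_on_nonneg_bounded(1)[where C = "(norm y * norm T)\<^sup>2"] bound) auto
  have f: "cinner x (f y) = cinner (T *V x) y" for x y
  proof -
    have "((\<lambda>e. cinner x (cinner y (T *V e) *C e)) has_sum cinner x (f y)) E"
      by (rule has_sum_bounded_linear[OF cinner.bounded_linear_right hs])
    moreover have "((\<lambda>e. cinner (T *V (cinner x e *C e)) y) has_sum cinner (T *V x) y) E"
      by (rule has_sum_bounded_linear[OF cinner.bounded_linear_left
            has_sum_bounded_linear[OF bop.bounded_linear_right expansion]])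
    moreover have "cinner x (cinner y (T *V e) *C e) = cinner (T *V (cinner x e *C e)) y" for e
      using cinner_commute[of y "T *V e"]
      by (simp add: bop_apply_scaleC cinner_scaleC_left cinner_scaleC_right mult.commute)
    ultimately show ?thesis by (auto dest: has_sum_unique)
  qed
  have "\<exists>S. \<forall>y. S *V y = f y"
  proof (rule bop_exists)
    show "f (x + y) = f x + f y" for x y
      by (rule cinner_ext) (simp add: f cinner_add_right)
    show "f (c *C x) = c *C f x" for c x
      by (rule cinner_ext) (simp add: f cinner_scaleC_right)
    show "norm (f y) \<le> norm y * norm T" for y
    proof (cases "f y = 0")
      case False
      have "norm (f y) * norm (f y) = norm (cinner (f y) (f y))"
        by (simp add: norm_cinner_self)
      also have "\<dots> = norm (cinner (T *V f y) y)" by (simp add: f)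
      also have "\<dots> \<le> norm (T *V f y) * norm y" by (rule norm_cinner_le)
      also have "\<dots> \<le> (norm T * norm (f y)) * norm y" by (intro mult_right_mono norm_bop_apply) simp
      finally have "norm (f y) * norm (f y) \<le> norm (f y) * (norm y * norm T)" by (simp add: ac_simps)
      then show ?thesis using False by simp
    qed simp
  qed
  then show ?thesis unfolding is_adj_def using f by metis
qed

lemma is_adj_unique: "is_adj T S \<Longrightarrow> is_adj T S' \<Longrightarrow> S = S'"
  unfolding is_adj_def by (metis bop_ext cinner_ext)

lemma adj_op_eqI: "is_adj T S \<Longrightarrow> adj_op T = S"
  unfolding adj_op_def is_adj_def[symmetric] by (rule the_equality) (auto dest: is_adj_unique)

lemma cinner_adj_right: "cinner x (adj_op T *V y) = cinner (T *V x) y"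
  using is_adj_exists[of T] adj_op_eqI[of T] unfolding is_adj_def by metis

lemma cinner_adj_left: "cinner (adj_op T *V x) y = cinner x (T *V y)"
  by (metis cinner_adj_right cinner_commute)

lemma adj_adj [simp]: "adj_op (adj_op T) = T"
  by (rule adj_op_eqI) (simp add: is_adj_def cinner_adj_left)

lemma adj_mult: "adj_op (S * T) = adj_op T * adj_op S"
  by (rule adj_op_eqI) (simp add: is_adj_def cinner_adj_right bop_apply_simps)

lemma adj_self_adjoint: "self_adjoint T \<Longrightarrow> adj_op T = T"
  by (rule adj_op_eqI) (simp add: is_adj_def self_adjoint_def)

lemma self_adjointD: "self_adjoint T \<Longrightarrow> cinner (T *V x) y = cinner x (T *V y)"
  by (simp add: self_adjoint_def)

lemma norm_adj: "norm (adj_op T) \<le> norm T"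
proof (rule norm_bop_le)
  fix y
  show "norm (adj_op T *V y) \<le> norm T * norm y"
  proof (cases "adj_op T *V y = 0")
    case False
    let ?z = "adj_op T *V y"
    have "norm ?z * norm ?z = norm (cinner ?z ?z)"
      by (simp add: norm_cinner_self)
    also have "\<dots> = norm (cinner (T *V ?z) y)" by (simp add: cinner_adj_right)
    also have "\<dots> \<le> norm (T *V ?z) * norm y" by (rule norm_cinner_le)
    also have "\<dots> \<le> (norm T * norm ?z) * norm y" by (intro mult_right_mono norm_bop_apply) simp
    finally have "norm ?z * norm ?z \<le> norm ?z * (norm T * norm y)" by (simp add: ac_simps)
    then show ?thesis using False by simp
  qed simp
qed simp

section \<open>Inverses, spectrum and square roots\<close>

lemma neumann_inverse:
  fixes N :: "'a::chilbert_space bop"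
  assumes "norm N < 1"
  shows "\<exists>S. S * (1 - N) = 1 \<and> (1 - N) * S = 1"
proof -
  have sum: "summable (\<lambda>n. N ^ n)"
    by (rule summable_comparison_test'[of "\<lambda>n. norm N ^ n"]) (use assms in \<open>auto intro: summable_geometric norm_power_bop\<close>)
  define S where "S = (\<Sum>n. N ^ n)"
  have shift: "(\<Sum>n. N ^ Suc n) = S - 1"
    using suminf_split_head[OF sum] by (simp add: S_def)
  have "N * S = (\<Sum>n. N ^ Suc n)"
    using bounded_linear.suminf[OF bounded_linear_mult_right sum, of N] by (simp add: S_def)
  moreover have "S * N = (\<Sum>n. N ^ Suc n)"
    using bounded_linear.suminf[OF bounded_linear_mult_left sum, of N] by (simp add: S_def power_commutes)
  ultimately have "S * (1 - N) = 1" "(1 - N) * S = 1"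
    by (simp_all only: shift left_diff_distrib right_diff_distrib) simp_all
  then show ?thesis by blast
qed

text \<open>The Lax-Milgram theorem: a damped step \<open>1 - \<tau> *\<^sub>R T\<close> is a strict
  contraction, so the Neumann series inverts a positive multiple of \<open>T\<close>.\<close>

lemma coercive_invertible:
  fixes T :: "'a::chilbert_space bop"
  assumes c: "c > 0" and coercive: "\<And>x. c * (norm x)\<^sup>2 \<le> Re (cinner (T *V x) x)"
  shows "\<exists>S. S * T = 1 \<and> T * S = 1"
proof -
  \<comment> \<open>Since \<open>M\<close> bounds the square of \<open>norm T\<close>, the squared
    contraction factor is at most \<open>1 - 2 * \<tau> * c + \<tau>\<^sup>2 * M\<close>, which is
    least at \<open>\<tau> = c / M\<close>. The summand \<open>c\<^sup>2\<close> in \<open>M\<close>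
    keeps the minimum \<open>1 - c\<^sup>2 / M\<close> nonnegative.\<close>
  define M where "M = (norm T)\<^sup>2 + c\<^sup>2"
  define \<tau> where "\<tau> = c / M"
  have M: "M > 0" using c by (simp add: M_def add_nonneg_pos)
  have \<tau>: "\<tau> > 0" using c M by (simp add: \<tau>_def)
  have cM: "c\<^sup>2 / M \<le> 1" using M by (simp add: M_def)
  define N where "N = 1 - \<tau> *\<^sub>R T"
  have "norm N \<le> sqrt (1 - c\<^sup>2 / M)"
  proof (rule norm_bop_le)
    fix x
    have "(norm (N *V x))\<^sup>2 = (norm x)\<^sup>2 - 2 * \<tau> * Re (cinner (T *V x) x) + \<tau>\<^sup>2 * (norm (T *V x))\<^sup>2"
      by (simp only: N_def bop_apply_simps power2_norm_eq_inner flip: inner_eq_Re_cinner)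
        (simp add: inner_diff_left inner_diff_right inner_commute[of x "T *V x"] power2_eq_square algebra_simps)
    also have "\<dots> \<le> (norm x)\<^sup>2 - 2 * \<tau> * (c * (norm x)\<^sup>2) + \<tau>\<^sup>2 * (M * (norm x)\<^sup>2)"
    proof -
      have "(norm (T *V x))\<^sup>2 \<le> (norm T * norm x)\<^sup>2" by (intro power_mono norm_bop_apply) simp
      also have "\<dots> \<le> M * (norm x)\<^sup>2" by (simp add: M_def power_mult_distrib algebra_simps)
      finally have "\<tau>\<^sup>2 * (norm (T *V x))\<^sup>2 \<le> \<tau>\<^sup>2 * (M * (norm x)\<^sup>2)" by (intro mult_left_mono) auto
      moreover have "2 * \<tau> * (c * (norm x)\<^sup>2) \<le> 2 * \<tau> * Re (cinner (T *V x) x)"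
        using \<tau> coercive by (intro mult_left_mono) auto
      ultimately show ?thesis by linarith
    qed
    also have "\<dots> = (1 - c\<^sup>2 / M) * (norm x)\<^sup>2"
      using M by (simp add: \<tau>_def field_simps power2_eq_square)
    also have "\<dots> = (sqrt (1 - c\<^sup>2 / M) * norm x)\<^sup>2"
      using cM by (simp add: power_mult_distrib)
    finally show "norm (N *V x) \<le> sqrt (1 - c\<^sup>2 / M) * norm x"
      by (rule power2_le_imp_le) (use cM in simp)
  qed (use cM in simp)
  also have "\<dots> < 1" using c M by simp
  finally obtain S where S: "S * (1 - N) = 1" "(1 - N) * S = 1" using neumann_inverse by blast
  then have "(\<tau> *\<^sub>R S) * T = 1 \<and> T * (\<tau> *\<^sub>R S) = 1" by (simp add: N_def)
  then show ?thesis by blast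
qed

section \<open>Quadratic forms and the ends of the spectrum\<close>

lemma Re_cinner_le: "\<bar>Re (cinner (T *V x) x)\<bar> \<le> norm T * (norm x)\<^sup>2"
proof -
  have "\<bar>Re (cinner (T *V x) x)\<bar> \<le> norm (T *V x) * norm x"
    by (rule order_trans[OF abs_Re_le_cmod norm_cinner_le])
  also have "\<dots> \<le> norm T * norm x * norm x" by (intro mult_right_mono norm_bop_apply) simp
  finally show ?thesis by (simp add: power2_eq_square mult.assoc)
qed

lemma positive_opD: "positive_op T \<Longrightarrow> 0 \<le> Re (cinner (T *V x) x)"
  by (simp add: positive_op_def)

text \<open>The quadratic form is nonnegative at \<open>x - t *\<^sub>R (T *V x)\<close>;
  \<open>t = 1 / norm T\<close> minimises the resulting upper bound.\<close>

lemma positive_op_norm_apply: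
  assumes T: "positive_op T"
  shows "(norm (T *V x))\<^sup>2 \<le> norm T * Re (cinner (T *V x) x)"
proof (cases "norm T = 0")
  case False
  then have pos: "norm T > 0" by simp
  let ?y = "T *V x"
  define t where "t = 1 / norm T"
  have sa: "Re (cinner (T *V ?y) x) = (norm ?y)\<^sup>2"
    using T by (simp add: positive_op_def self_adjointD cinner_self flip: of_real_power)
  have "0 \<le> Re (cinner (T *V (x - t *\<^sub>R ?y)) (x - t *\<^sub>R ?y))" by (rule positive_opD[OF T])
  also have "\<dots> = Re (cinner ?y x) - 2 * t * (norm ?y)\<^sup>2 + t\<^sup>2 * Re (cinner (T *V ?y) ?y)"
    using sa by (simp add: bop.diff_right bop.scaleR_right cinner.diff_left cinner.diff_right
        cinner.scaleR_left cinner.scaleR_right cinner_self power2_eq_square algebra_simps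
        del: of_real_power of_real_mult flip: of_real_mult)
  also have "\<dots> \<le> Re (cinner ?y x) - 2 * t * (norm ?y)\<^sup>2 + t\<^sup>2 * (norm T * (norm ?y)\<^sup>2)"
    using Re_cinner_le[of T ?y] by (intro add_left_mono mult_left_mono) auto
  also have "\<dots> = Re (cinner ?y x) - (norm ?y)\<^sup>2 / norm T"
    using pos by (simp add: t_def power2_eq_square)
  finally show ?thesis using pos by (simp add: field_simps)
qed (simp add: bop_apply_simps)

text \<open>The previous estimate bounds \<open>norm T\<close> by the geometric mean of
  \<open>norm T\<close> and \<open>K\<close>.\<close>

lemma positive_op_norm_le:
  assumes T: "positive_op T" and "\<And>x. Re (cinner (T *V x) x) \<le> K * (norm x)\<^sup>2" and K: "0 \<le> K"
  shows "norm T \<le> K"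
proof (cases "norm T = 0")
  case False
  have "norm T \<le> sqrt (norm T * K)"
  proof (rule norm_bop_le)
    fix x
    have "(norm (T *V x))\<^sup>2 \<le> norm T * (K * (norm x)\<^sup>2)"
      by (rule order_trans[OF positive_op_norm_apply[OF T]]) (intro mult_left_mono assms, simp)
    also have "\<dots> = (sqrt (norm T * K) * norm x)\<^sup>2"
      using K by (simp add: power_mult_distrib)
    finally show "norm (T *V x) \<le> sqrt (norm T * K) * norm x"
      by (rule power2_le_imp_le) (simp add: K)
  qed (use K in simp)
  then have "norm T * norm T \<le> norm T * K"
    using sqrt_ge_absD[of "norm T"] by (simp add: power2_eq_square)
  then show ?thesis using False by simp
qed (use K in simp)

lemma spectrum_lower_bound:
  fixes A :: "'a::chilbert_space bop"
  assumes "\<And>x. m * (norm x)\<^sup>2 \<le> Re (cinner (A *V x) x)" and z: "z \<in> spectrum A"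
  shows "m \<le> Re z"
proof (rule ccontr)
  assume "\<not> m \<le> Re z"
  then have "m - Re z > 0" by simp
  moreover have "(m - Re z) * (norm x)\<^sup>2 \<le> Re (cinner ((A - z *C 1) *V x) x)" for x
  proof -
    have "Re (cinner ((A - z *C 1) *V x) x) = Re (cinner (A *V x) x) - Re z * (norm x)\<^sup>2"
      by (simp add: bop_apply_simps cinner.diff_left cinner_scaleC_left cinner_self del: of_real_power)
    then show ?thesis using assms(1)[of x] by (simp add: left_diff_distrib)
  qed
  ultimately have "\<exists>S. S * (A - z *C 1) = 1 \<and> (A - z *C 1) * S = 1"
    by (rule coercive_invertible)
  with z show False unfolding spectrum_def by blast
qed

text \<open>Take for \<open>m\<close> the infimum of the quadratic form on the unit sphere. If
  \<open>B = A - m\<close> had an inverse \<open>S\<close>, then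
  \<open>positive_op_norm_apply\<close> would keep the form of \<open>B\<close> away from zero on
  unit vectors, against the choice of \<open>m\<close>.\<close>

lemma spectrum_numerical_infimum:
  fixes A :: "'a::chilbert_space bop"
  assumes A: "self_adjoint A" and nontriv: "\<exists>x :: 'a. x \<noteq> 0"
  obtains m :: real where "of_real m \<in> spectrum A" "\<And>x. m * (norm x)\<^sup>2 \<le> Re (cinner (A *V x) x)"
proof -
  define q where "q x = Re (cinner (A *V x) x)" for x
  define Q where "Q = q ` {x. norm x = 1}"
  define m where "m = Inf Q"
  obtain x0 :: 'a where "x0 \<noteq> 0" using nontriv by blast
  then have "norm (x0 /\<^sub>R norm x0) = 1" by simp
  then have ne: "Q \<noteq> {}" unfolding Q_def by blast
  have bdd: "bdd_below Q"
    using Re_cinner_le[of A] by (auto simp: Q_def q_def intro!: bdd_belowI2[where m = "- norm A"]) (smt (verit) mult_cancel_left1 power_one)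
  have lower: "m * (norm x)\<^sup>2 \<le> q x" for x
  proof (cases "x = 0")
    case False
    have "m \<le> q (x /\<^sub>R norm x)"
      unfolding m_def by (rule cInf_lower[OF _ bdd]) (use False in \<open>auto simp: Q_def\<close>)
    also have "\<dots> = q x / (norm x)\<^sup>2"
      by (simp add: q_def bop.scaleR_right cinner.scaleR_left cinner.scaleR_right power2_eq_square divide_inverse)
    finally show ?thesis using False by (simp add: field_simps)
  qed (simp add: q_def cinner.zero_right)
  define B where "B = A - complex_of_real m *C 1"
  have Bx: "cinner (B *V x) y = cinner (A *V x) y - m * cinner x y" for x y
    by (simp add: B_def bop_apply_simps cinner.diff_left cinner_scaleC_left)
  have B: "positive_op B"
    unfolding positive_op_def self_adjoint_def
  proof (intro conjI allI)
    fix x y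
    show "cinner (B *V x) y = cinner x (B *V y)"
      unfolding cinner_commute[of x "B *V y"] Bx by (simp add: self_adjointD[OF A] flip: cinner_commute)
    show "0 \<le> Re (cinner (B *V x) x)"
      using lower[of x] by (simp add: Bx q_def cinner_self del: of_real_power flip: of_real_mult)
  qed
  have "of_real m \<in> spectrum A"
  proof (rule ccontr)
    assume "of_real m \<notin> spectrum A"
    then obtain S where S: "S * B = 1" by (auto simp: spectrum_def B_def)
    \<comment> \<open>An inverse forces \<open>1 \<le> K * (q x - m)\<close> at unit vectors; the
      tolerance \<open>1 / (K + 1)\<close> chosen next contradicts this and is meaningful even for
      \<open>K = 0\<close>.\<close>
    define K where "K = (norm S)\<^sup>2 * norm B"
    have K0: "K \<ge> 0" by (simp add: K_def)
    have "\<exists>y\<in>Q. y < m + 1 / (K + 1)"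
      using cInf_lessD[OF ne, of "m + 1 / (K + 1)"] K0 by (auto simp: m_def)
    then obtain x where x: "norm x = 1" "q x < m + 1 / (K + 1)" by (auto simp: Q_def)
    have "1 = (norm (S *V (B *V x)))\<^sup>2" using S x by (simp flip: bop_apply_simps(5)) (simp add: bop_apply_simps)
    also have "\<dots> \<le> (norm S * norm (B *V x))\<^sup>2" by (intro power_mono norm_bop_apply) simp
    also have "\<dots> = (norm S)\<^sup>2 * (norm (B *V x))\<^sup>2" by (simp add: power_mult_distrib)
    also have "\<dots> \<le> (norm S)\<^sup>2 * (norm B * Re (cinner (B *V x) x))"
      by (intro mult_left_mono positive_op_norm_apply B) simp
    also have "\<dots> = K * (q x - m)"
      using x by (simp add: K_def Bx q_def cinner_self)
    also have "\<dots> \<le> K * (1 / (K + 1))"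
      using x K0 by (intro mult_left_mono) auto
    also have "\<dots> < 1" using K0 by (simp add: field_simps)
    finally show False by simp
  qed
  with lower show ?thesis using that by (simp add: q_def)
qed

lemma spectrum_uminus: "z \<in> spectrum (- A) \<Longrightarrow> - z \<in> spectrum A"
proof -
  assume z: "z \<in> spectrum (- A)"
  have eq: "- A - z *C 1 = - (A - (- z) *C 1)"
    by (simp add: complex_vector.scale_minus_left)
  have "S * (A - (- z) *C 1) = 1 \<and> (A - (- z) *C 1) * S = 1 \<Longrightarrow>
      (- S) * (- A - z *C 1) = 1 \<and> (- A - z *C 1) * (- S) = 1" for S
    unfolding eq by (simp only: minus_mult_minus) 
  then show ?thesis using z unfolding spectrum_def mem_Collect_eq by (elim contrapos_nn exE) (rule exI)
qed

lemma self_adjoint_uminus: "self_adjoint A \<Longrightarrow> self_adjoint (- A)"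
  by (simp add: self_adjoint_def bop_apply_simps cinner.minus_left cinner.minus_right)

text \<open>Apply the infimum lemma to \<open>A\<close> and to \<open>- A\<close>. The spectrum must
  be shown nonempty and bounded, since \<open>Inf\<close> and \<open>Sup\<close> of a real set carry
  no information otherwise.\<close>

lemma spectrum_bounds:
  fixes A :: "'a::chilbert_space bop"
  assumes A: "self_adjoint A" and nontriv: "\<exists>x :: 'a. x \<noteq> 0"
  shows "Inf (Re ` spectrum A) * (norm x)\<^sup>2 \<le> Re (cinner (A *V x) x)"
    and "Re (cinner (A *V x) x) \<le> Sup (Re ` spectrum A) * (norm x)\<^sup>2"
    and "Inf (Re ` spectrum A) \<le> Sup (Re ` spectrum A)"
proof -
  obtain m where m: "of_real m \<in> spectrum A" "\<And>x. m * (norm x)\<^sup>2 \<le> Re (cinner (A *V x) x)"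
    using spectrum_numerical_infimum[OF A nontriv] by blast
  obtain m' where m': "of_real m' \<in> spectrum (- A)" "\<And>x. m' * (norm x)\<^sup>2 \<le> Re (cinner (- A *V x) x)"
    using spectrum_numerical_infimum[OF self_adjoint_uminus[OF A] nontriv] by blast
  have mem: "m \<in> Re ` spectrum A" "- m' \<in> Re ` spectrum A"
    using imageI[OF m(1), of Re] imageI[OF spectrum_uminus[OF m'(1)], of Re] by simp_all
  have "- norm A * (norm x)\<^sup>2 \<le> Re (cinner (A *V x) x)" for x
    using Re_cinner_le[of A x] by linarith
  from spectrum_lower_bound[OF this] have bdd: "bdd_below (Re ` spectrum A)"
    by (auto intro!: bdd_belowI)
  have "- norm A * (norm x)\<^sup>2 \<le> Re (cinner (- A *V x) x)" for x
    using Re_cinner_le[of A x] by (simp add: bop_apply_simps cinner.minus_left)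
  note lower' = spectrum_lower_bound[OF this]
  have bdd': "bdd_above (Re ` spectrum A)"
  proof (rule bdd_aboveI2)
    fix z assume "z \<in> spectrum A"
    then have "- z \<in> spectrum (- A)" using spectrum_uminus[of "- z" "- (- A)"] spectrum_uminus[of z "- A"] by simp
    from lower'[OF this] show "Re z \<le> norm A" by simp
  qed
  have I: "Inf (Re ` spectrum A) \<le> m" by (rule cInf_lower[OF mem(1) bdd])
  have S: "- m' \<le> Sup (Re ` spectrum A)" by (rule cSup_upper[OF mem(2) bdd'])
  show "Inf (Re ` spectrum A) * (norm x)\<^sup>2 \<le> Re (cinner (A *V x) x)"
    using order_trans[OF mult_right_mono[OF I] m(2)] by simp
  show "Re (cinner (A *V x) x) \<le> Sup (Re ` spectrum A) * (norm x)\<^sup>2"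
    using mult_right_mono[OF S, of "(norm x)\<^sup>2"] m'(2)[of x] by (simp add: bop_apply_simps cinner.minus_left)
  show "Inf (Re ` spectrum A) \<le> Sup (Re ` spectrum A)"
    using order_trans[OF cInf_lower[OF mem(1) bdd] cSup_upper[OF mem(1) bdd']] .
qed

section \<open>Self-adjoint operators and positive square roots\<close>

lemma self_adjoint_add: "self_adjoint S \<Longrightarrow> self_adjoint T \<Longrightarrow> self_adjoint (S + T)"
  by (simp add: self_adjoint_def bop_apply_simps cinner.add_left cinner.add_right)

lemma self_adjoint_diff: "self_adjoint S \<Longrightarrow> self_adjoint T \<Longrightarrow> self_adjoint (S - T)"
  by (simp add: self_adjoint_def bop_apply_simps cinner.diff_left cinner.diff_right)

lemma self_adjoint_one: "self_adjoint 1"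
  by (simp add: self_adjoint_def bop_apply_simps)

lemma self_adjoint_scaleR: "self_adjoint T \<Longrightarrow> self_adjoint (r *\<^sub>R T)"
  by (simp add: self_adjoint_def bop_apply_simps cinner.scaleR_left cinner.scaleR_right)

lemma self_adjoint_power: "self_adjoint T \<Longrightarrow> self_adjoint (T ^ n)"
proof (induction n)
  case (Suc n)
  show ?case
    unfolding self_adjoint_def
  proof (intro allI)
    fix x y
    have "cinner (T ^ Suc n *V x) y = cinner x (T ^ n *V (T *V y))"
      using Suc by (simp add: bop_apply_simps self_adjointD)
    also have "T ^ n *V (T *V y) = T ^ Suc n *V y"
      by (simp only: power_Suc2 bop_apply_simps)
    finally show "cinner (T ^ Suc n *V x) y = cinner x (T ^ Suc n *V y)" .
  qed
qed (simp add: self_adjoint_one)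

text \<open>The Taylor coefficients of \<open>\<lambda>x. sqrt (1 - x)\<close>.\<close>

definition sqrt_coeff :: "nat \<Rightarrow> real" where
  "sqrt_coeff n = (-1) ^ n * ((1/2) gchoose n)"

lemma sqrt_coeff_0 [simp]: "sqrt_coeff 0 = 1"
  by (simp add: sqrt_coeff_def)

lemma sqrt_coeff_nonpos: "n > 0 \<Longrightarrow> sqrt_coeff n \<le> 0"
proof -
  assume "n > 0"
  then obtain m where n: "n = Suc m" by (cases n) auto
  have "sqrt_coeff n = pochhammer (-1/2) n / fact n"
    by (simp add: sqrt_coeff_def gbinomial_pochhammer flip: power_mult_distrib mult.assoc power_add)
  also have "\<dots> = - (pochhammer (1/2) m / (2 * fact n))"
    by (simp add: n pochhammer_rec)
  also have "\<dots> \<le> 0" by (simp add: pochhammer_nonneg)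
  finally show ?thesis .
qed

text \<open>Partial sums of the coefficients of \<open>sqrt (1 - x)\<close> are the coefficients of
  the quotient by \<open>1 - x\<close>, that is of \<open>1 / sqrt (1 - x)\<close>, which are
  positive. As all coefficients after the first are nonpositive, this bounds their absolute sum by
  one and gives convergence on the closed unit ball.\<close>

lemma sum_sqrt_coeff_nonneg: "0 \<le> (\<Sum>k\<le>n. sqrt_coeff k)"
proof -
  have "(\<Sum>k\<le>n. sqrt_coeff k) = (-1) ^ n * ((1/2 - 1) gchoose n)"
    using gbinomial_sum_lower_neg[of "1/2 :: real" n] by (simp add: sqrt_coeff_def mult.commute)
  also have "\<dots> = pochhammer (1/2) n / fact n"
    by (simp add: gbinomial_pochhammer flip: power_mult_distrib mult.assoc power_add)
  also have "\<dots> \<ge> 0" by (simp add: pochhammer_nonneg)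
  finally show ?thesis .
qed

text \<open>The Cauchy square of the series is \<open>1 - x\<close>: Vandermonde's identity with
  upper index \<open>1/2 + 1/2 = 1\<close>.\<close>

lemma sqrt_coeff_convolution:
  "(\<Sum>k\<le>n. sqrt_coeff k * sqrt_coeff (n - k)) = (if n = 0 then 1 else if n = 1 then -1 else 0)"
proof -
  have "(\<Sum>k\<le>n. sqrt_coeff k * sqrt_coeff (n - k))
      = (\<Sum>k\<le>n. (-1) ^ n * (((1/2) gchoose k) * ((1/2) gchoose (n - k))))"
  proof (intro sum.cong refl)
    fix k assume "k \<in> {..n}"
    then have "(-1::real) ^ n = (-1) ^ k * (-1) ^ (n - k)" by (simp flip: power_add)
    then show "sqrt_coeff k * sqrt_coeff (n - k) = (-1) ^ n * (((1/2) gchoose k) * ((1/2) gchoose (n - k)))"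
      by (simp add: sqrt_coeff_def)
  qed
  also have "\<dots> = (-1) ^ n * (((1/2 + 1/2) :: real) gchoose n)"
    by (simp only: gbinomial_Vandermonde[symmetric] atMost_atLeast0 sum_distrib_left)
  also have "((1/2 + 1/2) :: real) gchoose n = of_nat (1 choose n)"
    by (simp add: binomial_gbinomial)
  also have "(-1) ^ n * real (1 choose n) = (if n = 0 then 1 else if n = 1 then -1 else 0)"
    by (auto simp: binomial_eq_0)
  finally show ?thesis .
qed

lemma sqrt_coeff_tail: "summable (\<lambda>n. \<bar>sqrt_coeff n\<bar>)" "(\<Sum>n. \<bar>sqrt_coeff (Suc n)\<bar>) \<le> 1"
proof -
  have le: "(\<Sum>k<n. \<bar>sqrt_coeff (Suc k)\<bar>) \<le> 1" for n
  proof -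
    have "(\<Sum>k\<le>n. sqrt_coeff k) = 1 + (\<Sum>k<n. sqrt_coeff (Suc k))"
      by (simp add: sum.atMost_shift)
    moreover have "(\<Sum>k<n. \<bar>sqrt_coeff (Suc k)\<bar>) = - (\<Sum>k<n. sqrt_coeff (Suc k))"
      unfolding sum_negf[symmetric] by (intro sum.cong refl abs_of_nonpos sqrt_coeff_nonpos) simp
    ultimately show ?thesis using sum_sqrt_coeff_nonneg[of n] by linarith
  qed
  have s: "summable (\<lambda>n. \<bar>sqrt_coeff (Suc n)\<bar>)"
    by (rule bounded_imp_summable[where B = 1]) (simp_all add: le flip: lessThan_Suc_atMost del: sum.lessThan_Suc)
  then show "summable (\<lambda>n. \<bar>sqrt_coeff n\<bar>)" by (subst (asm) summable_Suc_iff)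
  show "(\<Sum>n. \<bar>sqrt_coeff (Suc n)\<bar>) \<le> 1" by (rule suminf_le_const[OF s le])
qed

lemma sqrt_one_minus_exists:
  fixes N :: "'a::chilbert_space bop"
  assumes N: "self_adjoint N" "norm N \<le> 1"
  obtains R where "positive_op R" "R * R = 1 - N" "\<And>S. S * N = N * S \<Longrightarrow> S * R = R * S"
proof -
  define t where "t n = sqrt_coeff n *\<^sub>R N ^ n" for n
  have N1: "norm (N ^ n) \<le> 1" for n
    using norm_power_bop[of N n] power_le_one[of "norm N" n] N by simp
  have nt: "norm (t n) \<le> \<bar>sqrt_coeff n\<bar>" for n
    using mult_left_mono[OF N1, of "\<bar>sqrt_coeff n\<bar>" n] by (simp add: t_def)
  have sn: "summable (\<lambda>n. norm (t n))"
    by (rule summable_comparison_test'[OF sqrt_coeff_tail(1)]) (use nt in simp)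
  then have s: "summable t" by (rule summable_norm_cancel)
  define R where "R = (\<Sum>n. t n)"
  have R: "t sums R" using s by (simp add: R_def summable_sums)
  have "R * R = (\<Sum>n. \<Sum>i\<le>n. t i * t (n - i))"
    unfolding R_def by (rule Cauchy_product[OF sn sn])
  also have "(\<lambda>n. \<Sum>i\<le>n. t i * t (n - i)) = (\<lambda>n. (\<Sum>k\<le>n. sqrt_coeff k * sqrt_coeff (n - k)) *\<^sub>R N ^ n)"
    unfolding t_def scaleR_sum_left
    by (intro ext sum.cong refl) (simp flip: power_add)
  also have "(\<Sum>n. (\<Sum>k\<le>n. sqrt_coeff k * sqrt_coeff (n - k)) *\<^sub>R N ^ n)
      = (\<Sum>n\<in>{0,1}. (\<Sum>k\<le>n. sqrt_coeff k * sqrt_coeff (n - k)) *\<^sub>R N ^ n)"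
    by (rule suminf_finite) (auto simp: sqrt_coeff_convolution)
  also have "\<dots> = 1 - N" by (simp add: sqrt_coeff_convolution del: One_nat_def) 
  finally have RR: "R * R = 1 - N" .
  have comm: "S * R = R * S" if "S * N = N * S" for S
  proof -
    have "S * N ^ n = N ^ n * S" for n
      by (induction n) (simp_all add: that flip: mult.assoc, simp add: mult.assoc)
    then have "S * t n = t n * S" for n by (simp add: t_def)
    then have "(\<lambda>n. S * t n) sums (R * S)"
      using bounded_linear.sums[OF bounded_linear_mult_left R, of S] by simp
    with bounded_linear.sums[OF bounded_linear_mult_right R, of S] show ?thesis
      by (rule sums_unique2)
  qed
  have lin1: "(\<lambda>n. cinner (t n *V x) y) sums cinner (R *V x) y" for x y
    by (rule bounded_linear.sums[OF cinner.bounded_linear_left bounded_linear.sums[OF bop.bounded_linear_left R]])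
  have lin2: "(\<lambda>n. cinner x (t n *V y)) sums cinner x (R *V y)" for x y
    by (rule bounded_linear.sums[OF cinner.bounded_linear_right bounded_linear.sums[OF bop.bounded_linear_left R]])
  have "self_adjoint (t n)" for n
    unfolding t_def by (intro self_adjoint_scaleR self_adjoint_power N)
  then have "self_adjoint R"
    using lin1 lin2 unfolding self_adjoint_def by (metis (mono_tags, lifting) sums_cong sums_unique2)
  moreover have "0 \<le> Re (cinner (R *V x) x)" for x
  proof -
    \<comment> \<open>The constant term is the identity and all the rest has norm at most one, so
      the sum is positive.\<close>
    have split: "R = (\<Sum>n. t (Suc n)) + 1"
      using suminf_split_head[OF s] by (simp add: R_def) (simp add: t_def)
    have ssn: "summable (\<lambda>n. norm (t (Suc n)))" using sn by (subst summable_Suc_iff)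
    have "norm (\<Sum>n. t (Suc n)) \<le> (\<Sum>n. norm (t (Suc n)))" by (rule summable_norm[OF ssn])
    also have "\<dots> \<le> (\<Sum>n. \<bar>sqrt_coeff (Suc n)\<bar>)"
      using sqrt_coeff_tail(1) by (intro suminf_le nt ssn) (subst summable_Suc_iff)
    also have "\<dots> \<le> 1" by (rule sqrt_coeff_tail)
    finally have "norm (\<Sum>n. t (Suc n)) * (norm x)\<^sup>2 \<le> 1 * (norm x)\<^sup>2" by (rule mult_right_mono) simp
    then have "\<bar>Re (cinner ((\<Sum>n. t (Suc n)) *V x) x)\<bar> \<le> (norm x)\<^sup>2"
      using Re_cinner_le[of "\<Sum>n. t (Suc n)" x] by linarith
    then show ?thesis
      by (simp add: split bop_apply_simps cinner.add_left cinner_self del: of_real_power)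
  qed
  ultimately have "positive_op R" by (simp add: positive_op_def)
  from this RR comm show ?thesis by (rule that)
qed

text \<open>Dividing by \<open>norm T\<close> puts \<open>N = 1 - T / norm T\<close> between 0 and
  1, hence into the closed unit ball, where the series for the root of \<open>1 - N\<close>
  converges.\<close>

lemma positive_sqrt_exists:
  fixes T :: "'a::chilbert_space bop"
  assumes T: "positive_op T"
  obtains R where "positive_op R" "R * R = T" "\<And>S. S * T = T * S \<Longrightarrow> S * R = R * S"
proof (cases "T = 0")
  case True
  have "positive_op (0 :: 'a bop)"
    by (simp add: positive_op_def self_adjoint_def bop_apply_simps cinner.zero_left cinner.zero_right)
  then show ?thesis using True by (intro that[of 0]) simp_all
next
  case False
  define k where "k = norm T"
  have k: "k > 0" using False by (simp add: k_def)
  define N where "N = 1 - (1 / k) *\<^sub>R T"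
  have sa: "self_adjoint N"
    unfolding N_def using T by (intro self_adjoint_diff self_adjoint_one self_adjoint_scaleR) (simp add: positive_op_def)
  have q: "Re (cinner (N *V x) x) = (norm x)\<^sup>2 - Re (cinner (T *V x) x) / k" for x
    by (simp add: N_def bop_apply_simps cinner.diff_left cinner.scaleR_left cinner_self divide_inverse mult.commute del: of_real_power)
  have "Re (cinner (T *V x) x) / k \<le> (norm x)\<^sup>2" for x
    using Re_cinner_le[of T x] k by (simp add: divide_le_eq k_def mult.commute)
  with sa have pos: "positive_op N" by (simp add: positive_op_def q)
  have "norm N \<le> 1"
    using positive_opD[OF T] k by (intro positive_op_norm_le[OF pos]) (simp_all add: q)
  from sqrt_one_minus_exists[OF sa this]
  obtain R where R: "positive_op R" "R * R = 1 - N" "\<And>S. S * N = N * S \<Longrightarrow> S * R = R * S" by metis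
  show ?thesis
  proof (rule that[of "sqrt k *\<^sub>R R"])
    show "positive_op (sqrt k *\<^sub>R R)"
      using R(1) k by (auto simp: positive_op_def self_adjoint_scaleR bop_apply_simps cinner.scaleR_left)
    show "sqrt k *\<^sub>R R * sqrt k *\<^sub>R R = T"
      using k R(2) by (simp add: N_def)
    fix S assume "S * T = T * S"
    then have "S * R = R * S" by (intro R(3)) (simp add: N_def left_diff_distrib right_diff_distrib)
    then show "S * sqrt k *\<^sub>R R = sqrt k *\<^sub>R R * S" by simp
  qed
qed

text \<open>The root \<open>R\<close> from the series commutes with everything that commutes with
  its square, in particular with any other positive root \<open>S\<close>. Then
  \<open>(R + S) * (R - S) = 0\<close>; testing this against vectors in the range of
  \<open>R - S\<close>, positivity kills both summands.\<close>

lemma positive_sqrt_unique: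
  fixes P Q :: "'a::chilbert_space bop"
  assumes P: "positive_op P" and Q: "positive_op Q" and eq: "P * P = Q * Q"
  shows "P = Q"
proof -
  have "positive_op (Q * Q)"
    using Q by (auto simp: positive_op_def self_adjoint_def bop_apply_simps) (metis cinner_self Re_complex_of_real zero_le_power2)
  then obtain R where R: "positive_op R" "R * R = Q * Q" "\<And>S. S * (Q * Q) = (Q * Q) * S \<Longrightarrow> S * R = R * S"
    using positive_sqrt_exists by metis
  have uniq: "S = R" if S: "positive_op S" "S * S = Q * Q" for S
  proof -
    have comm: "S * R = R * S" by (rule R(3)) (simp add: mult.assoc flip: S(2))
    define D where "D = R - S"
    have Dsa: "self_adjoint D"
      unfolding D_def using R(1) S(1) by (intro self_adjoint_diff) (simp_all add: positive_op_def)
    have "D *V x = 0" for x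
    proof -
      let ?y = "D *V x"
      have "(R + S) * D = 0"
        by (simp add: D_def distrib_right right_diff_distrib R(2) S(2) comm)
      then have "(R + S) *V ?y = 0" by (metis bop_apply_simps(4,5))
      then have "Re (cinner (R *V ?y) ?y) + Re (cinner (S *V ?y) ?y) = 0"
        by (metis bop_apply_simps(1) cinner.add_left cinner.zero_left plus_complex.sel(1) zero_complex.sel(1))
      then have "Re (cinner (R *V ?y) ?y) = 0" "Re (cinner (S *V ?y) ?y) = 0"
        using positive_opD[OF R(1), of ?y] positive_opD[OF S(1), of ?y] by linarith+
      then have "R *V ?y = 0" "S *V ?y = 0"
        using positive_op_norm_apply[OF R(1), of ?y] positive_op_norm_apply[OF S(1), of ?y] by auto
      then have "D *V ?y = 0" by (simp add: D_def bop_apply_simps)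
      then have "cinner ?y ?y = 0" by (simp add: self_adjointD[OF Dsa] cinner.zero_right)
      then show ?thesis by (simp add: cinner_self)
    qed
    then have "D = 0" by (intro bop_ext) (simp add: bop_apply_simps)
    then show ?thesis by (simp add: D_def)
  qed
  show ?thesis using uniq[OF P eq] uniq[OF Q refl] by simp
qed

lemma abs_op:
  fixes T :: "'a::chilbert_space bop"
  shows "positive_op (abs_op T)" "abs_op T * abs_op T = adj_op T * T"
proof -
  have "positive_op (adj_op T * T)"
    by (auto simp: positive_op_def self_adjoint_def bop_apply_simps cinner_adj_left cinner_adj_right cinner_self
        simp flip: of_real_power)
  then obtain R where R: "positive_op R" "R * R = adj_op T * T" using positive_sqrt_exists by metis
  have "positive_op (abs_op T) \<and> abs_op T * abs_op T = adj_op T * T"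
    unfolding abs_op_def by (rule theI[of _ R]) (use R in \<open>auto intro!: positive_sqrt_unique[of _ R]\<close>)
  then show "positive_op (abs_op T)" "abs_op T * abs_op T = adj_op T * T" by auto
qed

section \<open>Hilbert-Schmidt operators and the trace\<close>

lemma norm_adj_cinner: "cmod (cinner (adj_op X *V f) e) = cmod (cinner (X *V e) f)"
  by (metis cinner_adj_left cinner_commute complex_mod_cnj)

lemma hs_matrix_summable:
  assumes E: "is_onb E" and F: "is_onb F" and X: "(\<lambda>e. (norm (X *V e))\<^sup>2) summable_on E"
  shows "(\<lambda>(e, f). (cmod (cinner (X *V e) f))\<^sup>2) summable_on E \<times> F"
proof -
  interpret F: onb_space F by unfold_locales (rule F)
  show ?thesis
    by (rule summable_on_SigmaI[OF _ X]) (use F.parseval in auto)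
qed

text \<open>Both sums are the double sum of the squared matrix entries between \<open>E\<close> and
  \<open>F\<close>. Allowing two bases lets a self-adjoint operator that is square summable in some
  basis be transferred to the fixed one.\<close>

lemma hs_adj_has_sum:
  assumes E: "is_onb E" and F: "is_onb F" and X: "((\<lambda>e. (norm (X *V e))\<^sup>2) has_sum S) E"
  shows "((\<lambda>f. (norm (adj_op X *V f))\<^sup>2) has_sum S) F"
proof -
  interpret E: onb_space E by unfold_locales (rule E)
  interpret F: onb_space F by unfold_locales (rule F)
  have "((\<lambda>(e, f). (cmod (cinner (X *V e) f))\<^sup>2) has_sum S) (E \<times> F)"
    by (rule has_sum_SigmaI[OF _ X])
      (use F.parseval in \<open>auto intro!: hs_matrix_summable E F has_sum_imp_summable[OF X]\<close>)
  then have "((\<lambda>(f, e). (cmod (cinner (X *V e) f))\<^sup>2) has_sum S) (F \<times> E)"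
    by (subst (asm) has_sum_swap) (simp add: case_prod_unfold)
  then show ?thesis
    by (rule has_sum_SigmaD) (use E.parseval[of "adj_op X *V _"] in \<open>simp add: norm_adj_cinner\<close>)
qed

context onb_space
begin

definition hs :: "'a bop \<Rightarrow> bool" where
  "hs X \<longleftrightarrow> (\<lambda>e. (norm (X *V e))\<^sup>2) summable_on E"

definition hs_norm2 :: "'a bop \<Rightarrow> real" where
  "hs_norm2 X = (\<Sum>\<^sub>\<infinity>e\<in>E. (norm (X *V e))\<^sup>2)"

definition hs_inner :: "'a bop \<Rightarrow> 'a bop \<Rightarrow> complex" where
  "hs_inner X Y = (\<Sum>\<^sub>\<infinity>e\<in>E. cinner (X *V e) (Y *V e))"

definition tr :: "'a bop \<Rightarrow> complex" where
  "tr T = (\<Sum>\<^sub>\<infinity>e\<in>E. cinner (T *V e) e)"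

lemma hs_if_self_adjoint_hilbert_schmidt:
  assumes "self_adjoint V" "hilbert_schmidt V"
  shows "hs V"
  using assms hs_adj_has_sum[OF _ is_onb, of _ V]
  unfolding hs_def hilbert_schmidt_def summable_on_def adj_self_adjoint[OF assms(1)] by blast

lemma hs_norm2_has_sum: "hs X \<Longrightarrow> ((\<lambda>e. (norm (X *V e))\<^sup>2) has_sum hs_norm2 X) E"
  by (simp add: hs_def hs_norm2_def)

lemma hs_norm2_nonneg: "0 \<le> hs_norm2 X"
  unfolding hs_norm2_def by (rule infsum_nonneg) simp

lemma sum_le_hs_norm2: "hs X \<Longrightarrow> finite F \<Longrightarrow> F \<subseteq> E \<Longrightarrow> (\<Sum>e\<in>F. (norm (X *V e))\<^sup>2) \<le> hs_norm2 X"
  unfolding hs_def hs_norm2_def by (rule finite_sum_le_infsum) auto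

lemma hs_adj: "hs X \<Longrightarrow> hs (adj_op X)"
  and hs_norm2_adj: "hs X \<Longrightarrow> hs_norm2 (adj_op X) = hs_norm2 X"
  using hs_adj_has_sum[OF is_onb is_onb hs_norm2_has_sum]
  by (auto simp: hs_def hs_norm2_def summable_on_def infsumI)

lemma norm_add_power2_le: "(norm (x + y))\<^sup>2 \<le> 2 * (norm x)\<^sup>2 + 2 * (norm (y :: 'b::real_normed_vector))\<^sup>2"
proof -
  have "(norm (x + y))\<^sup>2 \<le> (norm x + norm y)\<^sup>2" by (intro power_mono norm_triangle_ineq) simp
  also have "\<dots> \<le> 2 * (norm x)\<^sup>2 + 2 * (norm y)\<^sup>2"
    using sum_squares_bound[of "norm x" "norm y"] by (simp add: power2_sum)
  finally show ?thesis .
qed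

lemma hs_zero: "hs 0"
  by (simp add: hs_def bop_apply_simps)

lemma hs_add: "hs X \<Longrightarrow> hs Y \<Longrightarrow> hs (X + Y)"
  unfolding hs_def bop_apply_simps
  by (rule summable_on_comparison_test[of "\<lambda>e. 2 * (norm (X *V e))\<^sup>2 + 2 * (norm (Y *V e))\<^sup>2"])
    (auto intro: summable_on_add summable_on_cmult_right norm_add_power2_le)

lemma hs_scaleC: "hs X \<Longrightarrow> hs (c *C X)"
  unfolding hs_def bop_apply_simps norm_scaleC power_mult_distrib by (rule summable_on_cmult_right)

lemma hs_scaleR: "hs X \<Longrightarrow> hs (r *\<^sub>R X)"
  unfolding scaleR_scaleC by (rule hs_scaleC)

lemma hs_mult_left:
  assumes "hs X"
  shows "hs (T * X)" "hs_norm2 (T * X) \<le> (norm T)\<^sup>2 * hs_norm2 X"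
proof -
  have le: "(norm ((T * X) *V e))\<^sup>2 \<le> (norm T)\<^sup>2 * (norm (X *V e))\<^sup>2" for e
    using power_mono[OF norm_bop_apply[of T "X *V e"], of 2] by (simp add: bop_apply_simps power_mult_distrib)
  have s: "(\<lambda>e. (norm T)\<^sup>2 * (norm (X *V e))\<^sup>2) summable_on E"
    using assms unfolding hs_def by (rule summable_on_cmult_right)
  then show "hs (T * X)"
    unfolding hs_def by (rule summable_on_comparison_test) (use le in auto)
  then have "hs_norm2 (T * X) \<le> (\<Sum>\<^sub>\<infinity>e\<in>E. (norm T)\<^sup>2 * (norm (X *V e))\<^sup>2)"
    unfolding hs_def hs_norm2_def by (intro infsum_mono s le)
  then show "hs_norm2 (T * X) \<le> (norm T)\<^sup>2 * hs_norm2 X"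
    by (simp add: hs_norm2_def infsum_cmult_right')
qed

lemma hs_mult_right:
  assumes "hs X"
  shows "hs (X * T)" "hs_norm2 (X * T) \<le> (norm T)\<^sup>2 * hs_norm2 X"
proof -
  have h: "hs (adj_op T * adj_op X)" by (intro hs_mult_left hs_adj assms)
  show "hs (X * T)" using hs_adj[OF h] by (simp add: adj_mult)
  have "hs_norm2 (X * T) = hs_norm2 (adj_op T * adj_op X)"
    using hs_norm2_adj[OF h] by (simp add: adj_mult)
  also have "\<dots> \<le> (norm (adj_op T))\<^sup>2 * hs_norm2 (adj_op X)" by (intro hs_mult_left hs_adj assms)
  also have "\<dots> \<le> (norm T)\<^sup>2 * hs_norm2 X"
    unfolding hs_norm2_adj[OF assms] by (intro mult_right_mono power_mono norm_adj hs_norm2_nonneg) simp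
  finally show "hs_norm2 (X * T) \<le> (norm T)\<^sup>2 * hs_norm2 X" .
qed

lemma norm_cinner_le_squares: "cmod (cinner x y) \<le> (norm x)\<^sup>2 + (norm (y :: 'b::complex_inner))\<^sup>2"
proof -
  have "0 \<le> norm x * norm y" by simp
  then show ?thesis
    using norm_cinner_le[of x y] sum_squares_bound[of "norm x" "norm y"] by linarith
qed

lemma hs_inner_abs_summable:
  assumes "hs X" "hs Y"
  shows "(\<lambda>e. norm (cinner (X *V e) (Y *V e))) summable_on E"
  by (rule summable_on_comparison_test[of "\<lambda>e. (norm (X *V e))\<^sup>2 + (norm (Y *V e))\<^sup>2"])
    (use assms in \<open>auto simp: hs_def intro: summable_on_add norm_cinner_le_squares\<close>)

lemma hs_inner_summable: "hs X \<Longrightarrow> hs Y \<Longrightarrow> (\<lambda>e. cinner (X *V e) (Y *V e)) summable_on E"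
  by (rule Infinite_Sum.abs_summable_summable[OF hs_inner_abs_summable])

lemma hs_inner_add_left: "hs X \<Longrightarrow> hs X' \<Longrightarrow> hs Y \<Longrightarrow> hs_inner (X + X') Y = hs_inner X Y + hs_inner X' Y"
  by (simp add: hs_inner_def bop_apply_simps cinner.add_left infsum_add hs_inner_summable)

lemma hs_inner_commute: "hs_inner X Y = cnj (hs_inner Y X)"
  by (simp add: hs_inner_def flip: infsum_cnj cinner_commute)

lemma hs_inner_scaleC_left: "hs_inner (c *C X) Y = c * hs_inner X Y"
  by (simp add: hs_inner_def bop_apply_simps cinner_scaleC_left infsum_cmult_right')

lemma hs_inner_scaleR_left: "hs_inner (r *\<^sub>R X) Y = r * hs_inner X Y"
  by (simp add: scaleR_scaleC hs_inner_scaleC_left)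

lemma hs_inner_zero_left: "hs_inner 0 Y = 0"
  by (simp add: hs_inner_def bop_apply_simps cinner.zero_left)

lemma hs_inner_sum_left:
  "hs Y \<Longrightarrow> (\<And>i. i \<in> I \<Longrightarrow> hs (X i)) \<Longrightarrow> hs_inner (\<Sum>i\<in>I. X i) Y = (\<Sum>i\<in>I. hs_inner (X i) Y)
    \<and> hs (\<Sum>i\<in>I. X i)"
  by (induction I rule: infinite_finite_induct) (simp_all add: hs_inner_zero_left hs_zero hs_inner_add_left hs_add)

lemma hs_inner_self:
  assumes "hs X"
  shows "hs_inner X X = hs_norm2 X"
proof -
  have "hs_inner X X = (\<Sum>\<^sub>\<infinity>e\<in>E. complex_of_real ((norm (X *V e))\<^sup>2))"
    by (simp add: hs_inner_def cinner_self)
  also have "\<dots> = hs_norm2 X" by (intro infsumI has_sum_of_real hs_norm2_has_sum assms)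
  finally show ?thesis .
qed

lemma hs_inner_mult_left: "hs_inner (T * X) Y = hs_inner X (adj_op T * Y)"
  by (simp add: hs_inner_def bop_apply_simps cinner_adj_right)

text \<open>Fubini for the matrix entries, whose products are absolutely summable. With
  \<open>tr_mult\<close> this becomes the cyclicity of the trace.\<close>

lemma hs_inner_adj:
  assumes X: "hs X" and Y: "hs Y"
  shows "hs_inner X Y = hs_inner (adj_op Y) (adj_op X)"
proof -
  let ?f = "\<lambda>e f. cinner (X *V e) f * cinner f (Y *V e)"
  have "(\<lambda>(e, f). (cmod (cinner (X *V e) f))\<^sup>2) summable_on E \<times> E"
    "(\<lambda>(e, f). (cmod (cinner (Y *V e) f))\<^sup>2) summable_on E \<times> E"
    using X Y by (simp_all add: hs_matrix_summable[OF is_onb is_onb] hs_def)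
  from summable_on_add[OF this]
  have s: "(\<lambda>x. (cmod (cinner (X *V fst x) (snd x)))\<^sup>2 + (cmod (cinner (Y *V fst x) (snd x)))\<^sup>2) summable_on E \<times> E"
    by (simp add: case_prod_unfold)
  have "(\<lambda>x. norm (?f (fst x) (snd x))) summable_on E \<times> E"
  proof (rule summable_on_comparison_test[OF s])
    fix x
    have *: "u * v \<le> u\<^sup>2 + v\<^sup>2" if "0 \<le> u" "0 \<le> v" for u v :: real
      using sum_squares_bound[of u v] mult_nonneg_nonneg[OF that] by linarith
    have "cmod (cinner (snd x) (Y *V fst x)) = cmod (cinner (Y *V fst x) (snd x))"
      by (metis cinner_commute complex_mod_cnj)
    then show "norm (?f (fst x) (snd x)) \<le> (cmod (cinner (X *V fst x) (snd x)))\<^sup>2 + (cmod (cinner (Y *V fst x) (snd x)))\<^sup>2"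
      by (simp add: norm_mult *)
  qed simp
  then have sum: "(\<lambda>(e, f). ?f e f) summable_on E \<times> E"
    unfolding case_prod_unfold by (rule Infinite_Sum.abs_summable_summable)
  have "hs_inner X Y = (\<Sum>\<^sub>\<infinity>e\<in>E. \<Sum>\<^sub>\<infinity>f\<in>E. ?f e f)"
    by (simp add: hs_inner_def infsumI[OF cinner_has_sum])
  also have "\<dots> = (\<Sum>\<^sub>\<infinity>f\<in>E. \<Sum>\<^sub>\<infinity>e\<in>E. ?f e f)"
    by (rule infsum_swap_banach[OF sum])
  also have "\<dots> = (\<Sum>\<^sub>\<infinity>f\<in>E. cinner (adj_op Y *V f) (adj_op X *V f))"
  proof (rule infsum_cong)
    fix f
    have "((\<lambda>e. cinner (adj_op Y *V f) e * cinner e (adj_op X *V f)) has_sum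
        cinner (adj_op Y *V f) (adj_op X *V f)) E" by (rule cinner_has_sum)
    then show "(\<Sum>\<^sub>\<infinity>e\<in>E. ?f e f) = cinner (adj_op Y *V f) (adj_op X *V f)"
      by (intro infsumI) (simp add: cinner_adj_left cinner_adj_right mult.commute)
  qed
  finally show ?thesis by (simp add: hs_inner_def)
qed

lemma hs_inner_mult_right:
  assumes "hs X" "hs Y"
  shows "hs_inner (X * T) Y = hs_inner X (Y * adj_op T)"
proof -
  have "hs_inner (X * T) Y = hs_inner (adj_op Y) (adj_op T * adj_op X)"
    using assms by (simp add: hs_inner_adj hs_mult_right adj_mult)
  also have "\<dots> = hs_inner (T * adj_op Y) (adj_op X)" by (simp add: hs_inner_mult_left)
  also have "\<dots> = hs_inner X (Y * adj_op T)"
    using assms by (subst hs_inner_adj) (simp_all add: hs_mult_left hs_adj adj_mult)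
  finally show ?thesis .
qed

text \<open>A criterion for trace class operators that does not mention the absolute value and is visibly
  closed under sums. Testing it against \<open>U = T (|T| + \<epsilon>)\<^sup>-\<^sup>1\<close>, an approximation of the polar part
  of \<open>T\<close>, controls the trace of \<open>|T|\<close>.\<close>

definition nuclear :: "'a bop \<Rightarrow> bool" where
  "nuclear T \<longleftrightarrow> (\<exists>C. \<forall>U F. norm U \<le> 1 \<and> finite F \<and> F \<subseteq> E \<longrightarrow> (\<Sum>e\<in>F. cmod (cinner (T *V e) (U *V e))) \<le> C)"

text \<open>Moving \<open>X\<close> to the other side absorbs the test operator:
  \<open>adj_op X * U\<close> has Hilbert-Schmidt norm at most that of \<open>X\<close>, uniformly
  in \<open>U\<close>.\<close>

lemma nuclear_mult:
  assumes X: "hs X" and Y: "hs Y"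
  shows "nuclear (X * Y)"
  unfolding nuclear_def
proof (intro exI allI impI)
  fix U :: "'a bop" and F
  assume asm: "norm U \<le> 1 \<and> finite F \<and> F \<subseteq> E"
  let ?Z = "adj_op X * U"
  have Z: "hs ?Z" by (intro hs_mult_right hs_adj X)
  have "hs_norm2 ?Z \<le> (norm U)\<^sup>2 * hs_norm2 X"
    using hs_mult_right(2)[OF hs_adj[OF X]] by (simp add: hs_norm2_adj X)
  also have "\<dots> \<le> 1 * hs_norm2 X"
    using asm by (intro mult_right_mono power_le_one hs_norm2_nonneg) auto
  finally have Z_le: "hs_norm2 ?Z \<le> hs_norm2 X" by simp
  have "(\<Sum>e\<in>F. cmod (cinner ((X * Y) *V e) (U *V e))) = (\<Sum>e\<in>F. cmod (cinner (Y *V e) (?Z *V e)))"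
    by (simp add: bop_apply_simps cinner_adj_right)
  also have "\<dots> \<le> (\<Sum>e\<in>F. (norm (Y *V e))\<^sup>2 + (norm (?Z *V e))\<^sup>2)"
    by (intro sum_mono norm_cinner_le_squares)
  also have "\<dots> \<le> hs_norm2 Y + hs_norm2 X"
    unfolding sum.distrib using asm sum_le_hs_norm2[OF Y, of F] sum_le_hs_norm2[OF Z, of F] Z_le by linarith
  finally show "(\<Sum>e\<in>F. cmod (cinner ((X * Y) *V e) (U *V e))) \<le> hs_norm2 Y + hs_norm2 X" .
qed

lemma nuclear_add:
  assumes "nuclear S" "nuclear T"
  shows "nuclear (S + T)"
proof -
  obtain C D where C: "\<And>U F. norm U \<le> 1 \<Longrightarrow> finite F \<Longrightarrow> F \<subseteq> E \<Longrightarrow> (\<Sum>e\<in>F. cmod (cinner (S *V e) (U *V e))) \<le> C"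
    and D: "\<And>U F. norm U \<le> 1 \<Longrightarrow> finite F \<Longrightarrow> F \<subseteq> E \<Longrightarrow> (\<Sum>e\<in>F. cmod (cinner (T *V e) (U *V e))) \<le> D"
    using assms unfolding nuclear_def by metis
  have "(\<Sum>e\<in>F. cmod (cinner ((S + T) *V e) (U *V e))) \<le> C + D"
    if "norm U \<le> 1" "finite F" "F \<subseteq> E" for U :: "'a bop" and F
  proof -
    have "(\<Sum>e\<in>F. cmod (cinner ((S + T) *V e) (U *V e)))
        \<le> (\<Sum>e\<in>F. cmod (cinner (S *V e) (U *V e)) + cmod (cinner (T *V e) (U *V e)))"
      by (intro sum_mono) (simp add: bop_apply_simps cinner.add_left norm_triangle_ineq)
    then show ?thesis using C[OF that] D[OF that] by (simp add: sum.distrib)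
  qed
  then show ?thesis unfolding nuclear_def by blast
qed

lemma nuclear_scaleC:
  assumes "nuclear T"
  shows "nuclear (c *C T)"
proof -
  obtain C where C: "\<And>U F. norm U \<le> 1 \<Longrightarrow> finite F \<Longrightarrow> F \<subseteq> E \<Longrightarrow> (\<Sum>e\<in>F. cmod (cinner (T *V e) (U *V e))) \<le> C"
    using assms unfolding nuclear_def by metis
  have "(\<Sum>e\<in>F. cmod (cinner ((c *C T) *V e) (U *V e))) \<le> cmod c * C"
    if "norm U \<le> 1" "finite F" "F \<subseteq> E" for U :: "'a bop" and F
    using mult_left_mono[OF C[OF that], of "cmod c"]
    by (simp add: bop_apply_simps cinner_scaleC_left norm_mult sum_distrib_left)
  then show ?thesis unfolding nuclear_def by blast
qed

lemma nuclear_zero: "nuclear 0"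
  by (auto simp: nuclear_def bop_apply_simps cinner.zero_left)

lemma nuclear_abs_summable:
  assumes "nuclear T"
  shows "(\<lambda>e. norm (cinner (T *V e) e)) summable_on E"
proof -
  obtain C where C: "\<And>U F. norm U \<le> 1 \<Longrightarrow> finite F \<Longrightarrow> F \<subseteq> E \<Longrightarrow> (\<Sum>e\<in>F. cmod (cinner (T *V e) (U *V e))) \<le> C"
    using assms unfolding nuclear_def by metis
  show ?thesis
    by (rule summable_on_nonneg_bounded) (use C[OF norm_one_bop] in \<open>auto simp: bop_apply_simps\<close>)
qed

lemma tr_add: "nuclear S \<Longrightarrow> nuclear T \<Longrightarrow> tr (S + T) = tr S + tr T"
  unfolding tr_def bop_apply_simps cinner.add_left
  by (intro infsum_add Infinite_Sum.abs_summable_summable[OF nuclear_abs_summable])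

lemma tr_scaleC: "tr (c *C T) = c * tr T"
  by (simp add: tr_def bop_apply_simps cinner_scaleC_left infsum_cmult_right')

lemma tr_zero: "tr 0 = 0"
  by (simp add: tr_def bop_apply_simps cinner.zero_left)

lemma nuclear_sum: "(\<And>i. i \<in> I \<Longrightarrow> nuclear (T i)) \<Longrightarrow> nuclear (\<Sum>i\<in>I. T i)"
  by (induction I rule: infinite_finite_induct) (simp_all add: nuclear_zero nuclear_add)

lemma tr_sum: "(\<And>i. i \<in> I \<Longrightarrow> nuclear (T i)) \<Longrightarrow> tr (\<Sum>i\<in>I. T i) = (\<Sum>i\<in>I. tr (T i))"
  by (induction I rule: infinite_finite_induct) (simp_all add: tr_zero tr_add nuclear_sum)

lemma tr_mult: "tr (X * Y) = hs_inner Y (adj_op X)"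
  by (simp add: tr_def hs_inner_def bop_apply_simps cinner_adj_right)

lemma tr_mult_commute: "hs X \<Longrightarrow> hs Y \<Longrightarrow> tr (X * Y) = tr (Y * X)"
  unfolding tr_mult by (subst hs_inner_adj) (simp_all add: hs_adj)

lemma nuclear_trace_class:
  assumes "nuclear T"
  shows "trace_class T"
proof -
  obtain C where C: "\<And>U F. norm U \<le> 1 \<Longrightarrow> finite F \<Longrightarrow> F \<subseteq> E \<Longrightarrow> (\<Sum>e\<in>F. cmod (cinner (T *V e) (U *V e))) \<le> C"
    using assms unfolding nuclear_def by metis
  let ?P = "abs_op T"
  have P: "positive_op ?P" and PP: "?P * ?P = adj_op T * T" by (rule abs_op)+
  have Psa: "self_adjoint ?P" using P by (simp add: positive_op_def)
  have approx: "(\<Sum>e\<in>F. Re (cinner (?P *V e) e)) \<le> C + \<epsilon> * real (card F)"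
    if F: "finite F" "F \<subseteq> E" and \<epsilon>: "\<epsilon> > 0" for F \<epsilon>
  proof -
    \<comment> \<open>The shift by \<epsilon> makes \<open>?B\<close> coercive and so invertible,
      although \<open>?P\<close> need not be.\<close>
    let ?B = "?P + \<epsilon> *\<^sub>R 1"
    have "\<epsilon> * (norm x)\<^sup>2 \<le> Re (cinner (?B *V x) x)" for x
      using positive_opD[OF P, of x] by (simp add: bop_apply_simps cinner.add_left cinner.scaleR_left cinner_self del: of_real_power)
    then obtain S where S: "?B * S = 1" using coercive_invertible[OF \<epsilon>, of ?B] by metis
    have PS: "?P *V (S *V x) = x - \<epsilon> *\<^sub>R (S *V x)" for x
    proof -
      have "?B *V (S *V x) = x" using S by (metis bop_apply_simps(5,6))
      then show ?thesis by (simp add: bop_apply_simps algebra_simps)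
    qed
    have PS_le: "norm (?P *V (S *V x)) \<le> norm x" for x
    proof (rule power2_le_imp_le)
      let ?y = "S *V x"
      \<comment> \<open>Below, the cross term is nonnegative because \<open>?P\<close> is positive;
        dropping it leaves the square of \<open>norm (?P *V ?y)\<close>.\<close>
      have expand: "(norm (p + \<epsilon> *\<^sub>R y))\<^sup>2 = (norm p)\<^sup>2 + 2 * \<epsilon> * inner p y + \<epsilon>\<^sup>2 * (norm y)\<^sup>2" for p y :: 'a
        by (simp only: power2_norm_eq_inner)
          (simp add: inner_add_left inner_add_right inner_commute[of y p] power2_eq_square algebra_simps)
      have "?P *V ?y + \<epsilon> *\<^sub>R ?y = x" by (simp add: PS)
      then have "(norm x)\<^sup>2 = (norm (?P *V ?y))\<^sup>2 + 2 * \<epsilon> * inner (?P *V ?y) ?y + \<epsilon>\<^sup>2 * (norm ?y)\<^sup>2"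
        using expand[of "?P *V ?y" ?y] by simp
      moreover have "0 \<le> inner (?P *V ?y) ?y" using positive_opD[OF P] by (simp add: inner_eq_Re_cinner)
      ultimately show "(norm (?P *V ?y))\<^sup>2 \<le> (norm x)\<^sup>2" using \<epsilon> by simp
    qed simp
    define U where "U = T * S"
    have nU: "norm U \<le> 1"
    proof (rule norm_bop_le)
      fix x
      let ?y = "S *V x"
      have "cinner (T *V ?y) (T *V ?y) = cinner ((adj_op T * T) *V ?y) ?y"
        by (simp add: bop_apply_simps cinner_adj_left)
      also have "\<dots> = cinner (?P *V ?y) (?P *V ?y)"
        unfolding PP[symmetric] by (simp add: bop_apply_simps self_adjointD[OF Psa])
      finally have "(norm (T *V ?y))\<^sup>2 = (norm (?P *V ?y))\<^sup>2"
        unfolding cinner_self by (simp only: of_real_eq_iff)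
      then have "norm (U *V x) = norm (?P *V ?y)"
        by (simp add: U_def bop_apply_simps)
      then show "norm (U *V x) \<le> 1 * norm x" using PS_le by simp
    qed simp
    \<comment> \<open>Replacing \<open>?P *V (S *V e)\<close> by \<open>e\<close> costs at most
      \<epsilon>. For a fixed finite \<open>F\<close> the total error
      \<open>\<epsilon> * card F\<close> vanishes as \<epsilon> tends to 0, while \<open>C\<close>
      stays the same.\<close>
    have term_le: "Re (cinner (?P *V e) e) \<le> cmod (cinner (T *V e) (U *V e)) + \<epsilon>" if "e \<in> E" for e
    proof -
      have "cinner (T *V e) (U *V e) = cinner ((adj_op T * T) *V e) (S *V e)"
        by (simp add: U_def bop_apply_simps cinner_adj_left)
      also have "\<dots> = cinner (?P *V e) (?P *V (S *V e))"
        unfolding PP[symmetric] by (simp add: bop_apply_simps self_adjointD[OF Psa])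
      also have "\<dots> = cinner (?P *V e) e - \<epsilon> * cinner e (?P *V (S *V e))"
        by (simp add: PS cinner.diff_right cinner.scaleR_right self_adjointD[OF Psa] scaleR_conv_of_real)
      finally have "Re (cinner (?P *V e) e) = Re (cinner (T *V e) (U *V e)) + \<epsilon> * Re (cinner e (?P *V (S *V e)))"
        by simp
      moreover have "Re (cinner e (?P *V (S *V e))) \<le> 1"
        using norm_cinner_le[of e "?P *V (S *V e)"] PS_le[of e] norm_basis[OF that]
          complex_Re_le_cmod[of "cinner e (?P *V (S *V e))"] by simp
      then have "\<epsilon> * Re (cinner e (?P *V (S *V e))) \<le> \<epsilon>" using \<epsilon> by simp
      ultimately show ?thesis using complex_Re_le_cmod[of "cinner (T *V e) (U *V e)"] by linarith
    qed
    have "(\<Sum>e\<in>F. Re (cinner (?P *V e) e)) \<le> (\<Sum>e\<in>F. cmod (cinner (T *V e) (U *V e)) + \<epsilon>)"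
      by (intro sum_mono term_le) (use F in auto)
    then show ?thesis using C[OF nU F] by (simp add: sum.distrib mult.commute)
  qed
  have "(\<Sum>e\<in>F. Re (cinner (?P *V e) e)) \<le> C" if F: "finite F" "F \<subseteq> E" for F
  proof (rule field_le_epsilon)
    fix \<delta> :: real assume \<delta>: "\<delta> > 0"
    have "(\<Sum>e\<in>F. Re (cinner (?P *V e) e)) \<le> C + \<delta> / (1 + real (card F)) * real (card F)"
      using \<delta> by (intro approx F) (simp add: add_pos_nonneg)
    also have "\<delta> / (1 + real (card F)) * real (card F) \<le> \<delta>"
      using \<delta> by (simp add: field_simps)
    finally show "(\<Sum>e\<in>F. Re (cinner (?P *V e) e)) \<le> C + \<delta>" by simp
  qed
  then have "(\<lambda>e. Re (cinner (?P *V e) e)) summable_on E"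
    using positive_opD[OF P] by (intro summable_on_nonneg_bounded(1)) auto
  then show ?thesis unfolding trace_class_def using is_onb by blast
qed

end

section \<open>Taylor expansion of operator polynomials\<close>

text \<open>\<open>words A V n k\<close> is the sum of all words of length \<open>n\<close> in \<open>A\<close> and \<open>V\<close> with exactly \<open>k\<close> letters \<open>V\<close>,
  the part of \<open>(A + V) ^ n\<close> that is homogeneous of degree \<open>k\<close> in \<open>V\<close>.\<close>

fun words :: "'a::chilbert_space bop \<Rightarrow> 'a bop \<Rightarrow> nat \<Rightarrow> nat \<Rightarrow> 'a bop" where
  "words A V 0 0 = 1"
| "words A V 0 (Suc k) = 0"
| "words A V (Suc n) 0 = A * words A V n 0"
| "words A V (Suc n) (Suc k) = A * words A V n (Suc k) + V * words A V n k"

lemma words_0_right: "words A V n 0 = A ^ n"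
  by (induction n) simp_all

lemma words_eq_0: "n < k \<Longrightarrow> words A V n k = 0"
proof (induction n arbitrary: k)
  case 0
  then show ?case by (cases k) simp_all
next
  case (Suc n)
  then show ?case by (cases k) simp_all
qed

text \<open>Expand every letter \<open>A + t *\<^sub>R V\<close>: a word with \<open>k\<close>
  letters \<open>V\<close> arises once for each choice of \<open>j\<close> of them as the original
  letters \<open>V\<close>, the other \<open>k - j\<close> each bringing a factor \<open>t\<close>.
  For \<open>k < j\<close> the binomial coefficient is zero, so the truncated exponent is harmless.
  The case \<open>j = 0\<close> expands powers, \<open>j = 2\<close> gives second derivatives along
  the segment.\<close>

lemma words_shift:
  "words (A + t *\<^sub>R V) V n j = (\<Sum>k\<le>n. (real (k choose j) * t ^ (k - j)) *\<^sub>R words A V n k)"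
proof (induction n arbitrary: j)
  case 0
  show ?case by (cases j) simp_all
next
  case (Suc n)
  define c where "c j k = real (k choose j) * t ^ (k - j)" for j k
  have pascal: "c (Suc j) (Suc k) = c j k + t * c (Suc j) k" for j k
  proof (cases "k \<ge> Suc j")
    case True
    then have "t ^ (k - j) = t * t ^ (k - Suc j)" by (simp add: Suc_diff_Suc flip: power_Suc)
    then show ?thesis by (simp add: c_def algebra_simps)
  next
    case False
    then show ?thesis by (simp add: c_def binomial_eq_0)
  qed
  have c0: "c 0 (Suc k) = t * c 0 k" for k by (simp add: c_def)
  have IH: "words (A + t *\<^sub>R V) V n j = (\<Sum>k\<le>n. c j k *\<^sub>R words A V n k)" for j
    using Suc by (simp add: c_def)
  have top: "(\<Sum>k\<le>n. c j (Suc k) *\<^sub>R words A V n (Suc k)) + c j 0 *\<^sub>R words A V n 0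
      = (\<Sum>k\<le>n. c j k *\<^sub>R words A V n k)" for j
    using sum.atMost_Suc_shift[of "\<lambda>k. c j k *\<^sub>R words A V n k" n] by (simp add: words_eq_0 add.commute)
  have "(\<Sum>k\<le>Suc n. c j k *\<^sub>R words A V (Suc n) k)
      = c j 0 *\<^sub>R (A * words A V n 0) + (\<Sum>k\<le>n. c j (Suc k) *\<^sub>R (A * words A V n (Suc k) + V * words A V n k))"
    by (subst sum.atMost_Suc_shift) simp
  also have "\<dots> = A * ((\<Sum>k\<le>n. c j (Suc k) *\<^sub>R words A V n (Suc k)) + c j 0 *\<^sub>R words A V n 0)
      + V * (\<Sum>k\<le>n. c j (Suc k) *\<^sub>R words A V n k)"
    by (simp add: scaleR_right_distrib sum.distrib sum_distrib_left distrib_left)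
  also have "\<dots> = A * (\<Sum>k\<le>n. c j k *\<^sub>R words A V n k) + V * (\<Sum>k\<le>n. c j (Suc k) *\<^sub>R words A V n k)"
    by (simp only: top)
  also have "\<dots> = words (A + t *\<^sub>R V) V (Suc n) j"
  proof (cases j)
    case 0
    then show ?thesis
      by (simp add: IH c0 distrib_right scaleR_sum_right sum_distrib_left scaleR_right_distrib sum.distrib mult.commute[of t])
  next
    case (Suc i)
    then show ?thesis
      by (simp add: IH pascal distrib_right distrib_left scaleR_sum_right sum_distrib_left scaleR_left_distrib scaleR_right_distrib
          sum.distrib mult.commute[of t] add_ac)
  qed
  finally show ?case by (simp add: c_def)
qed

text \<open>All terms of degree at least three in \<open>V\<close>. The index may run past the word
  length, where \<open>words\<close> vanishes; this avoids a truncated upper limit.\<close>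

definition power_remainder :: "'a::chilbert_space bop \<Rightarrow> 'a bop \<Rightarrow> nat \<Rightarrow> 'a bop" where
  "power_remainder A V n = (\<Sum>k<n. words A V n (k + 3))"

lemma power_add_eq_words:
  "(A + V) ^ n = A ^ n + words A V n 1 + words A V n 2 + power_remainder A V n"
proof -
  have "(A + V) ^ n = words (A + 1 *\<^sub>R V) V n 0" by (simp add: words_0_right)
  also have "\<dots> = (\<Sum>k\<le>n. words A V n k)"
    by (simp only: words_shift) simp
  also have "\<dots> = (\<Sum>k<n + 3. words A V n k)"
    by (rule sum.mono_neutral_left) (auto simp: words_eq_0)
  also have "\<dots> = A ^ n + words A V n 1 + words A V n 2 + power_remainder A V n"
    by (simp add: sum.lessThan_Suc_shift power_remainder_def words_0_right eval_nat_numeral del: sum.lessThan_Suc)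
  finally show ?thesis .
qed

section \<open>Derivatives of powers and of polynomials\<close>

lemma power_bop_has_derivative: "((\<lambda>T. T ^ n) has_derivative (\<lambda>X. words T X n 1)) (at T)"
proof (induction n)
  case (Suc n)
  have "((\<lambda>T. T * T ^ n) has_derivative (\<lambda>X. T * words T X n 1 + X * T ^ n)) (at T)"
    by (intro has_derivative_mult Suc has_derivative_ident)
  then show ?case by (simp add: words_0_right)
qed simp

text \<open>The derivative of \<open>words T Y n 1\<close> in direction \<open>X\<close>, arranged
  as the product rule produces it. For \<open>X = Y\<close> each word occurs twice, which cancels
  the factor \<open>1/2\<close> in the Taylor remainder.\<close>

fun words2 :: "'a::chilbert_space bop \<Rightarrow> 'a bop \<Rightarrow> 'a bop \<Rightarrow> nat \<Rightarrow> 'a bop" where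
  "words2 T Y X 0 = 0"
| "words2 T Y X (Suc n) = T * words2 T Y X n + X * words T Y n 1 + Y * words T X n 1"

lemma words_1_has_derivative: "((\<lambda>T. words T Y n 1) has_derivative (\<lambda>X. words2 T Y X n)) (at T)"
proof (induction n)
  case (Suc n)
  have "((\<lambda>T. T * words T Y n 1 + Y * T ^ n) has_derivative
      (\<lambda>X. T * words2 T Y X n + X * words T Y n 1 + Y * words T X n 1)) (at T)"
    by (intro has_derivative_add has_derivative_mult Suc has_derivative_ident
        has_derivative_mult_right power_bop_has_derivative)
  then show ?case by (simp add: words_0_right)
qed simp

lemma words2_same: "words2 T V V n = 2 *\<^sub>R words T V n 2"
  by (induction n) (simp_all add: numeral_2_eq_2 scaleR_right_distrib flip: scaleR_2)

lemma scaleC_bop_eq_mult: "c *C T = (c *C 1) * (T :: 'a::chilbert_space bop)"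
  by (rule bop_ext) (simp add: bop_apply_simps)

lemma mult_scaleC_bop: "S * (c *C T) = c *C (S * (T :: 'a::chilbert_space bop))"
  by (rule bop_ext) (simp add: bop_apply_simps bop_apply_scaleC)

lemma scaleC_mult_bop: "(c *C S) * T = c *C (S * (T :: 'a::chilbert_space bop))"
  by (rule bop_ext) (simp add: bop_apply_simps)

lemma bounded_linear_scaleC_bop: "bounded_linear (\<lambda>T :: 'a::chilbert_space bop. c *C T)"
proof -
  have eq: "(\<lambda>T. (c *C 1) * T) = (\<lambda>T :: 'a bop. c *C T)"
    by (rule ext) (rule scaleC_bop_eq_mult[symmetric])
  show ?thesis using bounded_linear_mult_right[of "c *C (1 :: 'a bop)"] unfolding eq .
qed

lemma poly_op_has_derivative:
  "(poly_op p has_derivative (\<lambda>X. \<Sum>i\<le>degree p. coeff p i *C words T X i 1)) (at T)"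
  unfolding poly_op_def[abs_def]
  by (intro has_derivative_sum bounded_linear.has_derivative[OF bounded_linear_scaleC_bop] power_bop_has_derivative)

lemma D1_poly_eq: "D1_poly p T X = (\<Sum>i\<le>degree p. coeff p i *C words T X i 1)"
  unfolding D1_poly_def by (rule fun_cong[OF frechet_derivative_at[OF poly_op_has_derivative, symmetric]])

lemma D1_poly_has_derivative:
  "((\<lambda>T. D1_poly p T Y) has_derivative (\<lambda>X. \<Sum>i\<le>degree p. coeff p i *C words2 T Y X i)) (at T)"
  unfolding D1_poly_eq
  by (intro has_derivative_sum bounded_linear.has_derivative[OF bounded_linear_scaleC_bop] words_1_has_derivative)

lemma D2_poly_eq: "D2_poly p T X Y = (\<Sum>i\<le>degree p. coeff p i *C words2 T Y X i)"
  unfolding D2_poly_def by (rule fun_cong[OF frechet_derivative_at[OF D1_poly_has_derivative, symmetric]])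

lemma taylor_remainder_eq:
  "taylor_remainder p A V = (\<Sum>i\<le>degree p. coeff p i *C power_remainder A V i)"
proof -
  have "(1/2) *\<^sub>R D2_poly p A V V = (\<Sum>i\<le>degree p. coeff p i *C words A V i 2)"
    unfolding D2_poly_eq words2_same scaleR_scaleC complex_vector.scale_sum_right
    by (intro sum.cong refl) (simp add: scaleC_scaleC)
  then show ?thesis
    unfolding taylor_remainder_def poly_op_def D1_poly_eq power_add_eq_words
    by (simp add: scaleC_add_right sum.distrib)
qed

section \<open>Polynomial functional calculus and affine substitution\<close>

lemma poly_op_altdef: "degree p \<le> n \<Longrightarrow> poly_op p T = (\<Sum>i\<le>n. coeff p i *C T ^ i)"
  unfolding poly_op_def
  by (rule sum.mono_neutral_left) (auto simp: coeff_eq_0)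

lemma poly_op_0: "poly_op 0 T = 0"
  by (simp add: poly_op_def)

lemma poly_op_add: "poly_op (p + q) T = poly_op p T + poly_op q T"
proof -
  let ?n = "max (degree p) (degree q)"
  have "poly_op (p + q) T = (\<Sum>i\<le>?n. coeff (p + q) i *C T ^ i)"
    by (rule poly_op_altdef) (rule degree_add_le_max)
  then show ?thesis
    by (simp add: poly_op_altdef[of p ?n] poly_op_altdef[of q ?n] scaleC_add_left sum.distrib)
qed

lemma poly_op_smult: "poly_op (smult c p) T = c *C poly_op p T"
  using poly_op_altdef[OF degree_smult_le, of c p T]
  by (simp add: poly_op_def complex_vector.scale_sum_right scaleC_scaleC)

lemma poly_op_pCons: "poly_op (pCons c p) T = c *C 1 + T * poly_op p T"
proof -
  have "poly_op (pCons c p) T = (\<Sum>i\<le>Suc (degree p). coeff (pCons c p) i *C T ^ i)"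
    by (rule poly_op_altdef) (rule degree_pCons_le)
  also have "\<dots> = c *C 1 + (\<Sum>i\<le>degree p. coeff p i *C (T * T ^ i))"
    by (subst sum.atMost_Suc_shift) simp
  also have "(\<Sum>i\<le>degree p. coeff p i *C (T * T ^ i)) = T * poly_op p T"
    by (simp add: poly_op_def sum_distrib_left mult_scaleC_bop)
  finally show ?thesis .
qed

lemma poly_op_mult: "poly_op (p * q) T = poly_op p T * poly_op q T"
proof (induction p)
  case (pCons c p)
  then show ?case
    by (simp add: poly_op_add poly_op_smult poly_op_pCons distrib_right scaleC_mult_bop mult.assoc)
qed (simp add: poly_op_0)

lemma poly_op_pcompose: "poly_op (pcompose p r) T = poly_op p (poly_op r T)"
proof (induction p)
  case (pCons c p)
  then show ?case
    by (simp add: pcompose_pCons poly_op_add poly_op_mult poly_op_pCons poly_op_0)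
qed (simp add: poly_op_0)

text \<open>Polynomial calculus respects composition, so \<open>p\<close> at \<open>T\<close> is
  \<open>q\<close> at \<phi> of \<open>T\<close>, where \<phi> inverts the affine substitution. The
  chain rule then multiplies each direction by \<open>1 / c\<close>.\<close>

lemma taylor_remainder_affine:
  fixes A V :: "'a::chilbert_space bop"
  assumes c: "c \<noteq> 0"
  shows "taylor_remainder p A V =
    taylor_remainder (pcompose p [:complex_of_real a, complex_of_real c:])
      ((1 / c) *\<^sub>R (A - a *\<^sub>R 1)) ((1 / c) *\<^sub>R V)"
proof -
  define q where "q = pcompose p [:complex_of_real a, complex_of_real c:]"
  define \<phi> :: "'a bop \<Rightarrow> 'a bop" where "\<phi> T = (1 / c) *\<^sub>R (T - a *\<^sub>R 1)" for T
  have "poly_op [:complex_of_real a, complex_of_real c:] (\<phi> T) = T" for T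
    using c by (simp add: \<phi>_def poly_op_pCons poly_op_0 mult_scaleC_bop flip: scaleR_scaleC)
  then have pq: "poly_op p = (\<lambda>T. poly_op q (\<phi> T))"
    by (simp add: q_def poly_op_pcompose fun_eq_iff)
  have d\<phi>: "(\<phi> has_derivative (\<lambda>X. (1 / c) *\<^sub>R X)) (at T)" for T
    unfolding \<phi>_def[abs_def] by (auto intro!: derivative_eq_intros)
  have "((\<lambda>T. poly_op q (\<phi> T)) has_derivative (\<lambda>X. D1_poly q (\<phi> T) ((1 / c) *\<^sub>R X))) (at T)" for T
    unfolding D1_poly_eq by (rule has_derivative_compose[OF d\<phi> poly_op_has_derivative])
  then have D1: "D1_poly p T X = D1_poly q (\<phi> T) ((1 / c) *\<^sub>R X)" for T X
    unfolding D1_poly_def[of p] pq by (rule fun_cong[OF frechet_derivative_at[symmetric]])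
  have "((\<lambda>T. D1_poly q (\<phi> T) Y) has_derivative (\<lambda>X. D2_poly q (\<phi> T) ((1 / c) *\<^sub>R X) Y)) (at T)" for T Y
    unfolding D2_poly_eq by (rule has_derivative_compose[OF d\<phi> D1_poly_has_derivative])
  then have D2: "D2_poly p T X Y = D2_poly q (\<phi> T) ((1 / c) *\<^sub>R X) ((1 / c) *\<^sub>R Y)" for T X Y
    unfolding D2_poly_def[of p] D1 by (rule fun_cong[OF frechet_derivative_at[symmetric]])
  have "\<phi> (A + V) = \<phi> A + (1 / c) *\<^sub>R V"
    by (simp add: \<phi>_def algebra_simps)
  then show ?thesis
    unfolding taylor_remainder_def D1 D2 by (simp add: pq q_def \<phi>_def)
qed

section \<open>Positivity of the moments\<close>

lemma Bernstein_Suc_Suc: "Bernstein (Suc n) (Suc m) s = s * Bernstein n m s + (1 - s) * Bernstein n (Suc m) s"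
proof (cases "Suc m \<le> n")
  case True
  then have eq: "(1 - s) ^ (n - m) = (1 - s) * (1 - s) ^ (n - Suc m)"
    by (simp add: Suc_diff_Suc flip: power_Suc)
  show ?thesis by (simp add: Bernstein_def eq algebra_simps)
qed (simp add: Bernstein_def binomial_eq_0)

lemma Bernstein_Suc_0: "Bernstein (Suc n) 0 s = (1 - s) * Bernstein n 0 s"
  by (simp add: Bernstein_def)

text \<open>Two neighbouring Bernstein polynomials differ by the derivative of a multiple of
  \<open>s ^ Suc m * (1 - s) ^ (n - m)\<close>, which vanishes at both ends. So the integral does
  not depend on \<open>m\<close>, and at \<open>m = n\<close> it is that of
  \<open>s ^ n\<close>.\<close>

lemma Bernstein_has_integral: "m \<le> n \<Longrightarrow> (Bernstein n m has_integral 1 / real (Suc n)) {0..1}"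
proof (induction "n - m" arbitrary: m)
  case 0
  have "((\<lambda>s :: real. s ^ n) has_integral 1 ^ Suc n / real (Suc n) - 0 ^ Suc n / real (Suc n)) {0..1}"
  proof (rule fundamental_theorem_of_calculus)
    fix s :: real
    have "((\<lambda>s. s ^ Suc n / real (Suc n)) has_real_derivative real (Suc n) * s ^ (Suc n - Suc 0) / real (Suc n)) (at s within {0..1})"
      by (intro DERIV_cdivide DERIV_pow)
    then show "((\<lambda>s. s ^ Suc n / real (Suc n)) has_vector_derivative s ^ n) (at s within {0..1})"
      by (simp add: has_real_derivative_iff_has_vector_derivative del: of_nat_Suc power_Suc)
  qed simp
  moreover have "Bernstein n m = (\<lambda>s. s ^ n)" using 0 by (simp add: Bernstein_def fun_eq_iff)
  ultimately show ?case by simp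
next
  case (Suc d)
  then have m: "Suc m \<le> n" by simp
  have IH: "(Bernstein n (Suc m) has_integral 1 / real (Suc n)) {0..1}"
    by (rule Suc.hyps(1)) (use Suc.hyps(2) m in auto)
  let ?c = "real (n choose m) / real (Suc m)"
  have c: "?c * real (n - m) = real (n choose Suc m)"
  proof -
    have "Suc m * (n choose Suc m) = (n - m) * (n choose m)"
      by (simp only: binomial_absorption binomial_absorb_comp)
    then have "real (Suc m) * real (n choose Suc m) = real (n - m) * real (n choose m)"
      by (metis of_nat_mult)
    then show ?thesis by (simp add: field_simps)
  qed
  have "((\<lambda>s. Bernstein n m s - Bernstein n (Suc m) s) has_integral
      ?c * 1 ^ Suc m * (1 - 1) ^ (n - m) - ?c * 0 ^ Suc m * (1 - 0) ^ (n - m)) {0..1}"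
  proof (rule fundamental_theorem_of_calculus)
    fix s :: real
    have "((\<lambda>s. ?c * s ^ Suc m * (1 - s) ^ (n - m)) has_real_derivative
        ?c * (real (Suc m) * s ^ m) * (1 - s) ^ (n - m) - ?c * real (n - m) * s ^ Suc m * (1 - s) ^ (n - m - 1))
        (at s within {0..1})"
      by (rule derivative_eq_intros refl)+ (simp add: algebra_simps)
    also have "?c * (real (Suc m) * s ^ m) * (1 - s) ^ (n - m) - ?c * real (n - m) * s ^ Suc m * (1 - s) ^ (n - m - 1)
        = Bernstein n m s - Bernstein n (Suc m) s"
      unfolding c by (simp add: Bernstein_def)
    finally show "((\<lambda>s. ?c * s ^ Suc m * (1 - s) ^ (n - m)) has_vector_derivative
        Bernstein n m s - Bernstein n (Suc m) s) (at s within {0..1})"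
      by (simp add: has_real_derivative_iff_has_vector_derivative)
  qed simp
  then have "((\<lambda>s. Bernstein n m s - Bernstein n (Suc m) s) has_integral 0) {0..1}"
    using m by (simp add: power_0_left)
  from has_integral_add[OF this IH] show ?case by simp
qed

text \<open>The operator \<open>S\<close> of the overview. Left and right multiplication commute, so
  its powers expand binomially, with Bernstein polynomials in \<open>s\<close> as weights.\<close>

definition mixed_mult :: "real \<Rightarrow> 'a::chilbert_space bop \<Rightarrow> 'a bop \<Rightarrow> 'a bop" where
  "mixed_mult s T X = s *\<^sub>R (T * X) + (1 - s) *\<^sub>R (X * T)"

lemma mixed_mult_add: "mixed_mult s T (X + Y) = mixed_mult s T X + mixed_mult s T Y"
  by (simp add: mixed_mult_def distrib_left distrib_right scaleR_right_distrib)

text \<open>Hence \<open>mixed_mult s (1 - T)\<close> is \<open>1 - S\<close>, and its powers play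
  the part of the powers of \<open>1 - u\<close>.\<close>

lemma mixed_mult_one_minus: "mixed_mult s T X + mixed_mult s (1 - T) X = X"
proof -
  have "mixed_mult s T X + mixed_mult s (1 - T) X = s *\<^sub>R X + (1 - s) *\<^sub>R X"
    by (simp add: mixed_mult_def left_diff_distrib right_diff_distrib scaleR_right_diff_distrib)
  also have "\<dots> = X" by (simp flip: scaleR_left_distrib)
  finally show ?thesis .
qed

lemma mixed_mult_commute: "S * T = T * S \<Longrightarrow> mixed_mult s S (mixed_mult s T X) = mixed_mult s T (mixed_mult s S X)"
proof -
  assume "S * T = T * S"
  then have "S * (T * X) = T * (S * X)" "X * (S * T) = X * (T * S)" by (simp_all flip: mult.assoc)
  then show ?thesis
    by (simp add: mixed_mult_def distrib_left distrib_right scaleR_right_distrib mult.assoc add_ac mult.commute)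
qed

lemma mixed_mult_funpow:
  "(mixed_mult s T ^^ n) X = (\<Sum>m\<le>n. Bernstein n m s *\<^sub>R (T ^ m * X * T ^ (n - m)))"
proof (induction n)
  case 0
  show ?case by (simp add: Bernstein_def)
next
  case (Suc n)
  define Y where "Y m = T ^ m * X * T ^ (Suc n - m)" for m
  have Y1: "T * (T ^ m * X * T ^ (n - m)) = Y (Suc m)" for m
    by (simp add: Y_def mult.assoc)
  have Y0: "T ^ m * X * T ^ (n - m) * T = Y m" if "m \<le> n" for m
    using that by (simp add: Y_def mult.assoc Suc_diff_le power_commutes)
  have top: "(\<Sum>m\<le>n. Bernstein n (Suc m) s *\<^sub>R Y (Suc m)) + Bernstein n 0 s *\<^sub>R Y 0
      = (\<Sum>m\<le>n. Bernstein n m s *\<^sub>R Y m)"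
    using sum.atMost_Suc_shift[of "\<lambda>m. Bernstein n m s *\<^sub>R Y m" n]
    by (simp add: Bernstein_def binomial_eq_0 add.commute)
  have "(mixed_mult s T ^^ Suc n) X
      = s *\<^sub>R (\<Sum>m\<le>n. Bernstein n m s *\<^sub>R Y (Suc m)) + (1 - s) *\<^sub>R (\<Sum>m\<le>n. Bernstein n m s *\<^sub>R Y m)"
    by (simp add: Suc mixed_mult_def sum_distrib_left sum_distrib_right Y1 Y0)
  also have "\<dots> = (\<Sum>m\<le>n. Bernstein (Suc n) (Suc m) s *\<^sub>R Y (Suc m)) + Bernstein (Suc n) 0 s *\<^sub>R Y 0"
    unfolding top[symmetric] Bernstein_Suc_Suc Bernstein_Suc_0
    by (simp add: scaleR_sum_right scaleR_left_distrib scaleR_right_distrib sum.distrib)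
  also have "\<dots> = (\<Sum>m\<le>Suc n. Bernstein (Suc n) m s *\<^sub>R Y m)"
    by (subst sum.atMost_Suc_shift) (simp add: add.commute)
  finally show ?case by (simp add: Y_def)
qed

context onb_space
begin

lemma nuclear_mult_left:
  assumes "nuclear T"
  shows "nuclear (S * T)"
proof -
  obtain C where C: "\<And>U F. norm U \<le> 1 \<Longrightarrow> finite F \<Longrightarrow> F \<subseteq> E \<Longrightarrow> (\<Sum>e\<in>F. cmod (cinner (T *V e) (U *V e))) \<le> C"
    using assms unfolding nuclear_def by metis
  \<comment> \<open>The added one keeps the rescaling of the test operator meaningful when
    \<open>S = 0\<close>.\<close>
  define K where "K = norm S + 1"
  have K: "K > 0" by (simp add: K_def add_nonneg_pos)
  have "(\<Sum>e\<in>F. cmod (cinner ((S * T) *V e) (U *V e))) \<le> K * C"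
    if U: "norm U \<le> 1" and F: "finite F" "F \<subseteq> E" for U :: "'a bop" and F
  proof -
    let ?U = "(1 / K) *\<^sub>R (adj_op S * U)"
    have "norm (adj_op S * U) \<le> norm S * 1"
      by (rule order_trans[OF norm_mult_ineq]) (intro mult_mono norm_adj U, simp_all)
    also have "\<dots> \<le> K" by (simp add: K_def)
    finally have "norm ?U \<le> 1" using K by (simp add: divide_le_eq)
    from mult_left_mono[OF C[OF this F], of K]
    have "(\<Sum>e\<in>F. K * cmod (cinner (T *V e) (?U *V e))) \<le> K * C" using K by (simp add: sum_distrib_left)
    also have "(\<Sum>e\<in>F. K * cmod (cinner (T *V e) (?U *V e))) = (\<Sum>e\<in>F. cmod (cinner ((S * T) *V e) (U *V e)))"
      using K by (simp add: bop_apply_simps cinner.scaleR_right cinner_adj_right)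
    finally show ?thesis .
  qed
  then show ?thesis unfolding nuclear_def by blast
qed

lemma nuclear_scaleR: "nuclear T \<Longrightarrow> nuclear (r *\<^sub>R T)"
  unfolding scaleR_scaleC by (rule nuclear_scaleC)

lemma tr_scaleR: "tr (r *\<^sub>R T) = r * tr T"
  by (simp add: scaleR_scaleC tr_scaleC)

lemma words_hs: "hs V \<Longrightarrow> hs (words T V n (Suc k))"
  by (induction n) (simp_all add: hs_zero hs_add hs_mult_left hs_mult_right)

lemma words_nuclear: "hs V \<Longrightarrow> nuclear (words T V n (Suc (Suc k)))"
  by (induction n) (simp_all add: nuclear_zero nuclear_add nuclear_mult_left nuclear_mult words_hs)

text \<open>Taking real parts gives a symmetric real bilinear form. Nothing is lost for the moments,
  which are real by \<open>Im_mixed_moment\<close>.\<close>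

definition hs_form :: "'a bop \<Rightarrow> 'a bop \<Rightarrow> real" where
  "hs_form X Y = Re (hs_inner X Y)"

lemma hs_form_commute: "hs_form X Y = hs_form Y X"
  using hs_inner_commute[of X Y] by (simp add: hs_form_def)

lemma hs_form_add_left: "hs X \<Longrightarrow> hs X' \<Longrightarrow> hs Y \<Longrightarrow> hs_form (X + X') Y = hs_form X Y + hs_form X' Y"
  by (simp add: hs_form_def hs_inner_add_left)

lemma hs_form_scaleR_left: "hs_form (r *\<^sub>R X) Y = r * hs_form X Y"
  by (simp add: hs_form_def hs_inner_scaleR_left)

lemma hs_form_self_nonneg: "hs X \<Longrightarrow> 0 \<le> hs_form X X"
  by (simp add: hs_form_def hs_inner_self hs_norm2_nonneg)

lemma hs_mixed_mult: "hs X \<Longrightarrow> hs (mixed_mult s T X)"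
  by (simp add: mixed_mult_def hs_add hs_scaleR hs_mult_left hs_mult_right)

lemma hs_mixed_mult_funpow: "hs X \<Longrightarrow> hs ((mixed_mult s T ^^ n) X)"
  by (induction n) (simp_all add: hs_mixed_mult)

lemma hs_form_mixed_mult_commute:
  assumes X: "hs X" and Y: "hs Y" and T: "self_adjoint T"
  shows "hs_form (mixed_mult s T X) Y = hs_form X (mixed_mult s T Y)"
proof -
  have "hs_form (T * X) Y = hs_form X (T * Y)" "hs_form (X * T) Y = hs_form X (Y * T)"
    using hs_inner_mult_left[of T X Y] hs_inner_mult_right[OF X Y, of T] T
    by (simp_all add: hs_form_def adj_self_adjoint)
  then show ?thesis
    using X Y by (simp add: mixed_mult_def hs_form_add_left hs_form_scaleR_left hs_scaleR hs_mult_left hs_mult_right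
        hs_form_commute[of X "_ + _"] hs_form_commute[of X "_ *\<^sub>R _"] hs_form_commute[of X "_ * _"])
qed

lemma hs_form_mult_left_nonneg:
  assumes X: "hs X" and T: "positive_op T"
  shows "0 \<le> hs_form (T * X) X"
proof -
  have "hs_form (T * X) X = (\<Sum>\<^sub>\<infinity>e\<in>E. Re (cinner ((T * X) *V e) (X *V e)))"
    unfolding hs_form_def hs_inner_def using X by (simp add: infsum_Re hs_inner_summable hs_mult_left)
  also have "\<dots> \<ge> 0"
    by (rule infsum_nonneg) (simp add: bop_apply_simps positive_opD[OF T])
  finally show ?thesis .
qed

text \<open>Passing to adjoints turns right multiplication into left multiplication, for which
  positivity is checked vector by vector.\<close>

lemma hs_form_mixed_mult_nonneg:
  assumes X: "hs X" and T: "positive_op T" and s: "0 \<le> s" "s \<le> 1"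
  shows "0 \<le> hs_form (mixed_mult s T X) X"
proof -
  have "hs_form (X * T) X = hs_form (adj_op X) (T * adj_op X)"
    using X T by (simp add: hs_form_def hs_inner_adj[of "X * T"] hs_mult_right adj_mult adj_self_adjoint positive_op_def)
  also have "\<dots> = hs_form (T * adj_op X) (adj_op X)" by (rule hs_form_commute)
  also have "\<dots> \<ge> 0" by (intro hs_form_mult_left_nonneg hs_adj X T)
  finally have "0 \<le> hs_form (X * T) X" .
  then show ?thesis
    using hs_form_mult_left_nonneg[OF X T] X s
    by (simp add: mixed_mult_def hs_form_add_left hs_form_scaleR_left hs_scaleR hs_mult_left hs_mult_right)
qed

text \<open>The maps \<open>?P\<close> and \<open>?Q\<close> commute, are symmetric and positive,
  and add up to the identity. Moving one of two equal factors to the other side of the form lowers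
  an exponent by two, so that only exponents 0 and 1 remain; no square root of \<open>?P\<close> or
  \<open>?Q\<close> is taken.\<close>

lemma hs_form_mixed_mult_funpow_nonneg:
  assumes X: "hs X" and T: "positive_op T" and T1: "positive_op (1 - T)" and s: "0 \<le> s" "s \<le> 1"
  shows "0 \<le> hs_form ((mixed_mult s T ^^ k) ((mixed_mult s (1 - T) ^^ l) X)) X"
proof -
  let ?P = "mixed_mult s T" and ?Q = "mixed_mult s (1 - T)"
  have sa: "self_adjoint T" "self_adjoint (1 - T)" using T T1 by (simp_all add: positive_op_def)
  have PQ: "?P (?Q Y) = ?Q (?P Y)" for Y
    by (rule mixed_mult_commute) (simp add: left_diff_distrib right_diff_distrib)
  have QnP: "(?Q ^^ l) (?P Y) = ?P ((?Q ^^ l) Y)" for l Y by (induction l) (simp_all add: PQ)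
  have PnQ: "(?P ^^ k) (?Q Y) = ?Q ((?P ^^ k) Y)" for k Y by (induction k) (simp_all add: PQ)
  have P: "hs_form (?P Y) Z = hs_form Y (?P Z)" and Q: "hs_form (?Q Y) Z = hs_form Y (?Q Z)"
    if "hs Y" "hs Z" for Y Z by (simp_all add: hs_form_mixed_mult_commute that sa)
  note pos = hs_form_mixed_mult_nonneg[OF _ T s] hs_form_mixed_mult_nonneg[OF _ T1 s]
  have mixed: "0 \<le> hs_form (?P (?Q X)) X" if X: "hs X" for X
  proof -
    \<comment> \<open>Inserting \<open>?P + ?Q = 1\<close> splits the product into
      \<open>?P ?Q ?P + ?Q ?P ?Q\<close>, whose forms are those of \<open>?Q\<close> at
      \<open>?P X\<close> and of \<open>?P\<close> at \<open>?Q X\<close>.\<close>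
    have "?P (?Q X) = ?P (?Q (?P X + ?Q X))" by (simp only: mixed_mult_one_minus)
    also have "\<dots> = ?P (?Q (?P X)) + ?Q (?P (?Q X))" by (simp only: mixed_mult_add PQ)
    finally have "hs_form (?P (?Q X)) X = hs_form (?P (?Q (?P X))) X + hs_form (?Q (?P (?Q X))) X"
      using X by (metis hs_form_add_left hs_mixed_mult)
    also have "\<dots> = hs_form (?Q (?P X)) (?P X) + hs_form (?P (?Q X)) (?Q X)"
      using X by (simp add: P[of "?Q (?P X)" X] Q[of "?P (?Q X)" X] hs_mixed_mult)
    also have "\<dots> \<ge> 0" using X by (intro add_nonneg_nonneg pos hs_mixed_mult)
    finally show ?thesis .
  qed
  have step: "0 \<le> hs_form ((?Q ^^ l) X) X \<and> 0 \<le> hs_form (?P ((?Q ^^ l) X)) X" if "hs X" for l X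
    using that
  proof (induction l arbitrary: X rule: induct_nat_012)
    case (ge2 n)
    have eq: "(?Q ^^ Suc (Suc n)) X = ?Q ((?Q ^^ n) (?Q X))" by (simp add: funpow_swap1)
    show ?case
      using ge2.IH(1)[of "?Q X"] ge2.prems unfolding eq PQ
      by (simp add: Q hs_mixed_mult hs_mixed_mult_funpow)
  qed (simp_all add: hs_form_self_nonneg pos mixed)
  show ?thesis using X
  proof (induction k arbitrary: X rule: induct_nat_012)
    case (ge2 n)
    have "(?P ^^ Suc (Suc n)) ((?Q ^^ l) X) = ?P ((?P ^^ n) ((?Q ^^ l) (?P X)))"
      by (simp add: funpow_swap1 QnP)
    then show ?case
      using ge2.IH(1)[of "?P X"] ge2.prems
      by (simp add: P hs_mixed_mult hs_mixed_mult_funpow)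
  qed (simp_all add: step)
qed

end

section \<open>Traces of words with two letters \<open>V\<close>\<close>

lemma words_Suc_1: "words T V (Suc n) 1 = (\<Sum>j\<le>n. T ^ j * V * T ^ (n - j))"
proof (induction n)
  case (Suc n)
  have "words T V (Suc (Suc n)) 1 = T * words T V (Suc n) 1 + V * T ^ Suc n"
    by (simp add: words_0_right)
  also have "\<dots> = (\<Sum>j\<le>Suc n. T ^ j * V * T ^ (Suc n - j))"
    by (simp only: Suc sum.atMost_Suc_shift[of _ n] sum_distrib_left) (simp add: mult.assoc add.commute)
  finally show ?case .
qed simp

context onb_space
begin

context
  fixes T V :: "'a bop"
  assumes T: "self_adjoint T" and V: "self_adjoint V" "hs V"
begin

lemma hs_two_sided: "hs (T ^ m * V * T ^ j)"
  by (intro hs_mult_left hs_mult_right V)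

definition mixed_moment :: "nat \<Rightarrow> nat \<Rightarrow> complex" where
  "mixed_moment m j = hs_inner (T ^ m * V * T ^ j) V"

text \<open>Up to rotation, a word with two letters \<open>V\<close> is determined by the lengths of
  the two gaps between them, which are the arguments of \<open>mixed_moment\<close>.\<close>

lemma tr_mixed_moment: "tr ((T ^ i * V * T ^ j) * (V * T ^ k)) = mixed_moment (k + i) j"
proof -
  have "tr ((T ^ i * V * T ^ j) * (V * T ^ k)) = tr ((V * T ^ k) * (T ^ i * V * T ^ j))"
    by (intro tr_mult_commute hs_two_sided hs_mult_right V)
  also have "\<dots> = tr (V * (T ^ (k + i) * V * T ^ j))" by (simp add: power_add mult.assoc)
  also have "\<dots> = mixed_moment (k + i) j"
    by (simp add: tr_mult mixed_moment_def adj_self_adjoint V)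
  finally show ?thesis .
qed

lemma mixed_moment_commute: "mixed_moment m j = mixed_moment j m"
  using tr_mixed_moment[of 0 m j] tr_mixed_moment[of 0 j m]
    tr_mult_commute[OF hs_mult_right(1)[OF V(2), of "T ^ m"] hs_mult_right(1)[OF V(2), of "T ^ j"]]
  by simp

text \<open>Complex conjugation reverses the word and thus exchanges the gaps, which does not change
  the moment.\<close>

lemma Im_mixed_moment: "Im (mixed_moment m j) = 0"
proof -
  have "cnj (mixed_moment m j) = hs_inner V (T ^ m * V * T ^ j)"
    unfolding mixed_moment_def by (rule hs_inner_commute[symmetric])
  also have "\<dots> = hs_inner (adj_op (T ^ m * V * T ^ j)) (adj_op V)"
    by (intro hs_inner_adj hs_two_sided V)
  also have "\<dots> = mixed_moment j m"
    by (simp add: mixed_moment_def adj_mult adj_self_adjoint self_adjoint_power T V mult.assoc)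
  also have "\<dots> = mixed_moment m j" by (rule mixed_moment_commute)
  finally show ?thesis by (metis Reals_cnj_iff complex_is_Real_iff)
qed

text \<open>Two letters \<open>V\<close> enclosing \<open>j\<close> letters \<open>T\<close> fit
  into a word of length \<open>N + 2\<close> at \<open>N + 1 - j\<close> positions. The prefix
  \<open>T ^ r\<close> is there for the induction: the letters \<open>T\<close> split off at the
  left accumulate in it.\<close>

lemma tr_power_words_2:
  "tr (T ^ r * words T V (N + 2) 2) = (\<Sum>j\<le>N. of_nat (N + 1 - j) * mixed_moment (r + N - j) j)"
proof (induction N arbitrary: r)
  have second: "tr (T ^ r * V * words T V (Suc N) 1) = (\<Sum>j\<le>N. mixed_moment (r + N - j) j)" for r N
  proof -
    have "T ^ r * V * words T V (Suc N) 1 = (\<Sum>j\<le>N. (T ^ r * V * T ^ j) * (V * T ^ (N - j)))"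
      by (simp only: words_Suc_1 sum_distrib_left mult.assoc)
    then have "tr (T ^ r * V * words T V (Suc N) 1) = (\<Sum>j\<le>N. tr ((T ^ r * V * T ^ j) * (V * T ^ (N - j))))"
      by (simp only:) (intro tr_sum nuclear_mult hs_two_sided hs_mult_right V)
    then show ?thesis by (simp add: tr_mixed_moment add.commute)
  qed
  have split: "tr (T ^ r * words T V (N + 2) 2)
      = tr (T ^ Suc r * words T V (Suc N) 2) + tr (T ^ r * V * words T V (Suc N) 1)" for r N
  proof -
    have "T ^ r * words T V (N + 2) 2 = T ^ Suc r * words T V (Suc N) 2 + T ^ r * V * words T V (Suc N) 1"
      by (simp add: numeral_2_eq_2 distrib_left mult.assoc power_commutes)
        (simp flip: mult.assoc power_commutes)
    moreover have "nuclear (T ^ Suc r * words T V (Suc N) 2)"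
      unfolding numeral_2_eq_2 by (intro nuclear_mult_left words_nuclear V)
    moreover have "nuclear (T ^ r * V * words T V (Suc N) 1)"
      unfolding One_nat_def by (intro nuclear_mult hs_mult_left words_hs V)
    ultimately show ?thesis by (simp only: tr_add)
  qed
  {
    case 0
    show ?case
      using split[of r 0] second[of r 0] by (simp add: words_eq_0 tr_zero)
  next
    case (Suc N)
    have "tr (T ^ r * words T V (Suc N + 2) 2)
        = tr (T ^ Suc r * words T V (N + 2) 2) + (\<Sum>j\<le>Suc N. mixed_moment (r + Suc N - j) j)"
      using split[of r "Suc N"] second[of r "Suc N"] by simp
    also have "tr (T ^ Suc r * words T V (N + 2) 2)
        = (\<Sum>j\<le>Suc N. of_nat (Suc N - j) * mixed_moment (r + Suc N - j) j)"
      unfolding Suc by simp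
    also have "\<dots> + (\<Sum>j\<le>Suc N. mixed_moment (r + Suc N - j) j)
        = (\<Sum>j\<le>Suc N. of_nat (Suc N + 1 - j) * mixed_moment (r + Suc N - j) j)"
      unfolding sum.distrib[symmetric]
      by (intro sum.cong refl) (simp add: of_nat_diff algebra_simps)
    finally show ?case .
  }
qed

text \<open>Exchanging the gaps pairs the weight \<open>N + 1 - j\<close> with \<open>j + 1\<close>;
  their sum \<open>N + 2\<close> no longer depends on \<open>j\<close>.\<close>

lemma tr_words_2:
  "2 * tr (words T V (N + 2) 2) = of_nat (N + 2) * (\<Sum>j\<le>N. mixed_moment (N - j) j)"
proof -
  have S: "tr (words T V (N + 2) 2) = (\<Sum>j\<le>N. of_nat (N + 1 - j) * mixed_moment (N - j) j)"
    using tr_power_words_2[of 0 N] by simp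
  also have "\<dots> = (\<Sum>j\<le>N. of_nat (j + 1) * mixed_moment (N - j) j)"
  proof -
    have "(\<Sum>j<Suc N. of_nat (N + 1 - j) * mixed_moment (N - j) j)
        = (\<Sum>j<Suc N. of_nat (N + 1 - (Suc N - Suc j)) * mixed_moment (N - (Suc N - Suc j)) (Suc N - Suc j))"
      by (rule sum.nat_diff_reindex[symmetric])
    also have "\<dots> = (\<Sum>j<Suc N. of_nat (j + 1) * mixed_moment (N - j) j)"
      by (intro sum.cong refl) (auto simp: mixed_moment_commute)
    finally show ?thesis by (simp only: lessThan_Suc_atMost)
  qed
  finally have S': "tr (words T V (N + 2) 2) = (\<Sum>j\<le>N. of_nat (j + 1) * mixed_moment (N - j) j)" .
  have "2 * tr (words T V (N + 2) 2)
      = (\<Sum>j\<le>N. (of_nat (N + 1 - j) + of_nat (j + 1)) * mixed_moment (N - j) j)"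
    using arg_cong2[OF S S', of "(+)"] by (simp only: mult_2 distrib_right sum.distrib)
  also have "\<dots> = (\<Sum>j\<le>N. of_nat (N + 2) * mixed_moment (N - j) j)"
    by (intro sum.cong refl) (simp add: of_nat_diff)
  finally show ?thesis by (simp add: sum_distrib_left)
qed

lemma hs_form_mixed_mult_funpow:
  "hs_form ((mixed_mult s T ^^ N) V) V = (\<Sum>m\<le>N. Bernstein N m s * Re (mixed_moment m (N - m)))"
proof -
  have "hs_inner ((mixed_mult s T ^^ N) V) V
      = (\<Sum>m\<le>N. hs_inner (Bernstein N m s *\<^sub>R (T ^ m * V * T ^ (N - m))) V)"
    unfolding mixed_mult_funpow by (intro hs_inner_sum_left[THEN conjunct1] hs_scaleR hs_two_sided V)
  then show ?thesis by (simp add: hs_form_def hs_inner_scaleR_left mixed_moment_def)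
qed

text \<open>The divided difference of \<open>\<lambda>x. x ^ (N + 1)\<close> is the integral of its derivative along the segment
  joining the two points; applied to left and right multiplication by \<open>T\<close>, this turns the trace of
  the second derivative into an integral of moments of \<open>mixed_mult s T\<close>.\<close>

lemma tr_words_2_integral:
  "tr (words T V (N + 2) 2) = complex_of_real
    ((real (N + 2) * real (N + 1) / 2) * integral {0..1} (\<lambda>s. hs_form ((mixed_mult s T ^^ N) V) V))"
proof -
  have "((\<lambda>s. \<Sum>m\<le>N. Bernstein N m s * Re (mixed_moment m (N - m))) has_integral
      (\<Sum>m\<le>N. 1 / real (Suc N) * Re (mixed_moment m (N - m)))) {0..1}"
    by (intro has_integral_sum has_integral_mult_left Bernstein_has_integral) auto
  then have "integral {0..1} (\<lambda>s. hs_form ((mixed_mult s T ^^ N) V) V)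
      = (\<Sum>m\<le>N. Re (mixed_moment m (N - m))) / real (N + 1)"
    unfolding hs_form_mixed_mult_funpow by (simp add: integral_unique sum_divide_distrib)
  moreover have "complex_of_real (\<Sum>m\<le>N. Re (mixed_moment m (N - m))) = (\<Sum>m\<le>N. mixed_moment (N - m) m)"
    unfolding of_real_sum
    by (intro sum.cong refl) (auto simp: complex_eq_iff Im_mixed_moment mixed_moment_commute)
  ultimately have "2 * tr (words T V (N + 2) 2) = complex_of_real (2 *
    ((real (N + 2) * real (N + 1) / 2) * integral {0..1} (\<lambda>s. hs_form ((mixed_mult s T ^^ N) V) V)))"
    using tr_words_2[of N] by (simp del: of_real_sum of_nat_Suc add_2_eq_Suc')
  then show ?thesis
    unfolding of_real_mult[of 2] of_real_numeral by (rule mult_left_cancel[THEN iffD1, rotated]) simp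
qed

end

text \<open>Polynomials in \<open>t\<close> and \<open>s\<close> with Hilbert-Schmidt coefficients,
  introduced for the joint continuity needed in the double integral. The form against
  \<open>V\<close> need not be continuous in the operator norm, so continuity is read off from the
  polynomial structure.\<close>

inductive hs_poly :: "(real \<Rightarrow> real \<Rightarrow> 'a bop) \<Rightarrow> bool" where
  const: "hs X \<Longrightarrow> hs_poly (\<lambda>t s. X)"
| add: "hs_poly X \<Longrightarrow> hs_poly Y \<Longrightarrow> hs_poly (\<lambda>t s. X t s + Y t s)"
| scale1: "hs_poly X \<Longrightarrow> hs_poly (\<lambda>t s. t *\<^sub>R X t s)"
| scale2: "hs_poly X \<Longrightarrow> hs_poly (\<lambda>t s. s *\<^sub>R X t s)"

lemma hs_poly_mult_left: "hs_poly X \<Longrightarrow> hs_poly (\<lambda>t s. Z * X t s)"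
  by (induction rule: hs_poly.induct) (simp_all add: distrib_left hs_poly.intros hs_mult_left)

lemma hs_poly_mult_right: "hs_poly X \<Longrightarrow> hs_poly (\<lambda>t s. X t s * Z)"
  by (induction rule: hs_poly.induct) (simp_all add: distrib_right hs_poly.intros hs_mult_right)

lemma hs_poly_hs: "hs_poly X \<Longrightarrow> hs (X t s)"
  by (induction rule: hs_poly.induct) (simp_all add: hs_add hs_scaleR)

lemma hs_poly_diff:
  assumes "hs_poly X" "hs_poly Y"
  shows "hs_poly (\<lambda>t s. X t s - Y t s)"
  using hs_poly.add[OF assms(1) hs_poly_mult_left[OF assms(2), of "- 1"]] by simp

lemma hs_poly_mixed_mult:
  assumes X: "hs_poly X"
  shows "hs_poly (\<lambda>t s. mixed_mult s (A + t *\<^sub>R B) (X t s))"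
proof -
  have "hs_poly (\<lambda>t s. (A * X t s) + t *\<^sub>R (B * X t s))" "hs_poly (\<lambda>t s. (X t s * A) + t *\<^sub>R (X t s * B))"
    by (intro hs_poly.intros hs_poly_mult_left hs_poly_mult_right X)+
  then have "hs_poly (\<lambda>t s. (A + t *\<^sub>R B) * X t s)" "hs_poly (\<lambda>t s. X t s * (A + t *\<^sub>R B))"
    by (simp_all add: distrib_left distrib_right)
  then have "hs_poly (\<lambda>t s. s *\<^sub>R ((A + t *\<^sub>R B) * X t s) + (X t s * (A + t *\<^sub>R B) - s *\<^sub>R (X t s * (A + t *\<^sub>R B))))"
    by (intro hs_poly.intros hs_poly_diff)
  then show ?thesis by (simp add: mixed_mult_def scaleR_left_diff_distrib)
qed

lemma hs_poly_mixed_mult_funpow: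
  "hs_poly X \<Longrightarrow> hs_poly (\<lambda>t s. (mixed_mult s (A + t *\<^sub>R B) ^^ n) (X t s))"
  by (induction n) (simp_all add: hs_poly_mixed_mult)

lemma continuous_on_hs_poly:
  assumes "hs_poly X" "hs V"
  shows "continuous_on UNIV (\<lambda>(t, s). hs_form (X t s) V)"
  using assms(1)
proof (induction rule: hs_poly.induct)
  case (add X Y)
  then show ?case
    by (auto simp: hs_form_add_left hs_poly_hs assms(2) case_prod_unfold intro!: continuous_intros)
qed (auto simp: hs_form_scaleR_left case_prod_unfold intro!: continuous_intros)

text \<open>Taylor's formula with integral remainder along the segment from \<open>A\<close> to
  \<open>A + V\<close>, under the trace: twice \<open>words (A + t *\<^sub>R V) V n 2\<close> is the
  second derivative in \<open>t\<close> of the \<open>n\<close>-th power. Term by term it says that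
  \<open>k * (k - 1) * (1 - t) * t ^ (k - 2)\<close> has integral one.\<close>

lemma sum_tr_words_has_integral:
  assumes V: "hs V"
  shows "((\<lambda>t. complex_of_real (2 * (1 - t)) * tr (words (A + t *\<^sub>R V) V n 2)) has_integral
    (\<Sum>k\<in>{2..n}. tr (words A V n k))) {0..1}"
proof -
  have nuc: "nuclear ((real (k choose 2) * t ^ (k - 2)) *\<^sub>R words A V n k)" for k t
  proof (cases "k < 2")
    case True
    then show ?thesis by (simp add: binomial_eq_0 nuclear_zero)
  next
    case False
    then obtain i where "k = Suc (Suc i)" by (metis add_2_eq_Suc le_Suc_ex not_less)
    then show ?thesis by (simp only:) (intro nuclear_scaleR words_nuclear V)
  qed
  have tr_eq: "complex_of_real (2 * (1 - t)) * tr (words (A + t *\<^sub>R V) V n 2)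
      = (\<Sum>k\<in>{2..n}. (real k * (real k - 1) * (t ^ (k - 2) - t ^ (k - 1))) *\<^sub>R tr (words A V n k))" for t
  proof -
    have "tr (words (A + t *\<^sub>R V) V n 2) = (\<Sum>k\<le>n. complex_of_real (real (k choose 2) * t ^ (k - 2)) * tr (words A V n k))"
      unfolding words_shift by (subst tr_sum[OF nuc]) (simp only: tr_scaleR)
    also have "\<dots> = (\<Sum>k\<in>{2..n}. complex_of_real (real (k choose 2) * t ^ (k - 2)) * tr (words A V n k))"
      by (rule sum.mono_neutral_right) (auto simp: binomial_eq_0)
    finally show ?thesis
    proof (simp only: sum_distrib_left, intro sum.cong refl)
      fix k assume "k \<in> {2..n}"
      then obtain i where k: "k = Suc (Suc i)" by (metis add_2_eq_Suc atLeastAtMost_iff le_Suc_ex)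
      have "2 * real (k choose 2) = real k * (real k - 1)"
      proof -
        have "2 * (k choose 2) = k * (k - 1)"
          using binomial_absorption[of 1 k] by (simp add: numeral_2_eq_2)
        from arg_cong[OF this, of real] show ?thesis by (simp add: k algebra_simps)
      qed
      then have "2 * (1 - t) * (real (k choose 2) * t ^ (k - 2)) = real k * (real k - 1) * (t ^ (k - 2) - t ^ (k - 1))"
        by (simp add: k algebra_simps)
      then show "complex_of_real (2 * (1 - t)) * (complex_of_real (real (k choose 2) * t ^ (k - 2)) * tr (words A V n k))
          = (real k * (real k - 1) * (t ^ (k - 2) - t ^ (k - 1))) *\<^sub>R tr (words A V n k)"
        by (simp only: scaleR_conv_of_real mult.assoc[symmetric] of_real_mult[symmetric])
    qed
  qed
  have "((\<lambda>t. real k * (real k - 1) * (t ^ (k - 2) - t ^ (k - 1))) has_integral 1) {0..1}"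
    if k: "k \<in> {2..n}" for k
  proof -
    obtain i where i: "k = Suc (Suc i)" using k by (metis add_2_eq_Suc atLeastAtMost_iff le_Suc_ex)
    have "((\<lambda>t. real k * (real k - 1) * (t ^ (k - 2) - t ^ (k - 1))) has_integral
        (real k * 1 ^ (k - 1) - (real k - 1) * 1 ^ k) - (real k * 0 ^ (k - 1) - (real k - 1) * 0 ^ k)) {0..1}"
    proof (rule fundamental_theorem_of_calculus)
      fix t :: real
      have "((\<lambda>t. real k * t ^ (k - 1) - (real k - 1) * t ^ k) has_real_derivative
          real k * (real (k - 1) * t ^ (k - 1 - Suc 0)) - (real k - 1) * (real k * t ^ (k - Suc 0))) (at t within {0..1})"
        by (intro DERIV_diff DERIV_cmult DERIV_pow)
      also have "real k * (real (k - 1) * t ^ (k - 1 - Suc 0)) - (real k - 1) * (real k * t ^ (k - Suc 0))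
          = real k * (real k - 1) * (t ^ (k - 2) - t ^ (k - 1))"
        by (simp add: i algebra_simps)
      finally show "((\<lambda>t. real k * t ^ (k - 1) - (real k - 1) * t ^ k) has_vector_derivative
          real k * (real k - 1) * (t ^ (k - 2) - t ^ (k - 1))) (at t within {0..1})"
        by (simp only: has_real_derivative_iff_has_vector_derivative)
    qed simp
    then show ?thesis by (simp add: i)
  qed
  from has_integral_scaleR_left[OF this]
  have "((\<lambda>t. \<Sum>k\<in>{2..n}. (real k * (real k - 1) * (t ^ (k - 2) - t ^ (k - 1))) *\<^sub>R tr (words A V n k))
      has_integral (\<Sum>k\<in>{2..n}. 1 *\<^sub>R tr (words A V n k))) {0..1}"
    by (intro has_integral_sum) auto
  then show ?thesis unfolding tr_eq by simp
qed

lemma words_nuclear_3: "hs V \<Longrightarrow> nuclear (words A V n (k + 3))"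
  using words_nuclear[of V A n "Suc k"] by (simp add: eval_nat_numeral del: words.simps)

lemma tr_power_remainder:
  assumes V: "hs V"
  shows "tr (power_remainder A V (N + 2)) = (\<Sum>k\<in>{2..N + 2}. tr (words A V (N + 2) k)) - tr (words A V (N + 2) 2)"
proof -
  have "tr (power_remainder A V (N + 2)) = (\<Sum>k<N + 2. tr (words A V (N + 2) (k + 3)))"
    unfolding power_remainder_def by (intro tr_sum words_nuclear_3 V)
  also have "\<dots> = (\<Sum>k<N. tr (words A V (N + 2) (k + 3)))"
    by (rule sum.mono_neutral_right) (auto simp: words_eq_0 tr_zero)
  also have "\<dots> = (\<Sum>k\<in>{3..<N + 3}. tr (words A V (N + 2) k))"
    by (rule sum.reindex_bij_witness[of _ "\<lambda>k. k - 3" "\<lambda>k. k + 3"]) auto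
  also have "\<dots> = (\<Sum>k\<in>{2..N + 2}. tr (words A V (N + 2) k)) - tr (words A V (N + 2) 2)"
  proof -
    have "{2..N + 2} = insert 2 {3..<N + 3}" by auto
    then show ?thesis by simp
  qed
  finally show ?thesis .
qed

lemma nuclear_power_remainder: "hs V \<Longrightarrow> nuclear (power_remainder A V n)"
  unfolding power_remainder_def by (intro nuclear_sum words_nuclear_3)

text \<open>\<open>w1\<close> and \<open>w2\<close> are the values at
  \<open>u ^ k * (1 - u) ^ l\<close> of the two positive functionals of the overview,
  \<open>w1\<close> for the first-order remainder and \<open>w2\<close> for half the second
  derivative. The recursion expresses \<open>1 = u + (1 - u)\<close>, and
  \<open>(N + 2) * (N + 1)\<close> comes from the second derivative of
  \<open>x ^ (N + 2)\<close>.\<close>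

proposition tr_power_remainder_weights:
  assumes A: "self_adjoint A" and V: "self_adjoint V" "hs V"
    and pos: "\<And>t. t \<in> {0..1} \<Longrightarrow> positive_op (A + t *\<^sub>R V)"
      "\<And>t. t \<in> {0..1} \<Longrightarrow> positive_op (1 - (A + t *\<^sub>R V))"
  obtains w1 w2 :: "nat \<Rightarrow> nat \<Rightarrow> real"
  where "\<And>k l. 0 \<le> w1 k l" "\<And>k l. w1 k l = w1 (Suc k) l + w1 k (Suc l)"
    and "\<And>k l. 0 \<le> w2 k l" "\<And>k l. w2 k l = w2 (Suc k) l + w2 k (Suc l)"
    and "w1 0 0 = w2 0 0"
    and "\<And>N. tr (power_remainder A V (N + 2)) = complex_of_real (real (N + 2) * real (N + 1) * (w1 N 0 - w2 N 0))"
proof -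
  define T where "T t = A + t *\<^sub>R V" for t
  define u where "u t s k l = hs_form ((mixed_mult s (T t) ^^ k) ((mixed_mult s (1 - T t) ^^ l) V)) V" for t s k l
  define v where "v t k l = integral {0..1} (\<lambda>s. u t s k l)" for t k l
  define w1 where "w1 k l = integral {0..1} (\<lambda>t. (1 - t) * v t k l)" for k l
  define w2 where "w2 k l = v 0 k l / 2" for k l
  have T_sa: "self_adjoint (T t)" for t
    unfolding T_def by (intro self_adjoint_add self_adjoint_scaleR A V)
  \<comment> \<open>Brings \<open>1 - T t\<close> into the affine shape that
    \<open>hs_poly_mixed_mult_funpow\<close> expects.\<close>
  have T1: "1 - T t = (1 - A) + t *\<^sub>R (- V)" for t by (simp add: T_def)
  have "hs_poly (\<lambda>t s. (mixed_mult s (A + t *\<^sub>R V) ^^ k) ((mixed_mult s ((1 - A) + t *\<^sub>R (- V)) ^^ l) V))" for k l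
    by (intro hs_poly_mixed_mult_funpow hs_poly.const V)
  then have u_cont: "continuous_on UNIV (\<lambda>(t, s). u t s k l)" for k l
    unfolding u_def T1 unfolding T_def by (intro continuous_on_hs_poly V)
  have u_cont_s: "continuous_on {0..1} (\<lambda>s. u t s k l)" for t k l
    using continuous_on_compose2[OF u_cont, of "{0..1}" "\<lambda>s. (t, s)"] by (simp add: continuous_intros)
  have u_int: "(\<lambda>s. u t s k l) integrable_on {0..1}" for t k l
    by (rule integrable_continuous_real[OF u_cont_s])
  have "continuous_on {0..1} (\<lambda>t. integral (cbox 0 1) (u' t))"
    if "continuous_on UNIV (\<lambda>(t, s). u' t s)" for u' :: "real \<Rightarrow> real \<Rightarrow> real"
    by (rule integral_continuous_on_param) (rule continuous_on_subset[OF that], simp)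
  from this[OF u_cont] have "continuous_on {0..1} (\<lambda>t. v t k l)" for k l
    by (simp add: v_def)
  then have v_int: "(\<lambda>t. (1 - t) * v t k l) integrable_on {0..1}" for k l
    by (intro integrable_continuous_real continuous_intros)
  have u_rec: "u t s k l = u t s (Suc k) l + u t s k (Suc l)" for t s k l
  proof -
    let ?P = "mixed_mult s (T t)" and ?Q = "mixed_mult s (1 - T t)"
    let ?Z = "(?P ^^ k) ((?Q ^^ l) V)"
    have "?P (?Q Y) = ?Q (?P Y)" for Y
      by (rule mixed_mult_commute) (simp add: left_diff_distrib right_diff_distrib)
    then have QP: "(?P ^^ k) (?Q Y) = ?Q ((?P ^^ k) Y)" for k Y by (induction k) simp_all
    have "?Z = ?P ?Z + ?Q ?Z" by (simp only: mixed_mult_one_minus)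
    moreover have "hs ?Z" by (intro hs_mixed_mult_funpow V)
    ultimately have "hs_form ?Z V = hs_form (?P ?Z) V + hs_form (?Q ?Z) V"
      by (metis hs_form_add_left hs_mixed_mult V(2))
    then show ?thesis by (simp add: u_def QP)
  qed
  have v_rec: "v t k l = v t (Suc k) l + v t k (Suc l)" for t k l
    unfolding v_def by (subst u_rec) (rule integral_add[OF u_int u_int])
  have v_nonneg: "0 \<le> v t k l" if "t \<in> {0..1}" for t k l
    unfolding v_def u_def
    by (intro integral_nonneg u_int[unfolded u_def] hs_form_mixed_mult_funpow_nonneg V) (use pos that in \<open>auto simp: T_def\<close>)
  have v00: "v t 0 0 = hs_form V V" for t by (simp add: v_def u_def)
  have tr_words: "tr (words (T t) V (N + 2) 2) = complex_of_real ((real (N + 2) * real (N + 1) / 2) * v t N 0)" for t N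
    unfolding v_def u_def funpow_0 by (rule tr_words_2_integral[OF T_sa V])
  show ?thesis
  proof (rule that)
    show "0 \<le> w1 k l" for k l
      unfolding w1_def by (intro integral_nonneg v_int mult_nonneg_nonneg v_nonneg) auto
    show "w1 k l = w1 (Suc k) l + w1 k (Suc l)" for k l
      unfolding w1_def by (subst v_rec, subst distrib_left) (rule integral_add[OF v_int v_int])
    show "0 \<le> w2 k l" "w2 k l = w2 (Suc k) l + w2 k (Suc l)" for k l
      using v_nonneg[of 0 k l] v_rec[of 0 k l] by (simp_all add: w2_def)
    \<comment> \<open>Equal masses: \<open>v t 0 0\<close> does not depend on \<open>t\<close>, and
      the weight \<open>1 - t\<close> integrates to the factor \<open>1/2\<close> of
      \<open>w2\<close>.\<close>
    have "((\<lambda>t :: real. 1 - t) has_integral (1 - 1\<^sup>2 / 2) - (0 - 0\<^sup>2 / 2)) {0..1}"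
      by (rule fundamental_theorem_of_calculus)
        (auto intro!: derivative_eq_intros simp flip: has_real_derivative_iff_has_vector_derivative)
    from integral_unique[OF has_integral_mult_left[OF this, of "hs_form V V"]] show "w1 0 0 = w2 0 0"
      unfolding w1_def w2_def v00 by simp
    fix N
    let ?c = "real (N + 2) * real (N + 1)"
    have "((\<lambda>t. complex_of_real (2 * (1 - t)) * tr (words (T t) V (N + 2) 2)) has_integral
        complex_of_real (?c * w1 N 0)) {0..1}"
    proof -
      have "((\<lambda>t. ?c * ((1 - t) * v t N 0)) has_integral ?c * w1 N 0) {0..1}"
        unfolding w1_def by (intro has_integral_mult_right integrable_integral v_int)
      from has_integral_linear[OF this bounded_linear_of_real]
      have "((\<lambda>t. complex_of_real (?c * ((1 - t) * v t N 0))) has_integral complex_of_real (?c * w1 N 0)) {0..1}"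
        by (simp only: o_def)
      moreover have "complex_of_real (?c * ((1 - t) * v t N 0))
          = complex_of_real (2 * (1 - t)) * tr (words (T t) V (N + 2) 2)" for t
        unfolding tr_words of_real_mult[symmetric] by (rule arg_cong) simp
      ultimately show ?thesis by simp
    qed
    from has_integral_unique[OF this sum_tr_words_has_integral[OF V(2), of A "N + 2", folded T_def]]
    have "(\<Sum>k\<in>{2..N + 2}. tr (words A V (N + 2) k)) = complex_of_real (?c * w1 N 0)" ..
    moreover have "tr (words A V (N + 2) 2) = complex_of_real (?c * w2 N 0)"
      using tr_words[of 0 N] by (simp add: T_def w2_def)
    ultimately show "tr (power_remainder A V (N + 2)) = complex_of_real (?c * (w1 N 0 - w2 N 0))"
      unfolding tr_power_remainder[OF V(2)] by (simp add: right_diff_distrib)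
  qed
qed

end

section \<open>Moment problems on an interval\<close>

text \<open>For \<open>k < N\<close> truncated subtraction supplies the zero factor at
  \<open>i = k\<close>.\<close>

lemma fact_mult_binomial: "fact N * (k choose N) = (\<Prod>i<N. k - i)"
proof (induction N)
  case (Suc N)
  have "Suc N * (k choose Suc N) = (k - N) * (k choose N)"
    by (simp only: binomial_absorption binomial_absorb_comp)
  then have "fact (Suc N) * (k choose Suc N) = fact N * ((k - N) * (k choose N))"
    by (simp only: fact_Suc of_nat_id) (metis mult.assoc mult.commute)
  then show ?case using Suc by (simp add: ac_simps)
qed simp

lemma binomial_ratio:
  assumes "N \<le> n"
  shows "real (k choose N) / real (n choose N) = (\<Prod>i<N. real (k - i) / real (n - i))"
proof -
  have "real (k choose N) / real (n choose N) = (fact N * real (k choose N)) / (fact N * real (n choose N))"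
    by simp
  also have "\<dots> = real (\<Prod>i<N. k - i) / real (\<Prod>i<N. n - i)"
    by (simp only: fact_mult_binomial[symmetric] of_nat_mult of_nat_fact)
  finally show ?thesis by (simp add: prod_dividef)
qed

text \<open>Drawing \<open>N\<close> times without replacement is compared with drawing with
  replacement, factor by factor. All factors lie in \<open>{0..1}\<close>, so the errors add
  up.\<close>

lemma binomial_ratio_approx:
  assumes N: "N < n" and k: "k \<le> n"
  shows "\<bar>real (k choose N) / real (n choose N) - (real k / real n) ^ N\<bar> \<le> real N * (real N / (real n - real N))"
proof -
  have term_le: "\<bar>real (k - i) / real (n - i) - real k / real n\<bar> \<le> real N / (real n - real N)" if i: "i < N" for i
  proof -
    have le: "real i / (real n - real i) \<le> real N / (real n - real N)"
      using i N by (intro frac_le) auto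
    show ?thesis
    proof (cases "i \<le> k")
      case True
      \<comment> \<open>The difference of the two factors is exactly \<open>p * q\<close>, with
        \<open>q\<close> in \<open>{0..1}\<close>.\<close>
      define p q where "p = real i / (real n - real i)" and "q = (real n - real k) / real n"
      have "real k / real n - real (k - i) / real (n - i) = p * q"
        unfolding p_def q_def using True i N by (simp add: of_nat_diff field_simps)
      moreover have "0 \<le> q" "q \<le> 1" using k N by (simp_all add: q_def divide_le_eq)
      moreover have "0 \<le> p" using i N by (simp add: p_def)
      moreover have "\<bar>x - y\<bar> \<le> p" if "y - x = r" "0 \<le> r" "r \<le> p" for x y r
        using that by linarith
      ultimately have "\<bar>real (k - i) / real (n - i) - real k / real n\<bar> \<le> p"
        using mult_left_le[of q p] mult_nonneg_nonneg[of p q] by blast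
      then show ?thesis using le unfolding p_def by (rule order_trans)
    next
      case False
      then have "real k / real n \<le> real i / (real n - real i)"
        using i N by (intro frac_le) auto
      then show ?thesis using False le by simp
    qed
  qed
  have "\<bar>(\<Prod>i<N. real (k - i) / real (n - i)) - (\<Prod>i<N. real k / real n)\<bar>
      \<le> (\<Sum>i<N. \<bar>real (k - i) / real (n - i) - real k / real n\<bar>)"
    unfolding real_norm_def[symmetric]
    by (rule norm_prod_diff) (use k N in \<open>auto simp: divide_le_eq_1\<close>)
  also have "\<dots> \<le> (\<Sum>i<N. real N / (real n - real N))"
    by (intro sum_mono term_le) simp
  finally show ?thesis using N by (simp add: binomial_ratio)
qed

lemma borel_measurable_lebesgue_on: "f \<in> borel_measurable borel \<Longrightarrow> f \<in> borel_measurable (lebesgue_on S)"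
  by (simp add: measurable_completion measurable_restrict_space1)

lemma integrable_lebesgue_on_bounded:
  fixes f :: "real \<Rightarrow> real"
  assumes "f \<in> borel_measurable borel" "\<And>x. x \<in> {a..b} \<Longrightarrow> \<bar>f x\<bar> \<le> B"
  shows "integrable (lebesgue_on {a..b}) f"
proof -
  interpret finite_measure "lebesgue_on {a..b}" by (rule finite_measure_lebesgue_on) simp
  show ?thesis
    by (rule integrable_const_bound[of _ B]) (use assms in \<open>auto intro: borel_measurable_lebesgue_on AE_I2\<close>)
qed

text \<open>Helly's selection theorem asks for right-continuous functions, which is why the steps
  below include their jump point.\<close>

lemma continuous_at_right_step: "continuous (at_right x) (\<lambda>x :: real. if c \<le> x then 1 else 0 :: real)"
proof (cases "c \<le> x")
  case True
  then have "eventually (\<lambda>y. (if c \<le> y then 1 else 0 :: real) = (if c \<le> x then 1 else 0)) (at_right x)"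
    unfolding eventually_at_right_field by (intro exI[of _ "x + 1"]) auto
  then show ?thesis unfolding continuous_within by (rule tendsto_eventually)
next
  case False
  then have "eventually (\<lambda>y. (if c \<le> y then 1 else 0 :: real) = (if c \<le> x then 1 else 0)) (at_right x)"
    unfolding eventually_at_right_field by (intro exI[of _ c]) auto
  then show ?thesis unfolding continuous_within by (rule tendsto_eventually)
qed

lemma AE_lebesgue_on_isCont_mono:
  fixes F :: "real \<Rightarrow> real"
  assumes "mono F" "S \<in> sets lebesgue"
  shows "AE x in lebesgue_on S. isCont F x"
proof -
  have "{x. \<not> isCont F x} \<in> null_sets lebesgue"
    by (intro null_sets_completionI countable_imp_null_set_lborel mono_ctble_discont assms)
  then have "AE x in lebesgue. isCont F x" by (rule AE_I'[of _ _ _]) auto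
  then show ?thesis
    using assms(2) by (subst AE_restrict_space_iff) (auto elim: AE_mp)
qed

text \<open>Hausdorff's moment problem: \<open>w k l\<close> plays the role of the integral of \<open>u ^ k * (1 - u) ^ l\<close>
  against a measure on \<open>{0..1}\<close>, here transported to \<open>{a..b}\<close>; \<open>F\<close> is its distribution function,
  and the identity is the moment formula after integration by parts.\<close>

proposition hausdorff_moments:
  fixes w :: "nat \<Rightarrow> nat \<Rightarrow> real" and a b :: real
  assumes nonneg: "\<And>k l. 0 \<le> w k l" and rec: "\<And>k l. w k l = w (Suc k) l + w k (Suc l)" and ab: "a < b"
  obtains F where "mono F" "\<And>x. \<bar>F x\<bar> \<le> w 0 0"
    "\<And>N. w N 0 = w 0 0 - integral\<^sup>L (lebesgue_on {a..b})
       (\<lambda>x. real N / (b - a) * ((x - a) / (b - a)) ^ (N - 1) * F x)"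
proof -
  define c where "c = b - a"
  have c: "c > 0" using ab by (simp add: c_def)
  \<comment> \<open>The mass at \<open>k / n\<close> of a discrete approximation: for moments of a
    measure it would be the integral of the Bernstein polynomial
    \<open>Bernstein n k\<close>.\<close>
  define \<mu> where "\<mu> n k = real (n choose k) * w k (n - k)" for n k
  have \<mu>_nonneg: "0 \<le> \<mu> n k" for n k by (simp add: \<mu>_def nonneg)
  \<comment> \<open>Formally \<open>u ^ k = u ^ k * (u + (1 - u)) ^ m\<close>.\<close>
  have expand: "w k 0 = (\<Sum>j\<le>m. real (m choose j) * w (k + j) (m - j))" for k m
  proof (induction m arbitrary: k)
    case (Suc m)
    have "(\<Sum>j\<le>Suc m. real (Suc m choose j) * w (k + j) (Suc m - j))
        = w k (Suc m) + (\<Sum>j\<le>m. (real (m choose j) + real (m choose Suc j)) * w (k + Suc j) (m - j))"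
      by (subst sum.atMost_Suc_shift) simp
    also have "\<dots> = (w k (Suc m) + (\<Sum>j\<le>m. real (m choose Suc j) * w (k + Suc j) (Suc m - Suc j)))
        + (\<Sum>j\<le>m. real (m choose j) * w (Suc k + j) (m - j))"
      by (simp add: distrib_right sum.distrib)
    also have "w k (Suc m) + (\<Sum>j\<le>m. real (m choose Suc j) * w (k + Suc j) (Suc m - Suc j))
        = (\<Sum>j\<le>Suc m. real (m choose j) * w (k + j) (Suc m - j))"
      by (simp only: sum.atMost_Suc_shift[of _ m]) simp
    also have "\<dots> = (\<Sum>j\<le>m. real (m choose j) * w (k + j) (Suc (m - j)))"
      by (simp add: binomial_eq_0 Suc_diff_le)
    also have "\<dots> + (\<Sum>j\<le>m. real (m choose j) * w (Suc k + j) (m - j)) = (\<Sum>j\<le>m. real (m choose j) * w (k + j) (m - j))"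
      unfolding sum.distrib[symmetric]
    proof (intro sum.cong refl)
      fix j
      have "w (k + j) (m - j) = w (Suc k + j) (m - j) + w (k + j) (Suc (m - j))"
        using rec[of "k + j" "m - j"] by simp
      then show "real (m choose j) * w (k + j) (Suc (m - j)) + real (m choose j) * w (Suc k + j) (m - j)
          = real (m choose j) * w (k + j) (m - j)"
        by (simp only: distrib_left add.commute)
    qed
    finally show ?case using Suc[of k] by simp
  qed simp
  have total: "(\<Sum>k\<le>n. \<mu> n k) = w 0 0" for n
    using expand[of 0 n] by (simp add: \<mu>_def)
  \<comment> \<open>For genuine moments this is the integrated identity that the Bernstein
    polynomials, weighted with these ratios of binomial coefficients, add up to
    \<open>u ^ N\<close>.\<close>
  have moment: "(\<Sum>k\<le>n. \<mu> n k * (real (k choose N) / real (n choose N))) = w N 0" if N: "N \<le> n" for n N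
  proof -
    have "(\<Sum>k\<le>n. \<mu> n k * (real (k choose N) / real (n choose N)))
        = (\<Sum>k\<in>{N..n}. \<mu> n k * (real (k choose N) / real (n choose N)))"
      by (rule sum.mono_neutral_right) (auto simp: binomial_eq_0)
    also have "\<dots> = (\<Sum>k\<in>{N..n}. real ((n - N) choose (k - N)) * w k (n - k))"
    proof (intro sum.cong refl)
      fix k assume k: "k \<in> {N..n}"
      then have "real (n choose k) * real (k choose N) = real (n choose N) * real ((n - N) choose (k - N))"
        using choose_mult[of N k n] by (simp flip: of_nat_mult)
      then show "\<mu> n k * (real (k choose N) / real (n choose N)) = real ((n - N) choose (k - N)) * w k (n - k)"
        using N by (simp add: \<mu>_def field_simps)
    qed
    also have "\<dots> = (\<Sum>j\<le>n - N. real ((n - N) choose j) * w (N + j) (n - N - j))"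
      by (rule sum.reindex_bij_witness[of _ "\<lambda>j. N + j" "\<lambda>k. k - N"]) (use N in auto)
    also have "\<dots> = w N 0" by (rule expand[symmetric])
    finally show ?thesis .
  qed
  \<comment> \<open>Replacing the ratios by \<open>(k / n) ^ N\<close> costs an error of order
    \<open>1 / n\<close>, since the total mass is \<open>w 0 0\<close> for every
    \<open>n\<close>.\<close>
  have lim: "(\<lambda>n. \<Sum>k\<le>n. \<mu> n k * (real k / real n) ^ N) \<longlonglongrightarrow> w N 0" for N
  proof -
    have "(\<lambda>n. (\<Sum>k\<le>n. \<mu> n k * (real k / real n) ^ N) - w N 0) \<longlonglongrightarrow> 0"
    proof (rule Lim_null_comparison)
      show "\<forall>\<^sub>F n in sequentially. norm ((\<Sum>k\<le>n. \<mu> n k * (real k / real n) ^ N) - w N 0)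
          \<le> w 0 0 * (real N * (real N / (real n - real N)))"
      proof (rule eventually_mono[OF eventually_gt_at_top[of N]])
        fix n assume n: "N < n"
        have "norm ((\<Sum>k\<le>n. \<mu> n k * (real k / real n) ^ N) - w N 0)
            = \<bar>\<Sum>k\<le>n. \<mu> n k * ((real k / real n) ^ N - real (k choose N) / real (n choose N))\<bar>"
          using moment[of N n] n by (simp add: right_diff_distrib sum_subtractf)
        also have "\<dots> \<le> (\<Sum>k\<le>n. \<mu> n k * (real N * (real N / (real n - real N))))"
        proof (rule order_trans[OF sum_abs sum_mono])
          fix k assume "k \<in> {..n}"
          then show "\<bar>\<mu> n k * ((real k / real n) ^ N - real (k choose N) / real (n choose N))\<bar>
              \<le> \<mu> n k * (real N * (real N / (real n - real N)))"
            using binomial_ratio_approx[OF n, of k] \<mu>_nonneg[of n k]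
            unfolding abs_mult by (intro mult_mono) (auto simp: abs_minus_commute)
        qed
        also have "\<dots> = w 0 0 * (real N * (real N / (real n - real N)))"
          by (simp only: total flip: sum_distrib_right)
        finally show "norm ((\<Sum>k\<le>n. \<mu> n k * (real k / real n) ^ N) - w N 0)
            \<le> w 0 0 * (real N * (real N / (real n - real N)))" .
      qed
      have "filterlim (\<lambda>n. real n - real N) at_top sequentially"
        using filterlim_tendsto_add_at_top[OF tendsto_const[of "- real N"] filterlim_real_sequentially] by simp
      then have "(\<lambda>n. real N / (real n - real N)) \<longlonglongrightarrow> 0"
        by (intro tendsto_divide_0[OF tendsto_const] filterlim_at_top_imp_at_infinity)
      from tendsto_mult_left[OF this, of "w 0 0 * real N"]
      show "(\<lambda>n. w 0 0 * (real N * (real N / (real n - real N)))) \<longlonglongrightarrow> 0" by (simp add: mult.assoc)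
    qed
    then show ?thesis by (simp add: LIM_zero_iff)
  qed
  \<comment> \<open>The distribution function of the \<open>n\<close>-th discrete approximation,
    transported to \<open>{a..b}\<close>.\<close>
  define f where "f n x = (\<Sum>k\<le>n. \<mu> n k * (if a + c * (real k / real n) \<le> x then 1 else 0))" for n x
  have f_cont: "continuous (at_right x) (f n)" for n x
    unfolding f_def by (intro continuous_intros continuous_at_right_step)
  have f_mono: "mono (f n)" for n
    unfolding f_def by (intro monoI sum_mono mult_left_mono \<mu>_nonneg) auto
  have f_bdd: "\<bar>f n x\<bar> \<le> w 0 0" for n x
  proof -
    have "0 \<le> f n x" unfolding f_def by (intro sum_nonneg mult_nonneg_nonneg \<mu>_nonneg) auto
    moreover have "f n x \<le> (\<Sum>k\<le>n. \<mu> n k)"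
      unfolding f_def by (intro sum_mono) (simp add: \<mu>_nonneg)
    ultimately show ?thesis by (simp add: total)
  qed
  obtain s F where s: "strict_mono (s :: nat \<Rightarrow> nat)" and F: "mono F" "\<And>x. \<bar>F x\<bar> \<le> w 0 0"
    and conv: "\<And>x. isCont F x \<Longrightarrow> (\<lambda>n. f (s n) x) \<longlonglongrightarrow> F x"
    using Helly_selection[of f "w 0 0", OF f_cont f_mono f_bdd] by blast
  have "w N 0 = w 0 0 - integral\<^sup>L (lebesgue_on {a..b}) (\<lambda>x. real N / c * ((x - a) / c) ^ (N - 1) * F x)" for N
  proof -
    \<comment> \<open>The derivative of \<open>((x - a) / c) ^ N\<close>. Integrating it against a
      step at \<open>a + c * y\<close> gives \<open>1 - y ^ N\<close>, which is integration by parts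
      for a point mass. At \<open>N = 0\<close> the leading factor vanishes, so the truncated
      exponent does not matter.\<close>
    define g where "g x = real N / c * ((x - a) / c) ^ (N - 1)" for x
    have g_meas: "g \<in> borel_measurable borel"
      unfolding g_def by (intro borel_measurable_continuous_onI continuous_intros) (use c in auto)
    have g_bdd: "\<bar>g x\<bar> \<le> real N / c" if "x \<in> {a..b}" for x
    proof -
      have "((x - a) / c) ^ (N - 1) \<le> 1" "0 \<le> ((x - a) / c) ^ (N - 1)"
        using that c by (auto intro!: power_le_one simp: c_def)
      then show ?thesis using c by (simp add: g_def abs_mult mult_left_le divide_right_mono)
    qed
    have meas: "h \<in> borel_measurable borel" if "mono h" for h :: "real \<Rightarrow> real"
      by (rule borel_measurable_mono[OF that])
    have gh_bdd: "\<bar>g x * h x\<bar> \<le> real N / c * B" if "x \<in> {a..b}" "\<bar>h x\<bar> \<le> B" for h x and B :: real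
      unfolding abs_mult using that g_bdd c by (intro mult_mono) auto
    have step: "integral\<^sup>L (lebesgue_on {a..b}) (\<lambda>x. g x * (if a + c * y \<le> x then 1 else 0)) = 1 - y ^ N"
      "integrable (lebesgue_on {a..b}) (\<lambda>x. g x * (if a + c * y \<le> x then 1 else 0))"
      if y: "0 \<le> y" "y \<le> 1" for y
    proof -
      let ?h = "\<lambda>x. g x * (if a + c * y \<le> x then 1 else 0)"
      have "0 \<le> c * y" "c * y \<le> c" using y c by (simp_all add: mult_left_le)
      then have sub: "{a + c * y..b} \<subseteq> {a..b}" and ley: "a + c * y \<le> b"
        unfolding c_def atLeastatMost_subset_iff by linarith+
      show int: "integrable (lebesgue_on {a..b}) ?h"
      proof (rule integrable_lebesgue_on_bounded[OF _ gh_bdd[of _ _ 1]])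
        show "?h \<in> borel_measurable borel"
          by (intro borel_measurable_times g_meas meas) (auto intro!: monoI)
      qed auto
      have "(g has_integral ((b - a) / c) ^ N - ((a + c * y - a) / c) ^ N) {a + c * y..b}"
      proof (rule fundamental_theorem_of_calculus[OF ley])
        fix x
        have "((\<lambda>x. ((x - a) / c) ^ N) has_real_derivative g x) (at x within {a + c * y..b})"
        proof -
          have "((\<lambda>x. (x - a) / c) has_real_derivative 1 / c) (at x within {a + c * y..b})"
            using c by (auto intro!: derivative_eq_intros)
          from DERIV_power[OF this, of N] show ?thesis by (simp add: g_def)
        qed
        then show "((\<lambda>x. ((x - a) / c) ^ N) has_vector_derivative g x) (at x within {a + c * y..b})"
          by (simp only: has_real_derivative_iff_has_vector_derivative)
      qed
      then have "(g has_integral 1 - y ^ N) {a + c * y..b}" using c by (simp flip: c_def)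
      then have "((\<lambda>x. if x \<in> {a + c * y..b} then g x else 0) has_integral 1 - y ^ N) {a..b}"
        by (subst has_integral_restrict[OF sub])
      then have "(?h has_integral 1 - y ^ N) {a..b}"
        by (rule has_integral_eq[rotated]) auto
      then show "integral\<^sup>L (lebesgue_on {a..b}) ?h = 1 - y ^ N"
        by (subst lebesgue_integral_eq_integral[OF int]) (auto simp: integral_unique)
    qed
    have f_int: "integral\<^sup>L (lebesgue_on {a..b}) (\<lambda>x. g x * f n x)
        = w 0 0 - (\<Sum>k\<le>n. \<mu> n k * (real k / real n) ^ N)" for n
    proof -
      have y: "0 \<le> real k / real n" "real k / real n \<le> 1" if "k \<le> n" for k
        using that by (auto simp: divide_le_eq_1)
      have "integral\<^sup>L (lebesgue_on {a..b}) (\<lambda>x. g x * f n x)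
          = integral\<^sup>L (lebesgue_on {a..b}) (\<lambda>x. \<Sum>k\<le>n. \<mu> n k * (g x * (if a + c * (real k / real n) \<le> x then 1 else 0)))"
        unfolding f_def sum_distrib_left by (simp only: mult.left_commute)
      also have "\<dots> = (\<Sum>k\<le>n. \<mu> n k * (1 - (real k / real n) ^ N))"
        by (subst Bochner_Integration.integral_sum) (auto intro!: sum.cong simp: step y simp del: mult_if_delta times_divide_eq_right if_distrib)
      finally show ?thesis by (simp add: right_diff_distrib sum_subtractf total)
    qed
    have "(\<lambda>n. integral\<^sup>L (lebesgue_on {a..b}) (\<lambda>x. g x * f (s n) x))
        \<longlonglongrightarrow> integral\<^sup>L (lebesgue_on {a..b}) (\<lambda>x. g x * F x)"
    proof (rule integral_dominated_convergence)
      show "(\<lambda>x. g x * F x) \<in> borel_measurable (lebesgue_on {a..b})"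
        "(\<lambda>x. g x * f (s n) x) \<in> borel_measurable (lebesgue_on {a..b})" for n
        by (intro borel_measurable_lebesgue_on borel_measurable_times g_meas meas F f_mono)+
      show "integrable (lebesgue_on {a..b}) (\<lambda>x. real N / c * w 0 0)"
        by (rule integrable_lebesgue_on_bounded) auto
      \<comment> \<open>Helly's theorem gives convergence only where \<open>F\<close> is continuous;
        a monotone function is discontinuous on a countable set.\<close>
      have "AE x in lebesgue_on {a..b}. isCont F x"
        by (rule AE_lebesgue_on_isCont_mono[OF F(1)]) simp
      then show "AE x in lebesgue_on {a..b}. (\<lambda>n. g x * f (s n) x) \<longlonglongrightarrow> g x * F x"
        by eventually_elim (intro tendsto_intros conv)
      show "AE x in lebesgue_on {a..b}. norm (g x * f (s n) x) \<le> real N / c * w 0 0" for n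
        by (rule AE_I2) (use gh_bdd[where h = "f (s n)" and B = "w 0 0", OF _ f_bdd] in auto)
    qed
    moreover have "(\<lambda>n. integral\<^sup>L (lebesgue_on {a..b}) (\<lambda>x. g x * f (s n) x)) \<longlonglongrightarrow> w 0 0 - w N 0"
      unfolding f_int using LIMSEQ_subseq_LIMSEQ[OF lim s, of N] by (intro tendsto_intros) (simp add: o_def)
    ultimately have "integral\<^sup>L (lebesgue_on {a..b}) (\<lambda>x. g x * F x) = w 0 0 - w N 0"
      by (rule LIMSEQ_unique)
    then show ?thesis by (simp add: g_def)
  qed
  from that[OF F this[unfolded c_def]] show ?thesis .
qed

section \<open>Uniqueness from vanishing moments\<close>

lemma integrable_continuous_mult:
  fixes g h :: "real \<Rightarrow> real"
  assumes g: "continuous_on UNIV g" and h: "integrable (lebesgue_on {a..b}) h"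
  shows "integrable (lebesgue_on {a..b}) (\<lambda>x. g x * h x)"
proof -
  let ?M = "lebesgue_on {a..b}"
  have h_meas: "h \<in> borel_measurable ?M" using h by (rule borel_measurable_integrable)
  have "compact (g ` {a..b})"
    by (intro compact_continuous_image continuous_on_subset[OF g]) auto
  then obtain B where B: "\<And>x. x \<in> {a..b} \<Longrightarrow> \<bar>g x\<bar> \<le> B"
    by (metis bounded_iff compact_imp_bounded imageI real_norm_def)
  show ?thesis
  proof (rule Bochner_Integration.integrable_bound[of ?M "\<lambda>x. B * h x"])
    show "(\<lambda>x. g x * h x) \<in> borel_measurable ?M"
      using g by (intro borel_measurable_times h_meas borel_measurable_lebesgue_on borel_measurable_continuous_onI)
    show "AE x in ?M. norm (g x * h x) \<le> norm (B * h x)"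
      by (rule AE_I2) (use B in \<open>force simp: abs_mult intro!: mult_right_mono\<close>)
  qed (use h in simp)
qed

text \<open>By Weierstrass approximation \<open>h\<close> integrates to zero against every
  continuous function. Continuous functions converging almost everywhere to \<open>sgn (h x)\<close>
  then show that the integral of the absolute value of \<open>h\<close> is zero.\<close>

lemma AE_eq_0_if_moments_eq_0:
  fixes h :: "real \<Rightarrow> real"
  assumes h: "integrable (lebesgue_on {a..b}) h"
    and moments: "\<And>n. integral\<^sup>L (lebesgue_on {a..b}) (\<lambda>x. x ^ n * h x) = 0"
  shows "AE x in lebesgue_on {a..b}. h x = 0"
proof -
  let ?M = "lebesgue_on {a..b}"
  have h_meas: "h \<in> borel_measurable ?M" using h by (rule borel_measurable_integrable)
  note int = integrable_continuous_mult[OF _ h]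
  have poly: "integral\<^sup>L ?M (\<lambda>x. p x * h x) = 0" if poly: "real_polynomial_function p" for p
  proof -
    obtain c n where p: "p = (\<lambda>x. \<Sum>i\<le>n. c i * x ^ i)"
      using poly unfolding real_polynomial_function_iff_sum by blast
    have "integral\<^sup>L ?M (\<lambda>x. p x * h x) = integral\<^sup>L ?M (\<lambda>x. \<Sum>i\<le>n. c i * (x ^ i * h x))"
      by (simp add: p sum_distrib_right mult.assoc)
    also have "\<dots> = (\<Sum>i\<le>n. integral\<^sup>L ?M (\<lambda>x. c i * (x ^ i * h x)))"
      by (intro Bochner_Integration.integral_sum integrable_mult_right int continuous_intros)
    also have "\<dots> = 0" by (simp add: moments)
    finally show ?thesis .
  qed
  have cont: "integral\<^sup>L ?M (\<lambda>x. g x * h x) = 0" if g: "continuous_on UNIV g" for g :: "real \<Rightarrow> real"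
  proof -
    define K where "K = integral\<^sup>L ?M (\<lambda>x. \<bar>h x\<bar>)"
    have K: "0 \<le> K" by (simp add: K_def)
    have "\<bar>integral\<^sup>L ?M (\<lambda>x. g x * h x)\<bar> \<le> 0 + e" if e: "e > 0" for e
    proof -
      \<comment> \<open>The added one covers the case \<open>K = 0\<close>.\<close>
      define d where "d = e / (K + 1)"
      have d: "d > 0" using e K by (simp add: d_def)
      obtain p where p: "real_polynomial_function p" "\<And>x. x \<in> {a..b} \<Longrightarrow> \<bar>g x - p x\<bar> < d"
        using Stone_Weierstrass_real_polynomial_function[of "{a..b}" g d] continuous_on_subset[OF g] d by auto
      have p_cont: "continuous_on UNIV p" using p(1) by (auto simp: real_polynomial_function_iff_sum intro!: continuous_intros)
      have "integral\<^sup>L ?M (\<lambda>x. g x * h x) = integral\<^sup>L ?M (\<lambda>x. g x * h x) - integral\<^sup>L ?M (\<lambda>x. p x * h x)"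
        by (simp add: poly[OF p(1)])
      also have "\<dots> = integral\<^sup>L ?M (\<lambda>x. (g x - p x) * h x)"
        by (simp add: left_diff_distrib int g p_cont)
      also have "\<bar>\<dots>\<bar> \<le> integral\<^sup>L ?M (\<lambda>x. d * \<bar>h x\<bar>)"
      proof (rule order_trans[OF integral_abs_bound], rule integral_mono_AE)
        show "integrable ?M (\<lambda>x. \<bar>(g x - p x) * h x\<bar>)"
          by (intro integrable_abs int continuous_intros g p_cont)
        show "AE x in ?M. \<bar>(g x - p x) * h x\<bar> \<le> d * \<bar>h x\<bar>"
          by (rule AE_I2) (use p(2) in \<open>force simp: abs_mult intro!: mult_right_mono\<close>)
      qed (use h in simp)
      also have "\<dots> = d * K" by (simp add: K_def)
      also have "\<dots> \<le> e" using e K by (simp add: d_def field_simps)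
      finally show ?thesis by simp
    qed
    then have "\<bar>integral\<^sup>L ?M (\<lambda>x. g x * h x)\<bar> \<le> 0" by (rule field_le_epsilon)
    then show ?thesis by simp
  qed
  have "(\<lambda>x. sgn (h x)) \<in> borel_measurable ?M" using h_meas by measurable
  then have "(\<lambda>x. sgn (h x)) measurable_on {a..b}"
    by (simp add: measurable_on_iff_borel_measurable)
  then obtain N g where N: "negligible N" and g: "\<And>n :: nat. continuous_on UNIV (g n)"
    and lim: "\<And>x. x \<notin> N \<Longrightarrow> (\<lambda>n. g n x) \<longlonglongrightarrow> (if x \<in> {a..b} then sgn (h x) else 0)"
    unfolding measurable_on_def by blast
  \<comment> \<open>Truncation to values between -1 and 1 leaves the limit unchanged and makes the
    absolute value of \<open>h\<close> an integrable majorant.\<close>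
  define k where "k n x = max (-1) (min 1 (g n x))" for n x
  have k_cont: "continuous_on UNIV (k n)" for n
    unfolding k_def by (intro continuous_intros g)
  have "(\<lambda>n. integral\<^sup>L ?M (\<lambda>x. k n x * h x)) \<longlonglongrightarrow> integral\<^sup>L ?M (\<lambda>x. \<bar>h x\<bar>)"
  proof (rule integral_dominated_convergence)
    show "integrable ?M (\<lambda>x. \<bar>h x\<bar>)" "(\<lambda>x. \<bar>h x\<bar>) \<in> borel_measurable ?M"
      using h by auto
    show "(\<lambda>x. k n x * h x) \<in> borel_measurable ?M" for n
      by (rule borel_measurable_integrable[OF int[OF k_cont]])
    have "AE x in lebesgue. x \<notin> N"
      using N by (intro AE_not_in) (simp add: negligible_iff_null_sets)
    then have "AE x in ?M. x \<notin> N" by (subst AE_restrict_space_iff) (auto elim: AE_mp)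
    moreover have "AE x in ?M. x \<in> {a..b}" by (rule AE_I2) simp
    ultimately show "AE x in ?M. (\<lambda>n. k n x * h x) \<longlonglongrightarrow> \<bar>h x\<bar>"
    proof eventually_elim
      case (elim x)
      have "(\<lambda>n. k n x * h x) \<longlonglongrightarrow> max (-1) (min 1 (sgn (h x))) * h x"
        unfolding k_def using lim[OF elim(1)] elim(2) by (intro tendsto_intros) simp
      moreover have "max (-1) (min 1 (sgn (h x))) * h x = \<bar>h x\<bar>" by (simp add: sgn_real_def)
      ultimately show ?case by simp
    qed
    show "AE x in ?M. norm (k n x * h x) \<le> \<bar>h x\<bar>" for n
    proof (rule AE_I2)
      fix x
      have "\<bar>k n x\<bar> \<le> 1" by (auto simp: k_def)
      then show "norm (k n x * h x) \<le> \<bar>h x\<bar>" by (simp add: abs_mult mult_left_le_one_le)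
    qed
  qed
  then have "integral\<^sup>L ?M (\<lambda>x. \<bar>h x\<bar>) = 0"
    by (simp add: cont[OF k_cont] LIMSEQ_const_iff)
  then show ?thesis
    using h by (subst (asm) integral_nonneg_eq_0_iff_AE) auto
qed

section \<open>The trace formula\<close>

lemma words_zero: "words A 0 n (Suc k) = 0"
  by (induction n) simp_all

lemma power_remainder_zero: "power_remainder A 0 n = 0"
  unfolding power_remainder_def
  by (intro sum.neutral ballI) (metis add_Suc_right numeral_3_eq_3 words_zero)

lemma power_remainder_less_2: "n < 2 \<Longrightarrow> power_remainder A V n = 0"
  unfolding power_remainder_def by (intro sum.neutral ballI words_eq_0) simp

lemma words_self: "words A V n n = V ^ n"
  by (induction n) (simp_all add: words_eq_0)

lemma power_remainder_3: "power_remainder A V 3 = V ^ 3"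
proof -
  have "power_remainder A V 3 = (\<Sum>k\<in>{0}. words A V 3 (k + 3))"
    unfolding power_remainder_def by (rule sum.mono_neutral_right) (auto intro!: words_eq_0)
  then show ?thesis by (simp only: words_self) (simp add: words_self)
qed

text \<open>Written over all \<open>i\<close>: for \<open>i < 3\<close> the product of the three
  factors is zero, which masks the truncated exponent.\<close>

lemma poly_pderiv_3:
  fixes q :: "complex poly"
  shows "poly ((pderiv ^^ 3) q) u
    = (\<Sum>i\<le>degree q. coeff q i * (of_nat i * (of_nat i - 1) * (of_nat i - 2) * u ^ (i - 3)))"
proof -
  have monom: "(pderiv ^^ 3) (monom (c :: complex) i) = monom (of_nat i * (of_nat i - 1) * (of_nat i - 2) * c) (i - 3)" for c i
  proof (cases "i < 3")
    case True
    then have "i = 0 \<or> i = 1 \<or> i = 2" by auto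
    then show ?thesis by (auto simp: numeral_3_eq_3 pderiv_monom)
  next
    case False
    then obtain j where "i = 3 + j" using le_Suc_ex[of 3 i] by auto
    then have "i = Suc (Suc (Suc j))" by simp
    then show ?thesis by (simp add: numeral_3_eq_3 pderiv_monom algebra_simps)
  qed
  have "poly ((pderiv ^^ 3) (\<Sum>i\<le>degree q. monom (coeff q i) i)) u
      = (\<Sum>i\<le>degree q. coeff q i * (of_nat i * (of_nat i - 1) * (of_nat i - 2) * u ^ (i - 3)))"
    unfolding higher_pderiv_sum monom by (simp add: poly_sum poly_monom ac_simps)
  then show ?thesis by (simp only: poly_as_sum_of_monoms)
qed

lemma pderiv_funpow_pcompose_linear:
  "(pderiv ^^ n) (pcompose p [:a, c:]) = smult (c ^ n) (pcompose ((pderiv ^^ n) p) [:a, c:])"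
proof (induction n)
  case (Suc n)
  have "pderiv (pcompose r [:a, c:]) = smult c (pcompose (pderiv r) [:a, c:])" for r
    by (simp add: pderiv_pcompose pderiv_pCons)
  then show ?case by (simp add: Suc pderiv_smult mult.commute)
qed simp

lemma positive_op_affine:
  assumes A: "self_adjoint A" and c: "c > 0"
    and "\<And>x. a * (norm x)\<^sup>2 \<le> Re (cinner (A *V x) x)" "\<And>x. Re (cinner (A *V x) x) \<le> (a + c) * (norm x)\<^sup>2"
  shows "positive_op ((1 / c) *\<^sub>R (A - a *\<^sub>R 1))" "positive_op (1 - (1 / c) *\<^sub>R (A - a *\<^sub>R 1))"
proof -
  let ?B = "(1 / c) *\<^sub>R (A - a *\<^sub>R 1)"
  have sa: "self_adjoint ?B"
    by (intro self_adjoint_scaleR self_adjoint_diff self_adjoint_one A)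
  have q: "Re (cinner (?B *V x) x) = (Re (cinner (A *V x) x) - a * (norm x)\<^sup>2) / c" for x
    by (simp add: bop_apply_simps cinner.scaleR_left cinner.diff_left cinner_self del: of_real_power)
  show "positive_op ?B"
    using sa assms(3) c by (simp add: positive_op_def q)
  have "Re (cinner ((1 - ?B) *V x) x) = ((a + c) * (norm x)\<^sup>2 - Re (cinner (A *V x) x)) / c" for x
    using c by (simp add: bop_apply_simps(2,6) cinner.diff_left q) (simp add: cinner_self field_simps del: of_real_power)
  then show "positive_op (1 - ?B)"
    using self_adjoint_diff[OF self_adjoint_one sa] assms(4) c by (simp add: positive_op_def)
qed

context onb_space
begin

lemma nuclear_taylor_remainder: "hs V \<Longrightarrow> nuclear (taylor_remainder p A V)"
  unfolding taylor_remainder_eq by (intro nuclear_sum nuclear_scaleC nuclear_power_remainder)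

lemma tr_taylor_remainder:
  "hs V \<Longrightarrow> tr (taylor_remainder p A V) = (\<Sum>i\<le>degree p. coeff p i * tr (power_remainder A V i))"
  unfolding taylor_remainder_eq
  by (subst tr_sum) (simp_all add: nuclear_scaleC nuclear_power_remainder tr_scaleC)

lemma tr_taylor_remainder_cube: "hs V \<Longrightarrow> tr (taylor_remainder (monom 1 3) A V) = tr (V ^ 3)"
  by (simp add: tr_taylor_remainder degree_monom_eq power_remainder_3 coeff_monom if_distrib[of "\<lambda>c. c * _"] cong: if_cong)

proposition trace_formula_exists:
  assumes A: "self_adjoint A" and V: "self_adjoint V" "hs V" and ab: "a < b"
    and lower: "\<And>x. (a + norm V) * (norm x)\<^sup>2 \<le> Re (cinner (A *V x) x)"
    and upper: "\<And>x. Re (cinner (A *V x) x) \<le> (b - norm V) * (norm x)\<^sup>2"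
  obtains \<eta> where "integrable (lebesgue_on {a..b}) \<eta>"
    "\<And>p. tr (taylor_remainder p A V) =
      (\<integral>l. poly ((pderiv ^^ 3) p) (complex_of_real l) * complex_of_real (\<eta> l) \<partial>lebesgue_on {a..b})"
proof -
  let ?M = "lebesgue_on {a..b}"
  define c where "c = b - a"
  have c: "c > 0" using ab by (simp add: c_def)
  define A' V' where "A' = (1 / c) *\<^sub>R (A - a *\<^sub>R 1)" and "V' = (1 / c) *\<^sub>R V"
  have A': "self_adjoint A'"
    unfolding A'_def by (intro self_adjoint_scaleR self_adjoint_diff self_adjoint_one A)
  have V': "self_adjoint V'" "hs V'"
    unfolding V'_def by (intro self_adjoint_scaleR hs_scaleR V)+
  have pos: "positive_op (A' + t *\<^sub>R V')" "positive_op (1 - (A' + t *\<^sub>R V'))" if t: "t \<in> {0..1}" for t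
  proof -
    let ?T = "A + t *\<^sub>R V"
    have T: "self_adjoint ?T" by (intro self_adjoint_add self_adjoint_scaleR A V)
    have eq: "A' + t *\<^sub>R V' = (1 / c) *\<^sub>R (?T - a *\<^sub>R 1)"
      by (simp add: A'_def V'_def algebra_simps)
    \<comment> \<open>The perturbation moves the quadratic form by at most this amount, exactly what
      the margin \<open>norm V\<close> in \<open>lower\<close> and \<open>upper\<close> allows
      for.\<close>
    have tV: "\<bar>t * Re (cinner (V *V x) x)\<bar> \<le> norm V * (norm x)\<^sup>2" for x
    proof -
      have "\<bar>t * Re (cinner (V *V x) x)\<bar> \<le> 1 * (norm V * (norm x)\<^sup>2)"
        unfolding abs_mult using t by (intro mult_mono Re_cinner_le) auto
      then show ?thesis by simp
    qed
    have "Re (cinner (?T *V x) x) = Re (cinner (A *V x) x) + t * Re (cinner (V *V x) x)" for x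
      by (simp add: bop_apply_simps cinner.add_left cinner.scaleR_left)
    then have "a * (norm x)\<^sup>2 \<le> Re (cinner (?T *V x) x)" "Re (cinner (?T *V x) x) \<le> (a + c) * (norm x)\<^sup>2" for x
      using lower[of x] upper[of x] tV[of x] by (auto simp: c_def algebra_simps abs_le_iff)
    from positive_op_affine[OF T c this]
    show "positive_op (A' + t *\<^sub>R V')" "positive_op (1 - (A' + t *\<^sub>R V'))"
      unfolding eq by auto
  qed
  obtain w1 w2 :: "nat \<Rightarrow> nat \<Rightarrow> real"
    where w1: "\<And>k l. 0 \<le> w1 k l" "\<And>k l. w1 k l = w1 (Suc k) l + w1 k (Suc l)"
      and w2: "\<And>k l. 0 \<le> w2 k l" "\<And>k l. w2 k l = w2 (Suc k) l + w2 k (Suc l)"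
      and w00: "w1 0 0 = w2 0 0"
      and w: "\<And>N. tr (power_remainder A' V' (N + 2)) = complex_of_real (real (N + 2) * real (N + 1) * (w1 N 0 - w2 N 0))"
    using tr_power_remainder_weights[OF A' V' pos] by metis
  define u where "u x = (x - a) / c" for x
  obtain F1 where F1: "mono F1" "\<And>x. \<bar>F1 x\<bar> \<le> w1 0 0"
    and w1F: "\<And>N. w1 N 0 = w1 0 0 - integral\<^sup>L ?M (\<lambda>x. real N / c * u x ^ (N - 1) * F1 x)"
    by (rule hausdorff_moments[of w1 a b, OF w1 ab, folded c_def, folded u_def]) (rule that)
  obtain F2 where F2: "mono F2" "\<And>x. \<bar>F2 x\<bar> \<le> w2 0 0"
    and w2F: "\<And>N. w2 N 0 = w2 0 0 - integral\<^sup>L ?M (\<lambda>x. real N / c * u x ^ (N - 1) * F2 x)"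
    by (rule hausdorff_moments[of w2 a b, OF w2 ab, folded c_def, folded u_def]) (rule that)
  \<comment> \<open>The order of \<open>F2\<close> and \<open>F1\<close> reflects the sign in the
    integration by parts. The third derivative of the rescaled polynomial contributes
    \<open>c ^ 3\<close> and the derivative of \<open>u\<close> a factor \<open>1 / c\<close>, which
    leaves \<open>c\<^sup>2\<close>.\<close>
  define \<eta> where "\<eta> x = c\<^sup>2 * (F2 x - F1 x)" for x
  have u_bdd: "\<bar>u x ^ n\<bar> \<le> 1" if "x \<in> {a..b}" for x n
  proof -
    have "0 \<le> u x" "u x \<le> 1" using that c by (auto simp: u_def c_def)
    then show ?thesis by (simp add: power_abs power_le_one)
  qed
  have u_meas: "(\<lambda>x. u x ^ n) \<in> borel_measurable borel" for n
    unfolding u_def by (intro borel_measurable_continuous_onI continuous_intros) (use c in auto)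
  have uF_int: "integrable ?M (\<lambda>x. r * u x ^ n * F x)" if F: "mono F" "\<And>x. \<bar>F x\<bar> \<le> B" for F :: "real \<Rightarrow> real" and B n r
  proof (rule integrable_lebesgue_on_bounded)
    show "(\<lambda>x. r * u x ^ n * F x) \<in> borel_measurable borel"
      by (intro borel_measurable_times borel_measurable_const u_meas borel_measurable_mono F)
    fix x assume "x \<in> {a..b}"
    then show "\<bar>r * u x ^ n * F x\<bar> \<le> \<bar>r\<bar> * 1 * B"
      unfolding abs_mult by (intro mult_mono u_bdd[unfolded abs_mult] F order_refl mult_nonneg_nonneg) auto
  qed
  have \<eta>_int: "integrable ?M \<eta>"
    using uF_int[OF F2, of "c\<^sup>2" 0] uF_int[OF F1, of "c\<^sup>2" 0] by (simp add: \<eta>_def[abs_def] right_diff_distrib)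
  have tr_moment: "tr (power_remainder A' V' i) = complex_of_real
      (integral\<^sup>L ?M (\<lambda>x. (real i * (real i - 1) * (real i - 2) / c) * u x ^ (i - 3) * (F2 x - F1 x)))" for i
  proof (cases "i < 2")
    case True
    then have "real i * (real i - 1) = 0" by (auto simp: less_2_cases_iff)
    then show ?thesis using True by (simp add: power_remainder_less_2 tr_zero)
  next
    case False
    then obtain N where i: "i = N + 2" by (metis add.commute le_Suc_ex not_less)
    have "w1 N 0 - w2 N 0 = integral\<^sup>L ?M (\<lambda>x. real N / c * u x ^ (N - 1) * F2 x)
        - integral\<^sup>L ?M (\<lambda>x. real N / c * u x ^ (N - 1) * F1 x)"
      using w1F[of N] w2F[of N] w00 by simp
    also have "\<dots> = integral\<^sup>L ?M (\<lambda>x. real N / c * u x ^ (N - 1) * (F2 x - F1 x))"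
      by (simp add: right_diff_distrib uF_int[OF F2] uF_int[OF F1])
    finally have "real (N + 2) * real (N + 1) * (w1 N 0 - w2 N 0)
        = integral\<^sup>L ?M (\<lambda>x. real (N + 2) * real (N + 1) * (real N / c * u x ^ (N - 1) * (F2 x - F1 x)))"
      by simp
    \<comment> \<open>This includes \<open>N = 0\<close>: both truncated exponents are then zero,
      and so are both coefficients.\<close>
    also have "(\<lambda>x. real (N + 2) * real (N + 1) * (real N / c * u x ^ (N - 1) * (F2 x - F1 x)))
        = (\<lambda>x. (real i * (real i - 1) * (real i - 2) / c) * u x ^ (i - 3) * (F2 x - F1 x))"
      by (simp add: i fun_eq_iff add.commute[of 2])
    finally show ?thesis using w[of N] by (simp add: i)
  qed
  have "tr (taylor_remainder p A V) =
      (\<integral>l. poly ((pderiv ^^ 3) p) (complex_of_real l) * complex_of_real (\<eta> l) \<partial>?M)" for p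
  proof -
    define q where "q = pcompose p [:complex_of_real a, complex_of_real c:]"
    let ?f = "\<lambda>i x. (real i * (real i - 1) * (real i - 2) / c) * u x ^ (i - 3) * (F2 x - F1 x)"
    have f_int: "integrable ?M (?f i)" for i
      unfolding right_diff_distrib[of "_ / c * _"]
      by (intro Bochner_Integration.integrable_diff uF_int[OF F1] uF_int[OF F2])
    have "tr (taylor_remainder p A V) = tr (taylor_remainder q A' V')"
      using taylor_remainder_affine[of c p A V a] c by (simp add: q_def A'_def V'_def)
    also have "\<dots> = (\<Sum>i\<le>degree q. coeff q i * complex_of_real (integral\<^sup>L ?M (?f i)))"
      by (simp only: tr_taylor_remainder[OF V'(2)] tr_moment)
    also have "\<dots> = (\<Sum>i\<le>degree q. \<integral>x. coeff q i * complex_of_real (?f i x) \<partial>?M)"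
      by (intro sum.cong refl)
        (simp only: integral_complex_of_real[symmetric] integral_mult_right_zero)
    also have "\<dots> = (\<integral>x. (\<Sum>i\<le>degree q. coeff q i * complex_of_real (?f i x)) \<partial>?M)"
      by (rule Bochner_Integration.integral_sum[symmetric])
        (intro integrable_mult_right integrable_of_real f_int)
    also have "\<dots> = (\<integral>x. poly ((pderiv ^^ 3) p) (complex_of_real x) * complex_of_real (\<eta> x) \<partial>?M)"
    proof (rule Bochner_Integration.integral_cong[OF refl])
      fix x
      have "complex_of_real a + complex_of_real (u x) * complex_of_real c = complex_of_real x"
        using c by (simp add: u_def flip: of_real_mult of_real_add)
      then have q: "poly ((pderiv ^^ 3) q) (complex_of_real (u x)) = complex_of_real (c ^ 3) * poly ((pderiv ^^ 3) p) (complex_of_real x)"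
        by (simp add: q_def pderiv_funpow_pcompose_linear poly_pcompose)
      have "(\<Sum>i\<le>degree q. coeff q i * complex_of_real (?f i x))
          = poly ((pderiv ^^ 3) q) (complex_of_real (u x)) * complex_of_real ((F2 x - F1 x) / c)"
        unfolding poly_pderiv_3 sum_distrib_right by (intro sum.cong refl) simp
      also have "\<dots> = poly ((pderiv ^^ 3) p) (complex_of_real x) * (complex_of_real (c ^ 3) * complex_of_real ((F2 x - F1 x) / c))"
        by (simp only: q ac_simps)
      also have "complex_of_real (c ^ 3) * complex_of_real ((F2 x - F1 x) / c) = complex_of_real (\<eta> x)"
        unfolding of_real_mult[symmetric] using c by (simp add: \<eta>_def power3_eq_cube power2_eq_square)
      finally show "(\<Sum>i\<le>degree q. coeff q i * complex_of_real (?f i x))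
          = poly ((pderiv ^^ 3) p) (complex_of_real x) * complex_of_real (\<eta> x)" .
    qed
    finally show ?thesis .
  qed
  with \<eta>_int show ?thesis by (rule that)
qed

end

theorem theorem2p5:
  fixes A V :: "'a::chilbert_space bop" and a b :: real
  assumes separable: "separable_space (euclidean :: 'a topology)"
    and infinite_dim: "\<nexists>B :: 'a set. finite B \<and> complex_vector.span B = UNIV"
    and A: "self_adjoint A"
    and V: "self_adjoint V" "hilbert_schmidt V"
    and a: "a = Inf (Re ` spectrum A) - norm V"
    and b: "b = Sup (Re ` spectrum A) + norm V"
  shows "(\<forall>p. trace_class (taylor_remainder p A V)) \<and> trace_class (V ^ 3) \<and>
    (let trace_formula = (\<lambda>\<eta> :: real \<Rightarrow> real. \<forall>p :: complex poly.
        trace_op (taylor_remainder p A V) =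
          (\<integral>l. poly ((pderiv ^^ 3) p) (complex_of_real l) * complex_of_real (\<eta> l)
             \<partial>lebesgue_on {a..b}))
     in \<exists>\<eta>. integrable (lebesgue_on {a..b}) \<eta> \<and> trace_formula \<eta> \<and>
          (\<forall>\<eta>'. integrable (lebesgue_on {a..b}) \<eta>' \<and> trace_formula \<eta>' \<longrightarrow>
             (AE l in lebesgue_on {a..b}. \<eta>' l = \<eta> l)) \<and>
          complex_of_real (\<integral>l. \<eta> l \<partial>lebesgue_on {a..b}) = 1/6 * trace_op (V ^ 3))"
proof -
  interpret onb_space "SOME E :: 'a set. is_onb E"
    by unfold_locales (rule someI_ex[OF is_onb_exists])
  let ?M = "lebesgue_on {a..b}"
  have trace_op: "trace_op T = tr T" for T :: "'a bop" by (simp add: trace_op_def tr_def)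
  have hsV: "hs V" by (rule hs_if_self_adjoint_hilbert_schmidt[OF V])
  have nontriv: "\<exists>x :: 'a. x \<noteq> 0"
    using infinite_dim complex_vector.span_empty by (metis UNIV_eq_I finite.emptyI singletonI)
  note bounds = spectrum_bounds[OF A nontriv]
  have "\<exists>\<eta>. integrable ?M \<eta> \<and> (\<forall>p. tr (taylor_remainder p A V) =
      (\<integral>l. poly ((pderiv ^^ 3) p) (complex_of_real l) * complex_of_real (\<eta> l) \<partial>?M))"
  \<comment> \<open>Only for \<open>V = 0\<close> can the interval degenerate, for instance if
    \<open>A\<close> is a real multiple of the identity; then every remainder is zero.\<close>
  proof (cases "V = 0")
    case True
    then show ?thesis
      by (intro exI[of _ "\<lambda>_. 0"]) (simp add: taylor_remainder_eq power_remainder_zero tr_zero)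
  next
    case False
    then have "norm V > 0" by simp
    then have ab: "a < b" using bounds(3) unfolding a b by linarith
    have lower: "(a + norm V) * (norm x)\<^sup>2 \<le> Re (cinner (A *V x) x)"
      and upper: "Re (cinner (A *V x) x) \<le> (b - norm V) * (norm x)\<^sup>2" for x
      using bounds(1,2)[of x] by (simp_all add: a b)
    obtain \<eta> where "integrable ?M \<eta>" "\<And>p. tr (taylor_remainder p A V) =
        (\<integral>l. poly ((pderiv ^^ 3) p) (complex_of_real l) * complex_of_real (\<eta> l) \<partial>?M)"
      by (rule trace_formula_exists[OF A V(1) hsV ab lower upper]) (rule that)
    then show ?thesis by blast
  qed
  then obtain \<eta> where \<eta>: "integrable ?M \<eta>" and formula: "\<And>p. tr (taylor_remainder p A V) =
      (\<integral>l. poly ((pderiv ^^ 3) p) (complex_of_real l) * complex_of_real (\<eta> l) \<partial>?M)"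
    by blast
  have unique: "AE l in ?M. \<eta>' l = \<eta> l"
    if \<eta>': "integrable ?M \<eta>'" and formula': "\<And>p. tr (taylor_remainder p A V) =
      (\<integral>l. poly ((pderiv ^^ 3) p) (complex_of_real l) * complex_of_real (\<eta>' l) \<partial>?M)" for \<eta>'
  proof -
    have "integral\<^sup>L ?M (\<lambda>x. x ^ n * (\<eta>' x - \<eta> x)) = 0" for n
    proof -
      \<comment> \<open>The third derivative of \<open>x ^ (n + 3)\<close> is
        \<open>d * x ^ n\<close>, so the trace formula prescribes every moment of \<eta>.\<close>
      define d where "d = real (n + 3) * real (n + 2) * real (n + 1)"
      have eval: "poly ((pderiv ^^ 3) (monom 1 (n + 3))) (complex_of_real l) = complex_of_real (d * l ^ n)" for l
        by (simp add: numeral_3_eq_3 pderiv_monom poly_monom d_def algebra_simps)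
      have int: "integrable ?M (\<lambda>x. x ^ n * h x)" if "integrable ?M h" for h :: "real \<Rightarrow> real"
        by (intro integrable_continuous_mult that continuous_intros)
      have "complex_of_real (integral\<^sup>L ?M (\<lambda>x. d * (x ^ n * \<eta>' x))) = complex_of_real (integral\<^sup>L ?M (\<lambda>x. d * (x ^ n * \<eta> x)))"
        using formula[of "monom 1 (n + 3)"] formula'[of "monom 1 (n + 3)"]
        unfolding eval of_real_mult[symmetric] integral_complex_of_real mult.assoc by simp
      then have "d * integral\<^sup>L ?M (\<lambda>x. x ^ n * \<eta>' x) = d * integral\<^sup>L ?M (\<lambda>x. x ^ n * \<eta> x)"
        by (simp only: of_real_eq_iff integral_mult_right_zero)
      moreover have "d \<noteq> 0" by (simp add: d_def)
      ultimately show ?thesis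
        by (simp add: right_diff_distrib int \<eta> \<eta>')
    qed
    then have "AE x in ?M. \<eta>' x - \<eta> x = 0"
      by (intro AE_eq_0_if_moments_eq_0 Bochner_Integration.integrable_diff \<eta> \<eta>')
    then show ?thesis by simp
  qed
  \<comment> \<open>For \<open>p = x ^ 3\<close> the third derivative is the constant 6 and the
    remainder is \<open>V ^ 3\<close>; this is the origin of the factor \<open>1/6\<close>.\<close>
  have "tr (V ^ 3) = (\<integral>l. 6 * complex_of_real (\<eta> l) \<partial>?M)"
    using formula[of "monom 1 3"] tr_taylor_remainder_cube[OF hsV, of A]
    by (simp add: numeral_3_eq_3 pderiv_monom poly_monom)
  then have cube: "complex_of_real (\<integral>l. \<eta> l \<partial>?M) = 1/6 * tr (V ^ 3)"
    by simp
  have "nuclear (V ^ 3)"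
    unfolding power3_eq_cube by (intro nuclear_mult hs_mult_left hsV)
  then show ?thesis
    unfolding Let_def trace_op
    using nuclear_trace_class nuclear_taylor_remainder[OF hsV] \<eta> formula unique cube by blast
qed

end
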